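(* Let $(\Omega,\mathcal{F},\mu)$ be a probability space, let $\rho_1,\rho_2:L^\infty(\mu)\to\mathbb{R}$ be convex expectations, let $K_1,K_2\in L^\infty(\mu)$ with $0\le K_1<K_2$, and let $\alpha\in\mathbb{R}$ with $\rho_1(K_1)\le\alpha\le\rho_1(K_2)$. Suppose $\rho_1$ and $\rho_2$ are continuous from below, and suppose that there exist constants $u>\max\{0,M-\rho_1(0)+1\}$ and $v>\max\{0,M-\rho_2(0)+1\}$ such that the level sets $\mathcal{G}_u$ and $\mathcal{H}_v$ are both closed under $\mu$-a.e. convergence. Then there exist $P^*\in\mathcal{P}$ and $Q^*\in\mathcal{Q}$ such that every optimal test $X^*$ can be expressed as $$X^*=K_2 I_{\{H_{Q^*}>zG_{P^*}\}}+B\,I_{\{H_{Q^*}=zG_{P^*}\}}+K_1 I_{\{H_{Q^*}<zG_{P^*}\}},\quad \mu\text{-a.e.},$$ for some $z\in[0,+\infty)\cup\{+\infty\}$ and some random variable $B$ taking values in the random interval $[K_1,K_2]$.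
   Context: (In)equalities between random variables are understood $\mu$-a.e.; $I_A$ is the indicator of $A$. A mapping $\rho:L^\infty(\mu)\to\mathbb{R}$ is a convex expectation if for all $X,Y\in L^\infty(\mu)$: (i) $X\ge Y$ implies $\rho(X)\ge\rho(Y)$; (ii) $\rho(X+c)=\rho(X)+c$ for every constant $c$; (iii) $\rho(\lambda X+(1-\lambda)Y)\le\lambda\rho(X)+(1-\lambda)\rho(Y)$ for $\lambda\in[0,1]$. It is continuous from below if $\rho(X_n)\to\rho(X)$ whenever $(X_n)_{n\ge1}\subset L^\infty(\mu)$ increases to some $X\in L^\infty(\mu)$. $\mathcal{M}$ is the set of probability measures on $(\Omega,\mathcal{F})$ absolutely continuous with respect to $\mu$; $G_P=\frac{dP}{d\mu}$, $H_Q=\frac{dQ}{d\mu}$. The penalty function of $\rho$ is $\rho^*(P)=\sup_{X\in L^\infty(\mu)}(E_P[X]-\rho(X))\in(-\infty,+\infty]$, $P\in\mathcal{M}$. Put $\mathcal{P}=\{P\in\mathcal{M}:\rho_1^*(P)<\infty\}$, $\mathcal{Q}=\{Q\in\mathcal{M}:\rho_2^*(Q)<\infty\}$, $\mathcal{G}_c=\{G_P:P\in\mathcal{P},\ \rho_1^*(P)\le c\}$, $\mathcal{H}_c=\{H_Q:Q\in\mathcal{Q},\ \rho_2^*(Q)\le c\}$ for a constant $c$. $M$ denotes the least (essential) upper bound of $K_1$ and $K_2$, i.e. $M=\|K_2\|_{L^\infty(\mu)}$. A set of random variables is closed under $\mu$-a.e. convergence if whenever a sequence in it converges $\mu$-a.e.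 to a random variable, that limit belongs to it. $\mathcal{X}_\alpha=\{X\in L^\infty(\mu):K_1\le X\le K_2,\ \rho_1(X)\le\alpha\}$. An optimal test is an $X^*\in\mathcal{X}_\alpha$ with $\rho_2(K_2-X^* )=\inf_{X\in\mathcal{X}_\alpha}\rho_2(K_2-X)$. Convention for $z=+\infty$: comparing $H_{Q^*}$ with $zG_{P^*}$ means comparing $z^{-1}H_{Q^*}$ with $G_{P^*}$ where $z^{-1}=0$; i.e. $\{H_{Q^*}>zG_{P^*}\}=\emptyset$, $\{H_{Q^*}=zG_{P^*}\}=\{G_{P^*}=0\}$, $\{H_{Q^*}<zG_{P^*}\}=\{G_{P^*}>0\}$. *)

theory Defs
  imports "HOL-Probability.Probability" "HOL-Probability.Essential_Supremum"
begin

text \<open>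
  Elements of \<open>L\<^sup>\<infinity>(\<mu>)\<close> are represented by functions rather than by equivalence classes; accordingly
  (in)equalities between them are always almost-everywhere (in)equalities.
\<close>

definition Linf :: "'a measure \<Rightarrow> ('a \<Rightarrow> real) set" where
  "Linf \<mu> = {X \<in> borel_measurable \<mu>. \<exists>C. AE \<omega> in \<mu>. \<bar>X \<omega>\<bar> \<le> C}"

definition Linf_norm :: "'a measure \<Rightarrow> ('a \<Rightarrow> real) \<Rightarrow> real" where
  "Linf_norm \<mu> X = real_of_ereal (esssup \<mu> (\<lambda>\<omega>. ereal \<bar>X \<omega>\<bar>))"

text \<open>
  Monotonicity with respect to the a.e. order forces \<open>\<rho>\<close> to agree on a.e. equal functions, so \<open>\<rho>\<close> is a
  functional on the quotient; its values outside \<open>Linf \<mu>\<close> are irrelevant.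
\<close>

definition convex_expectation :: "'a measure \<Rightarrow> (('a \<Rightarrow> real) \<Rightarrow> real) \<Rightarrow> bool" where
  "convex_expectation \<mu> \<rho> \<longleftrightarrow>
     (\<forall>X\<in>Linf \<mu>. \<forall>Y\<in>Linf \<mu>. (AE \<omega> in \<mu>. X \<omega> \<ge> Y \<omega>) \<longrightarrow> \<rho> X \<ge> \<rho> Y) \<and>
     (\<forall>X\<in>Linf \<mu>. \<forall>c. \<rho> (\<lambda>\<omega>. X \<omega> + c) = \<rho> X + c) \<and>
     (\<forall>X\<in>Linf \<mu>. \<forall>Y\<in>Linf \<mu>. \<forall>l\<in>{0..1}.
        \<rho> (\<lambda>\<omega>. l * X \<omega> + (1 - l) * Y \<omega>) \<le> l * \<rho> X + (1 - l) * \<rho> Y)"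

definition continuous_from_below :: "'a measure \<Rightarrow> (('a \<Rightarrow> real) \<Rightarrow> real) \<Rightarrow> bool" where
  "continuous_from_below \<mu> \<rho> \<longleftrightarrow>
     (\<forall>Xs X. (\<forall>n::nat. Xs n \<in> Linf \<mu>) \<longrightarrow> X \<in> Linf \<mu> \<longrightarrow>
        (\<forall>n. AE \<omega> in \<mu>. Xs n \<omega> \<le> Xs (Suc n) \<omega>) \<longrightarrow>
        (AE \<omega> in \<mu>. (\<lambda>n. Xs n \<omega>) \<longlonglongrightarrow> X \<omega>) \<longrightarrow>
        (\<lambda>n. \<rho> (Xs n)) \<longlonglongrightarrow> \<rho> X)"

definition ac_probs :: "'a measure \<Rightarrow> 'a measure set" where
  "ac_probs \<mu> = {P. prob_space P \<and> sets P = sets \<mu> \<and> absolutely_continuous \<mu> P}"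

definition dens :: "'a measure \<Rightarrow> 'a measure \<Rightarrow> 'a \<Rightarrow> real" where
  "dens \<mu> P \<omega> = enn2real (RN_deriv \<mu> P \<omega>)"

definition penalty :: "'a measure \<Rightarrow> (('a \<Rightarrow> real) \<Rightarrow> real) \<Rightarrow> 'a measure \<Rightarrow> ereal" where
  "penalty \<mu> \<rho> P = (SUP X\<in>Linf \<mu>. ereal ((LINT \<omega>|P. X \<omega>) - \<rho> X))"

definition finite_penalty_probs :: "'a measure \<Rightarrow> (('a \<Rightarrow> real) \<Rightarrow> real) \<Rightarrow> 'a measure set" where
  "finite_penalty_probs \<mu> \<rho> = {P \<in> ac_probs \<mu>. penalty \<mu> \<rho> P < \<infinity>}"

text \<open>The set of densities is closed under a.e. equality, as a set of random variables modulo \<open>\<mu>\<close>.\<close>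

definition density_level_set ::
  "'a measure \<Rightarrow> (('a \<Rightarrow> real) \<Rightarrow> real) \<Rightarrow> real \<Rightarrow> ('a \<Rightarrow> real) set" where
  "density_level_set \<mu> \<rho> c =
     {g \<in> borel_measurable \<mu>. \<exists>P\<in>finite_penalty_probs \<mu> \<rho>.
        penalty \<mu> \<rho> P \<le> ereal c \<and> (AE \<omega> in \<mu>. g \<omega> = dens \<mu> P \<omega>)}"

definition closed_under_ae_convergence :: "'a measure \<Rightarrow> ('a \<Rightarrow> real) set \<Rightarrow> bool" where
  "closed_under_ae_convergence \<mu> S \<longleftrightarrow>
     (\<forall>Xs X. (\<forall>n::nat. Xs n \<in> S) \<longrightarrow> X \<in> borel_measurable \<mu> \<longrightarrow>
        (AE \<omega> in \<mu>. (\<lambda>n. Xs n \<omega>) \<longlonglongrightarrow> X \<omega>) \<longrightarrow> X \<in> S)"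

definition tests ::
  "'a measure \<Rightarrow> (('a \<Rightarrow> real) \<Rightarrow> real) \<Rightarrow> ('a \<Rightarrow> real) \<Rightarrow> ('a \<Rightarrow> real) \<Rightarrow> real \<Rightarrow> ('a \<Rightarrow> real) set" where
  "tests \<mu> \<rho>1 K1 K2 \<alpha> =
     {X \<in> Linf \<mu>. (AE \<omega> in \<mu>. K1 \<omega> \<le> X \<omega> \<and> X \<omega> \<le> K2 \<omega>) \<and> \<rho>1 X \<le> \<alpha>}"

text \<open>
  The infimum is taken in the reals: when \<open>\<rho>1 K1 \<le> \<alpha>\<close>, the set of tests contains \<open>K1\<close> and the
  objective is bounded below by \<open>\<rho>2 0\<close>.
\<close>

definition optimal_test ::
  "'a measure \<Rightarrow> (('a \<Rightarrow> real) \<Rightarrow> real) \<Rightarrow> (('a \<Rightarrow> real) \<Rightarrow> real) \<Rightarrow>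
     ('a \<Rightarrow> real) \<Rightarrow> ('a \<Rightarrow> real) \<Rightarrow> real \<Rightarrow> ('a \<Rightarrow> real) \<Rightarrow> bool" where
  "optimal_test \<mu> \<rho>1 \<rho>2 K1 K2 \<alpha> X \<longleftrightarrow>
     X \<in> tests \<mu> \<rho>1 K1 K2 \<alpha> \<and>
     \<rho>2 (\<lambda>\<omega>. K2 \<omega> - X \<omega>) = (INF Y\<in>tests \<mu> \<rho>1 K1 K2 \<alpha>. \<rho>2 (\<lambda>\<omega>. K2 \<omega> - Y \<omega>))"

text \<open>
  The sets \<open>{H > z G}\<close>, \<open>{H = z G}\<close>, \<open>{H < z G}\<close> for \<open>z \<in> [0, \<infinity>]\<close>. For \<open>z = \<infinity>\<close> one compares
  \<open>z\<^sup>-\<^sup>1 H = 0\<close> with \<open>G\<close>; this is not the comparison of \<open>H\<close> with the \<^typ>\<open>ennreal\<close> product \<open>\<infinity> * G\<close>,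
  which would give a different result where \<open>G = 0 < H\<close>.
\<close>

definition set_gt :: "'a measure \<Rightarrow> ennreal \<Rightarrow> ('a \<Rightarrow> real) \<Rightarrow> ('a \<Rightarrow> real) \<Rightarrow> 'a set" where
  "set_gt \<mu> z H G =
     {\<omega> \<in> space \<mu>. if z = \<infinity> then False else H \<omega> > enn2real z * G \<omega>}"

definition set_eq :: "'a measure \<Rightarrow> ennreal \<Rightarrow> ('a \<Rightarrow> real) \<Rightarrow> ('a \<Rightarrow> real) \<Rightarrow> 'a set" where
  "set_eq \<mu> z H G =
     {\<omega> \<in> space \<mu>. if z = \<infinity> then G \<omega> = 0 else H \<omega> = enn2real z * G \<omega>}"

definition set_lt :: "'a measure \<Rightarrow> ennreal \<Rightarrow> ('a \<Rightarrow> real) \<Rightarrow> ('a \<Rightarrow> real) \<Rightarrow> 'a set" where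
  "set_lt \<mu> z H G =
     {\<omega> \<in> space \<mu>. if z = \<infinity> then G \<omega> > 0 else H \<omega> < enn2real z * G \<omega>}"

end

theory Submission
  imports Defs
begin

text \<open>
  The heart of the proof is that a convex expectation \<open>\<rho>\<close> that is continuous from below has almost
  optimal densities: for \<open>\<rho> 0 = 0\<close> and \<open>\<epsilon> > 0\<close> some density \<open>g\<close> satisfies \<open>E[g Z] \<le> \<rho> Z + \<epsilon>\<close> for all
  bounded \<open>Z\<close>. Instead of separating in the weak-* topology, choose an even convex function \<open>F\<close> that
  grows so fast that \<open>- \<rho> Y \<le> E[F Y] + \<epsilon>\<close> for all bounded \<open>Y\<close>, minimise \<open>\<rho> Y + 2 E[F Y]\<close> over the balls
  of radius \<open>k\<close>, and pass to the limit \<open>k \<rightarrow> \<infinity>\<close> in \<open>g = - 2 F' Y\<close>; the growth of \<open>F\<close> gives uniform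
  integrability and its uniform convexity gives convergence. Applied to the inf-convolution of \<open>\<rho>\<close>
  with a convex function on an order interval this is a minimax theorem, and closed level sets make
  it exact.

  If \<open>\<rho>1 K1 < \<alpha>\<close>, there is a Lagrange multiplier \<open>z\<close>, and applying the minimax theorem to \<open>\<rho>1\<close> and then
  to \<open>\<rho>2\<close> yields densities \<open>G\<close> and \<open>H\<close> for which every optimal test minimises \<open>E[(z G - H) X]\<close> over the
  interval \<open>[K1, K2]\<close>. If \<open>\<rho>1 K1 = \<alpha>\<close>, every test equals \<open>K1\<close> where \<open>G > 0\<close>, and \<open>z = \<infinity>\<close>.
\<close>

subsection \<open>Essentially bounded functions\<close>

text \<open>Continuity from below controls \<open>\<rho>\<close> only along sequences that converge
  a.e. inside a bounded order interval, where it yields lower semicontinuity. Every compactness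
  argument is therefore arranged to deliver an a.e. convergent sequence, and the recurring device is
  to pick near-minimisers of a uniformly convex functional over decreasing sets that are stable
  under midpoints. The penalisation has its error \<open>\<epsilon>\<close> built into
  \<open>F\<close>, so the minimax theorem is at first only approximate. Removing the error requires
  all approximate densities to lie in one level set. This is where the constant
  \<open>M - \<rho> 0 + 1\<close> comes from: \<open>M\<close> bounds \<open>E[g X]\<close>, a
  near-minimiser \<open>X\<close> loses at most 1/2, and the error of the density is at most 1/2.
  The two densities are not found simultaneously: the second is sought with the first one frozen,
  when the contribution of \<open>\<rho>1\<close> has become affine in \<open>X\<close>. Both are
  obtained from estimates valid on the whole interval, before any optimal test is named; hence one
  pair of measures serves all optimal tests.\<close>

lemma Linf_measurable [measurable_dest]: "X \<in> Linf M \<Longrightarrow> X \<in> borel_measurable M"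
  by (simp add: Linf_def)

lemma LinfI: "X \<in> borel_measurable M \<Longrightarrow> AE \<omega> in M. \<bar>X \<omega>\<bar> \<le> C \<Longrightarrow> X \<in> Linf M"
  by (auto simp: Linf_def)

lemma LinfE:
  assumes "X \<in> Linf M"
  obtains C where "0 \<le> C" "AE \<omega> in M. \<bar>X \<omega>\<bar> \<le> C"
proof -
  from assms obtain C where C: "AE \<omega> in M. \<bar>X \<omega>\<bar> \<le> C"
    by (auto simp: Linf_def)
  have "AE \<omega> in M. \<bar>X \<omega>\<bar> \<le> max 0 C"
    using C by eventually_elim auto
  with that[of "max 0 C"] show thesis by auto
qed

lemma Linf_const [simp, intro]: "(\<lambda>_. c) \<in> Linf M"
  by (rule LinfI[where C = "\<bar>c\<bar>"]) auto

lemma Linf_add [intro]: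
  assumes "X \<in> Linf M" "Y \<in> Linf M" shows "(\<lambda>\<omega>. X \<omega> + Y \<omega>) \<in> Linf M"
proof -
  obtain C D where CD: "AE \<omega> in M. \<bar>X \<omega>\<bar> \<le> C" "AE \<omega> in M. \<bar>Y \<omega>\<bar> \<le> D"
    using assms by (auto simp: Linf_def)
  have "AE \<omega> in M. \<bar>X \<omega> + Y \<omega>\<bar> \<le> C + D"
    using CD by eventually_elim linarith
  then show ?thesis
    using assms by (intro LinfI) (auto simp: Linf_def)
qed

lemma Linf_mult [intro]:
  assumes "X \<in> Linf M" "Y \<in> Linf M" shows "(\<lambda>\<omega>. X \<omega> * Y \<omega>) \<in> Linf M"
proof -
  obtain C where C: "0 \<le> C" "AE \<omega> in M. \<bar>X \<omega>\<bar> \<le> C" by (rule LinfE[OF assms(1)])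
  obtain D where D: "0 \<le> D" "AE \<omega> in M. \<bar>Y \<omega>\<bar> \<le> D" by (rule LinfE[OF assms(2)])
  have "AE \<omega> in M. \<bar>X \<omega> * Y \<omega>\<bar> \<le> C * D"
    using C(2) D(2) by eventually_elim (auto simp: abs_mult intro!: mult_mono C D)
  then show ?thesis
    using assms by (intro LinfI) (auto simp: Linf_def)
qed

lemma Linf_cmult [intro]: "X \<in> Linf M \<Longrightarrow> (\<lambda>\<omega>. c * X \<omega>) \<in> Linf M"
  by (rule Linf_mult) auto

lemma Linf_uminus [intro]: "X \<in> Linf M \<Longrightarrow> (\<lambda>\<omega>. - X \<omega>) \<in> Linf M"
  using Linf_cmult[of X M "-1"] by simp

lemma Linf_diff [intro]: "X \<in> Linf M \<Longrightarrow> Y \<in> Linf M \<Longrightarrow> (\<lambda>\<omega>. X \<omega> - Y \<omega>) \<in> Linf M"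
  using Linf_add[OF _ Linf_uminus, of X M Y] by simp

lemma Linf_cdivide [intro]: "X \<in> Linf M \<Longrightarrow> (\<lambda>\<omega>. X \<omega> / c) \<in> Linf M"
  using Linf_cmult[of X M "1 / c"] by simp

lemma Linf_power [intro]: "X \<in> Linf M \<Longrightarrow> (\<lambda>\<omega>. X \<omega> ^ n) \<in> Linf M"
  by (induction n) auto

lemma Linf_abs [intro]: "X \<in> Linf M \<Longrightarrow> (\<lambda>\<omega>. \<bar>X \<omega>\<bar>) \<in> Linf M"
  by (auto simp: Linf_def)

lemma Linf_sum [intro]: "(\<And>i. i \<in> I \<Longrightarrow> X i \<in> Linf M) \<Longrightarrow> (\<lambda>\<omega>. \<Sum>i\<in>I. X i \<omega>) \<in> Linf M"
  by (induction I rule: infinite_finite_induct) auto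

lemma integrable_mult_Linf [intro]:
  fixes g :: "'a \<Rightarrow> real"
  assumes "integrable M g" "X \<in> Linf M"
  shows "integrable M (\<lambda>\<omega>. g \<omega> * X \<omega>)"
proof -
  obtain C where C: "AE \<omega> in M. \<bar>X \<omega>\<bar> \<le> C" using assms by (auto simp: Linf_def)
  have "integrable M (\<lambda>\<omega>. C * \<bar>g \<omega>\<bar>)" using assms by auto
  then show ?thesis
  proof (rule Bochner_Integration.integrable_bound)
    show "AE \<omega> in M. norm (g \<omega> * X \<omega>) \<le> norm (C * \<bar>g \<omega>\<bar>)"
      using C
    proof eventually_elim
      case (elim \<omega>)
      then have "\<bar>g \<omega>\<bar> * \<bar>X \<omega>\<bar> \<le> \<bar>g \<omega>\<bar> * \<bar>C\<bar>" by (intro mult_left_mono) auto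
      then show ?case by (simp add: abs_mult mult.commute)
    qed
  qed (use assms in \<open>auto simp: Linf_def\<close>)
qed

lemma (in prob_space) Linf_integrable [intro]: "X \<in> Linf M \<Longrightarrow> integrable M X"
  using integrable_mult_Linf[of M "\<lambda>_. 1" X] by simp

lemma tendsto_integral_mult_bounded:
  fixes g :: "'a \<Rightarrow> real"
  assumes g: "integrable M g"
    and X: "\<And>n. X n \<in> borel_measurable M" "Y \<in> borel_measurable M"
    and C: "\<And>n. AE \<omega> in M. \<bar>X n \<omega>\<bar> \<le> C"
    and lim: "AE \<omega> in M. (\<lambda>n. X n \<omega>) \<longlonglongrightarrow> Y \<omega>"
  shows "(\<lambda>n. LINT \<omega>|M. g \<omega> * X n \<omega>) \<longlonglongrightarrow> (LINT \<omega>|M. g \<omega> * Y \<omega>)"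
proof (rule integral_dominated_convergence[where w = "\<lambda>\<omega>. C * \<bar>g \<omega>\<bar>"])
  show "AE \<omega> in M. (\<lambda>n. g \<omega> * X n \<omega>) \<longlonglongrightarrow> g \<omega> * Y \<omega>"
    using lim by eventually_elim (auto intro: tendsto_intros)
  show "AE \<omega> in M. norm (g \<omega> * X n \<omega>) \<le> C * \<bar>g \<omega>\<bar>" for n
    using C[of n] by eventually_elim (metis abs_ge_zero abs_mult mult.commute mult_right_mono real_norm_def)
qed (use g X in auto)

subsection \<open>Compactness of boxes\<close>

text \<open>Order intervals of bounded functions play the part of compact convex sets:
  \<open>decreasing_convex_sets_common_point\<close> is their intersection property. The bounds hold
  only a.e., so membership does not depend on the representative.\<close>

definition Lbox :: "'a measure \<Rightarrow> ('a \<Rightarrow> real) \<Rightarrow> ('a \<Rightarrow> real) \<Rightarrow> ('a \<Rightarrow> real) set" where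
  "Lbox M a b = {X \<in> Linf M. AE \<omega> in M. a \<omega> \<le> X \<omega> \<and> X \<omega> \<le> b \<omega>}"

lemma Lbox_Linf: "X \<in> Lbox M a b \<Longrightarrow> X \<in> Linf M"
  by (simp add: Lbox_def)

lemma Lbox_convex:
  assumes "X \<in> Lbox M a b" "Y \<in> Lbox M a b" "0 \<le> l" "l \<le> 1"
  shows "(\<lambda>\<omega>. l * X \<omega> + (1 - l) * Y \<omega>) \<in> Lbox M a b"
proof -
  have "AE \<omega> in M. a \<omega> \<le> X \<omega> \<and> X \<omega> \<le> b \<omega>" "AE \<omega> in M. a \<omega> \<le> Y \<omega> \<and> Y \<omega> \<le> b \<omega>"
    using assms by (auto simp: Lbox_def)
  then have "AE \<omega> in M. a \<omega> \<le> l * X \<omega> + (1 - l) * Y \<omega> \<and> l * X \<omega> + (1 - l) * Y \<omega> \<le> b \<omega>"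
  proof eventually_elim
    case (elim \<omega>)
    have "l * a \<omega> \<le> l * X \<omega>" "(1 - l) * a \<omega> \<le> (1 - l) * Y \<omega>"
      "l * X \<omega> \<le> l * b \<omega>" "(1 - l) * Y \<omega> \<le> (1 - l) * b \<omega>"
      using elim assms by (auto intro!: mult_left_mono)
    then show ?case by (auto simp: algebra_simps)
  qed
  then show ?thesis
    using assms by (auto simp: Lbox_def)
qed

lemma Lbox_bound:
  assumes "a \<in> Linf M" "b \<in> Linf M"
  obtains C where "0 \<le> C" "\<And>X. X \<in> Lbox M a b \<Longrightarrow> AE \<omega> in M. \<bar>X \<omega>\<bar> \<le> C"
proof -
  obtain C where C: "0 \<le> C" "AE \<omega> in M. \<bar>a \<omega>\<bar> \<le> C" by (rule LinfE[OF assms(1)])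
  obtain D where D: "0 \<le> D" "AE \<omega> in M. \<bar>b \<omega>\<bar> \<le> D" by (rule LinfE[OF assms(2)])
  have "AE \<omega> in M. \<bar>X \<omega>\<bar> \<le> C + D" if "X \<in> Lbox M a b" for X
  proof -
    have "AE \<omega> in M. a \<omega> \<le> X \<omega> \<and> X \<omega> \<le> b \<omega>" using that by (simp add: Lbox_def)
    with C(2) D(2) show ?thesis by eventually_elim (use C(1) D(1) in linarith)
  qed
  then show thesis using that[of "C + D"] C D by auto
qed

lemma Lbox_closed:
  assumes "a \<in> Linf M" "b \<in> Linf M" "X \<in> borel_measurable M"
    "\<And>n. Xs n \<in> Lbox M a b" "AE \<omega> in M. (\<lambda>n. Xs n \<omega>) \<longlonglongrightarrow> X \<omega>"
  shows "X \<in> Lbox M a b"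
proof -
  have "AE \<omega> in M. \<forall>n. a \<omega> \<le> Xs n \<omega> \<and> Xs n \<omega> \<le> b \<omega>"
    using assms(4) unfolding AE_all_countable by (simp add: Lbox_def)
  with assms(5) have *: "AE \<omega> in M. a \<omega> \<le> X \<omega> \<and> X \<omega> \<le> b \<omega>"
    by eventually_elim (auto intro: LIMSEQ_le_const LIMSEQ_le_const2)
  obtain C where C: "0 \<le> C" "AE \<omega> in M. \<bar>a \<omega>\<bar> \<le> C" by (rule LinfE[OF assms(1)])
  obtain D where D: "0 \<le> D" "AE \<omega> in M. \<bar>b \<omega>\<bar> \<le> D" by (rule LinfE[OF assms(2)])
  have "AE \<omega> in M. \<bar>X \<omega>\<bar> \<le> C + D"
    using * C(2) D(2) by eventually_elim (use C(1) D(1) in linarith)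
  then show ?thesis
    using * assms(3) by (auto simp: Lbox_def intro: LinfI)
qed

text \<open>On a probability space L2-Cauchy implies L1-Cauchy, and an L1-Cauchy sequence has an
  a.e. Cauchy subsequence. The limit is only claimed to be measurable; it may be unbounded in the
  application to penalised minimisers.\<close>

lemma (in prob_space) L2_Cauchy_AE_subseq:
  assumes A: "\<And>n. A n \<in> Linf M"
    and cauchy: "\<And>e. 0 < e \<Longrightarrow>
      \<exists>N. \<forall>n\<ge>N. \<forall>m\<ge>n. (LINT \<omega>|M. (A n \<omega> - A m \<omega>)\<^sup>2) < e"
  obtains r X where "strict_mono (r :: nat \<Rightarrow> nat)" "X \<in> borel_measurable M"
    "AE \<omega> in M. (\<lambda>n. A (r n) \<omega>) \<longlonglongrightarrow> X \<omega>"
proof -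
  have "\<exists>N. \<forall>i\<ge>N. \<forall>j\<ge>N. (LINT \<omega>|M. norm (A i \<omega> - A j \<omega>)) < e" if "0 < e" for e
  proof -
    obtain N where N: "\<And>n m. n \<ge> N \<Longrightarrow> m \<ge> n \<Longrightarrow> (LINT \<omega>|M. (A n \<omega> - A m \<omega>)\<^sup>2) < e\<^sup>2"
      using cauchy[of "e\<^sup>2"] \<open>0 < e\<close> by auto
    have *: "(LINT \<omega>|M. norm (A i \<omega> - A j \<omega>)) < e" if "i \<ge> N" "j \<ge> i" for i j
    proof -
      have int: "integrable M (\<lambda>\<omega>. (A i \<omega> - A j \<omega>)\<^sup>2)"
        using A by (intro Linf_integrable Linf_power Linf_diff)
      \<comment> \<open>Young's inequality with weight \<open>e\<close> stands in for
        Cauchy-Schwarz: an L2 bound below \<open>e\<^sup>2\<close> yields an L1 bound below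
        \<open>e\<close>.\<close>
      have le: "norm (A i \<omega> - A j \<omega>) \<le> ((A i \<omega> - A j \<omega>)\<^sup>2 / e + e) / 2" for \<omega>
      proof -
        have "0 \<le> (\<bar>A i \<omega> - A j \<omega>\<bar> - e)\<^sup>2" by simp
        then have "2 * e * \<bar>A i \<omega> - A j \<omega>\<bar> \<le> (A i \<omega> - A j \<omega>)\<^sup>2 + e\<^sup>2"
          by (simp add: power2_diff algebra_simps)
        then show ?thesis using \<open>0 < e\<close> by (simp add: field_simps power2_eq_square)
      qed
      have "(LINT \<omega>|M. norm (A i \<omega> - A j \<omega>)) \<le> (LINT \<omega>|M. ((A i \<omega> - A j \<omega>)\<^sup>2 / e + e) / 2)"
        using le by (intro integral_mono Linf_integrable)
            (auto intro!: Linf_abs Linf_diff Linf_cdivide Linf_add Linf_power A)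
      also have "\<dots> = ((LINT \<omega>|M. (A i \<omega> - A j \<omega>)\<^sup>2) / e + e) / 2"
        using int by (simp add: prob_space)
      also have "\<dots> < e"
        using N[OF that] \<open>0 < e\<close> by (simp add: field_simps power2_eq_square)
      finally show ?thesis .
    qed
    show ?thesis
    proof (intro exI allI impI)
      fix i j assume "N \<le> i" "N \<le> j"
      then show "(LINT \<omega>|M. norm (A i \<omega> - A j \<omega>)) < e"
        using *[of i j] *[of j i] by (cases "i \<le> j") (auto simp: abs_minus_commute[of "A i _"])
    qed
  qed
  then obtain r where r: "strict_mono r" "AE \<omega> in M. Cauchy (\<lambda>i. A (r i) \<omega>)"
    using A by (elim cauchy_L1_AE_cauchy_subseq[of M A, rotated 2]) auto
  define X where "X = (\<lambda>\<omega>. lim (\<lambda>n. A (r n) \<omega>))"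
  have [measurable]: "A n \<in> borel_measurable M" for n using A by (simp add: Linf_def)
  have "X \<in> borel_measurable M" unfolding X_def by measurable
  moreover have "AE \<omega> in M. (\<lambda>n. A (r n) \<omega>) \<longlonglongrightarrow> X \<omega>"
    using r(2) by eventually_elim (simp add: X_def Cauchy_convergent_iff convergent_LIMSEQ_iff)
  ultimately show thesis using that r(1) by blast
qed

text \<open>The parallelogram identity in integrated form; the subtracted square is the uniform
  convexity that forces near-minimisers to cluster.\<close>

lemma (in prob_space) integral_midpoint_square:
  assumes "X \<in> Linf M" "Y \<in> Linf M"
  shows "(LINT \<omega>|M. ((X \<omega> + Y \<omega>) / 2)\<^sup>2) =
    ((LINT \<omega>|M. (X \<omega>)\<^sup>2) + (LINT \<omega>|M. (Y \<omega>)\<^sup>2)) / 2 - (LINT \<omega>|M. (X \<omega> - Y \<omega>)\<^sup>2) / 4"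
proof -
  have "((X \<omega> + Y \<omega>) / 2)\<^sup>2 = ((X \<omega>)\<^sup>2 + (Y \<omega>)\<^sup>2) / 2 - (X \<omega> - Y \<omega>)\<^sup>2 / 4" for \<omega>
    by (simp add: power2_eq_square field_simps)
  then have "(LINT \<omega>|M. ((X \<omega> + Y \<omega>) / 2)\<^sup>2) =
      (LINT \<omega>|M. ((X \<omega>)\<^sup>2 + (Y \<omega>)\<^sup>2) / 2 - (X \<omega> - Y \<omega>)\<^sup>2 / 4)"
    by simp
  also have "\<dots> = ((LINT \<omega>|M. (X \<omega>)\<^sup>2) + (LINT \<omega>|M. (Y \<omega>)\<^sup>2)) / 2 - (LINT \<omega>|M. (X \<omega> - Y \<omega>)\<^sup>2) / 4"
  proof -
    have "integrable M (\<lambda>\<omega>. (X \<omega>)\<^sup>2)" "integrable M (\<lambda>\<omega>. (Y \<omega>)\<^sup>2)" "integrable M (\<lambda>\<omega>. (X \<omega> - Y \<omega>)\<^sup>2)"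
      using assms by (auto intro!: Linf_integrable)
    then show ?thesis by (simp add: add_divide_distrib)
  qed
  finally show ?thesis .
qed

text \<open>
  Substitute for weak compactness: if the functional \<open>q\<close> satisfies a parallelogram inequality, its
  approximate minimisers over the decreasing sets \<open>C n\<close> form a Cauchy sequence.
\<close>

lemma (in prob_space) uniformly_convex_selection:
  fixes q :: "'b \<Rightarrow> real" and A :: "'b \<Rightarrow> 'a \<Rightarrow> real"
  assumes C: "\<And>n. C n \<noteq> {}" "\<And>n. C (Suc n) \<subseteq> C n"
    and q: "\<And>n x. x \<in> C n \<Longrightarrow> 0 \<le> q x" "\<And>n x. x \<in> C n \<Longrightarrow> q x \<le> K"
    and A: "\<And>n x. x \<in> C n \<Longrightarrow> A x \<in> Linf M"
    and mid: "\<And>n x y. x \<in> C n \<Longrightarrow> y \<in> C n \<Longrightarrow>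
      \<exists>z\<in>C n. q z \<le> (q x + q y) / 2 - (LINT \<omega>|M. (A x \<omega> - A y \<omega>)\<^sup>2) / 4"
  obtains x X where "\<And>n k. x (n + k) \<in> C n" "X \<in> borel_measurable M"
    "AE \<omega> in M. (\<lambda>n. A (x n) \<omega>) \<longlonglongrightarrow> X \<omega>"
proof -
  define s where "s n = (INF x\<in>C n. q x)" for n
  have anti: "C m \<subseteq> C n" if "n \<le> m" for n m
    using C(2) that by (rule lift_Suc_antimono_le)
  have bdd: "bdd_below (q ` C n)" for n by (rule bdd_belowI2[where m = 0]) (rule q(1))
  have s_le: "s n \<le> q x" if "x \<in> C n" for n x
    unfolding s_def using bdd that by (rule cINF_lower)
  have "mono s"
    unfolding mono_def s_def by (intro allI impI cINF_superset_mono C(1) bdd anti order_refl)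
  moreover have "s n \<le> K" for n
    using C(1)[of n] s_le q(2) by (metis all_not_in_conv order_trans)
  ultimately obtain S where S: "s \<longlonglongrightarrow> S"
    using incseq_convergent[of s K] by metis
  have "\<exists>x\<in>C n. q x < s n + 1 / Suc n" for n
    using cINF_less_iff[OF C(1) bdd, of n "s n + 1 / Suc n"] by (simp add: s_def)
  then obtain y where y: "\<And>n. y n \<in> C n" "\<And>n. q (y n) < s n + 1 / Suc n"
    by metis
  have yL: "A (y n) \<in> Linf M" for n by (rule A[OF y(1)])
  \<comment> \<open>A midpoint \<open>z\<close> of \<open>y n\<close> and \<open>y m\<close> lies in
    the larger set \<open>C n\<close>, so its value is at least \<open>s n\<close>; the values of
    \<open>y n\<close> and \<open>y m\<close> are within \<open>1 / Suc n\<close> and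
    \<open>1 / Suc m\<close> of \<open>s n\<close> and \<open>s m\<close>, and what is left bounds
    the squared distance. The infima \<open>s n\<close> converge, being increasing and bounded by
    \<open>K\<close>.\<close>
  have est: "(LINT \<omega>|M. (A (y n) \<omega> - A (y m) \<omega>)\<^sup>2) \<le> 2 * (s m - s n) + 4 * (1 / Suc n)"
    if "n \<le> m" for n m
  proof -
    have "y m \<in> C n" using y(1)[of m] anti[OF that] by blast
    from mid[OF y(1) this] obtain z where z: "z \<in> C n"
      "q z \<le> (q (y n) + q (y m)) / 2 - (LINT \<omega>|M. (A (y n) \<omega> - A (y m) \<omega>)\<^sup>2) / 4"
      by blast
    have "1 / real (Suc m) \<le> 1 / Suc n" using that by (simp add: field_simps)
    with z(2) s_le[OF z(1)] y(2)[of n] y(2)[of m] show ?thesis by argo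
  qed
  have "\<exists>N. \<forall>n\<ge>N. \<forall>m\<ge>n. (LINT \<omega>|M. (A (y n) \<omega> - A (y m) \<omega>)\<^sup>2) < e" if "0 < e" for e
  proof -
    have "(\<lambda>n. 2 * (S - s n) + 4 * (1 / Suc n)) \<longlonglongrightarrow> 2 * (S - S) + 4 * 0"
      using S LIMSEQ_inverse_real_of_nat by (intro tendsto_intros) (auto simp: inverse_eq_divide)
    then have "\<forall>\<^sub>F n in sequentially. 2 * (S - s n) + 4 * (1 / Suc n) < e"
      using \<open>0 < e\<close> by (auto dest: order_tendstoD(2))
    then obtain N where N: "\<And>n. n \<ge> N \<Longrightarrow> 2 * (S - s n) + 4 * (1 / Suc n) < e"
      by (auto simp: eventually_sequentially)
    have sS: "s m \<le> S" for m using S \<open>mono s\<close> by (intro incseq_le) auto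
    show ?thesis
    proof (intro exI allI impI)
      fix n m assume "N \<le> n" "n \<le> m"
      then show "(LINT \<omega>|M. (A (y n) \<omega> - A (y m) \<omega>)\<^sup>2) < e"
        using est[of n m] N[of n] sS[of m] by argo
    qed
  qed
  then obtain r X where r: "strict_mono r" "X \<in> borel_measurable M"
      "AE \<omega> in M. (\<lambda>n. A (y (r n)) \<omega>) \<longlonglongrightarrow> X \<omega>"
    using L2_Cauchy_AE_subseq[of "\<lambda>n. A (y n)", OF yL] by blast
  show thesis
  proof (rule that[of "\<lambda>n. y (r n)", OF _ r(2,3)])
    fix n k
    have "n \<le> r (n + k)" using seq_suble[OF r(1), of "n + k"] by linarith
    then show "y (r (n + k)) \<in> C n" using y(1) anti by blast
  qed
qed

text \<open>Near-minimisers of the L2 norm over the sets \<open>C n\<close> converge a.e. along a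
  subsequence; each \<open>C n\<close> contains a tail of it and hence the limit. For midpoint
  convex sets closed under a.e. limits in the box this is a sequential form of weak
  compactness.\<close>

lemma (in prob_space) decreasing_convex_sets_common_point:
  assumes ab: "a \<in> Linf M" "b \<in> Linf M"
    and C: "\<And>n. C n \<noteq> {}" "\<And>n. C (Suc n) \<subseteq> C n" "\<And>n. C n \<subseteq> Lbox M a b"
    and mid: "\<And>n X Y. X \<in> C n \<Longrightarrow> Y \<in> C n \<Longrightarrow> (\<lambda>\<omega>. (X \<omega> + Y \<omega>) / 2) \<in> C n"
    and closed: "\<And>n Xs X. (\<And>k. Xs k \<in> C n) \<Longrightarrow> X \<in> Lbox M a b \<Longrightarrow>
      AE \<omega> in M. (\<lambda>k. Xs k \<omega>) \<longlonglongrightarrow> X \<omega> \<Longrightarrow> X \<in> C n"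
  obtains X where "\<And>n. X \<in> C n"
proof -
  obtain K where K: "0 \<le> K" "\<And>X. X \<in> Lbox M a b \<Longrightarrow> AE \<omega> in M. \<bar>X \<omega>\<bar> \<le> K"
    using Lbox_bound[OF ab] by blast
  have LC: "X \<in> Linf M" if "X \<in> C n" for X n
    using that C(3) by (auto simp: Lbox_def)
  have qK: "(LINT \<omega>|M. (X \<omega>)\<^sup>2) \<le> K\<^sup>2" if "X \<in> C n" for n X
  proof -
    have "(LINT \<omega>|M. (X \<omega>)\<^sup>2) \<le> (LINT \<omega>|M. K\<^sup>2)"
    proof (rule integral_mono_AE)
      show "AE \<omega> in M. (X \<omega>)\<^sup>2 \<le> K\<^sup>2"
        using K(2)[of X] C(3) that
        by (auto elim!: eventually_mono simp: abs_le_square_iff[symmetric] K(1))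
    qed (use LC[OF that] in \<open>auto intro!: Linf_integrable\<close>)
    then show ?thesis by (simp add: prob_space)
  qed
  have q0: "0 \<le> (LINT \<omega>|M. (X \<omega>)\<^sup>2)" if "X \<in> C n" for n X by simp
  have mid': "\<exists>Z\<in>C n. (LINT \<omega>|M. (Z \<omega>)\<^sup>2) \<le> ((LINT \<omega>|M. (X \<omega>)\<^sup>2) + (LINT \<omega>|M. (Y \<omega>)\<^sup>2)) / 2 -
      (LINT \<omega>|M. (X \<omega> - Y \<omega>)\<^sup>2) / 4" if "X \<in> C n" "Y \<in> C n" for n X Y
    by (rule bexI[OF _ mid[OF that]]) (simp add: integral_midpoint_square[OF LC[OF that(1)] LC[OF that(2)]])
  show thesis
  proof (rule uniformly_convex_selection[of C "\<lambda>X. LINT \<omega>|M. (X \<omega>)\<^sup>2" "K\<^sup>2" "\<lambda>X. X"])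
    fix x X assume x: "\<And>n k. x (n + k) \<in> C n" and X: "X \<in> borel_measurable M"
      "AE \<omega> in M. (\<lambda>n. x n \<omega>) \<longlonglongrightarrow> X \<omega>"
    have lim: "AE \<omega> in M. (\<lambda>k. x (n + k) \<omega>) \<longlonglongrightarrow> X \<omega>" for n
      using X(2) by eventually_elim (subst add.commute, rule LIMSEQ_ignore_initial_segment)
    have XD: "X \<in> Lbox M a b"
      using x[of 0] C(3)[of 0] X by (intro Lbox_closed[OF ab X(1), of x]) auto
    show thesis by (rule that, rule closed[OF x XD lim])
  qed (fact C q0 qK LC mid')+
qed

subsection \<open>Convex expectations\<close>

lemma convex_expectation_mono:
  "convex_expectation M \<rho> \<Longrightarrow> X \<in> Linf M \<Longrightarrow> Y \<in> Linf M \<Longrightarrow> AE \<omega> in M. X \<omega> \<le> Y \<omega> \<Longrightarrow> \<rho> X \<le> \<rho> Y"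
  by (simp add: convex_expectation_def)

lemma convex_expectation_add_const:
  "convex_expectation M \<rho> \<Longrightarrow> X \<in> Linf M \<Longrightarrow> \<rho> (\<lambda>\<omega>. X \<omega> + c) = \<rho> X + c"
  by (simp add: convex_expectation_def)

lemma convex_expectation_convex:
  "convex_expectation M \<rho> \<Longrightarrow> X \<in> Linf M \<Longrightarrow> Y \<in> Linf M \<Longrightarrow> 0 \<le> l \<Longrightarrow> l \<le> 1 \<Longrightarrow>
    \<rho> (\<lambda>\<omega>. l * X \<omega> + (1 - l) * Y \<omega>) \<le> l * \<rho> X + (1 - l) * \<rho> Y"
  by (simp add: convex_expectation_def)

lemma convex_expectation_const:
  "convex_expectation M \<rho> \<Longrightarrow> \<rho> (\<lambda>_. c) = \<rho> (\<lambda>_. 0) + c"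
  using convex_expectation_add_const[of M \<rho> "\<lambda>_. 0" c] by simp

lemma convex_expectation_ge:
  assumes "convex_expectation M \<rho>" "X \<in> Linf M" "AE \<omega> in M. c \<le> X \<omega>"
  shows "\<rho> (\<lambda>_. 0) + c \<le> \<rho> X"
  using convex_expectation_mono[OF assms(1) Linf_const assms(2), of c]
    convex_expectation_const[OF assms(1), of c] assms(3) by simp

lemma convex_expectation_le:
  assumes "convex_expectation M \<rho>" "X \<in> Linf M" "AE \<omega> in M. X \<omega> \<le> c"
  shows "\<rho> X \<le> \<rho> (\<lambda>_. 0) + c"
  using convex_expectation_mono[OF assms(1,2) Linf_const, of c]
    convex_expectation_const[OF assms(1), of c] assms(3) by simp

lemma midpoint_eq: "(\<lambda>\<omega>. (X \<omega> + Y \<omega>) / 2 :: real) = (\<lambda>\<omega>. (1 / 2) * X \<omega> + (1 - 1 / 2) * Y \<omega>)"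
  by (auto simp: field_simps)

lemma convex_expectation_midpoint:
  assumes "convex_expectation M \<rho>" "X \<in> Linf M" "Y \<in> Linf M"
  shows "\<rho> (\<lambda>\<omega>. (X \<omega> + Y \<omega>) / 2) \<le> (\<rho> X + \<rho> Y) / 2"
  unfolding midpoint_eq using convex_expectation_convex[OF assms, of "1 / 2"] by simp

text \<open>Sequential lower semicontinuity along a.e. convergence, written with eventual lower
  bounds in place of a liminf; this keeps all values real and makes sums immediate.\<close>

definition ae_lsc_on :: "'a measure \<Rightarrow> ('a \<Rightarrow> real) set \<Rightarrow> (('a \<Rightarrow> real) \<Rightarrow> real) \<Rightarrow> bool" where
  "ae_lsc_on M D f \<longleftrightarrow>
     (\<forall>Xs X. (\<forall>n::nat. Xs n \<in> D) \<longrightarrow> X \<in> D \<longrightarrow> (AE \<omega> in M. (\<lambda>n. Xs n \<omega>) \<longlonglongrightarrow> X \<omega>) \<longrightarrow>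
       (\<forall>c<f X. \<forall>\<^sub>F n in sequentially. c < f (Xs n)))"

lemma ae_lsc_onD:
  "ae_lsc_on M D f \<Longrightarrow> (\<And>n. Xs n \<in> D) \<Longrightarrow> X \<in> D \<Longrightarrow> AE \<omega> in M. (\<lambda>n. Xs n \<omega>) \<longlonglongrightarrow> X \<omega> \<Longrightarrow>
    c < f X \<Longrightarrow> \<forall>\<^sub>F n in sequentially. c < f (Xs n)"
  unfolding ae_lsc_on_def by blast

lemma ae_lsc_onD_le:
  assumes "ae_lsc_on M D f" "\<And>n. Xs n \<in> D" "X \<in> D" "AE \<omega> in M. (\<lambda>n. Xs n \<omega>) \<longlonglongrightarrow> X \<omega>"
    and "\<And>n. f (Xs n) \<le> c"
  shows "f X \<le> c"
proof (rule ccontr)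
  assume "\<not> f X \<le> c"
  then have "\<forall>\<^sub>F n in sequentially. c < f (Xs n)"
    using ae_lsc_onD[OF assms(1-4)] by simp
  then show False
    using assms(5) by (auto simp: eventually_sequentially not_less[symmetric])
qed

lemma ae_lsc_on_add:
  assumes "ae_lsc_on M D f" "ae_lsc_on M D g"
  shows "ae_lsc_on M D (\<lambda>X. f X + g X)"
  unfolding ae_lsc_on_def
proof (intro allI impI)
  fix Xs X c
  assume *: "\<forall>n::nat. Xs n \<in> D" "X \<in> D" "AE \<omega> in M. (\<lambda>n. Xs n \<omega>) \<longlonglongrightarrow> X \<omega>" "c < f X + g X"
  define e where "e = (f X + g X - c) / 2"
  have e: "0 < e" using * by (simp add: e_def)
  have "\<forall>\<^sub>F n in sequentially. f X - e < f (Xs n)" "\<forall>\<^sub>F n in sequentially. g X - e < g (Xs n)"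
    using ae_lsc_onD[OF assms(1), of Xs X "f X - e"] ae_lsc_onD[OF assms(2), of Xs X "g X - e"] * e
    by auto
  then show "\<forall>\<^sub>F n in sequentially. c < f (Xs n) + g (Xs n)"
    by eventually_elim (simp add: e_def field_simps)
qed

lemma ae_lsc_on_divide:
  assumes "ae_lsc_on M D f" "0 < (k::real)"
  shows "ae_lsc_on M D (\<lambda>X. f X / k)"
  unfolding ae_lsc_on_def
proof (intro allI impI)
  fix Xs X c
  assume *: "\<forall>n::nat. Xs n \<in> D" "X \<in> D" "AE \<omega> in M. (\<lambda>n. Xs n \<omega>) \<longlonglongrightarrow> X \<omega>" "c < f X / k"
  then have "\<forall>\<^sub>F n in sequentially. c * k < f (Xs n)"
    using ae_lsc_onD[OF assms(1), of Xs X "c * k"] assms(2) by (auto simp: field_simps)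
  then show "\<forall>\<^sub>F n in sequentially. c < f (Xs n) / k"
    by eventually_elim (use assms(2) in \<open>simp add: field_simps\<close>)
qed

lemma ae_lsc_on_tendsto:
  assumes "\<And>Xs X. (\<And>n::nat. Xs n \<in> D) \<Longrightarrow> X \<in> D \<Longrightarrow> AE \<omega> in M. (\<lambda>n. Xs n \<omega>) \<longlonglongrightarrow> X \<omega> \<Longrightarrow>
    (\<lambda>n. f (Xs n)) \<longlonglongrightarrow> f X"
  shows "ae_lsc_on M D f"
  unfolding ae_lsc_on_def by (intro allI impI order_tendstoD(1)[OF assms]) auto

lemma Lbox_tendsto_integral:
  assumes ab: "a \<in> Linf M" "b \<in> Linf M" and g: "integrable M g"
    and Xs: "\<And>n::nat. Xs n \<in> Lbox M a b" "X \<in> Lbox M a b" "AE \<omega> in M. (\<lambda>n. Xs n \<omega>) \<longlonglongrightarrow> X \<omega>"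
  shows "(\<lambda>n. LINT \<omega>|M. g \<omega> * Xs n \<omega>) \<longlonglongrightarrow> (LINT \<omega>|M. g \<omega> * X \<omega>)"
proof -
  obtain K where K: "0 \<le> K" "\<And>X. X \<in> Lbox M a b \<Longrightarrow> AE \<omega> in M. \<bar>X \<omega>\<bar> \<le> K"
    using Lbox_bound[OF ab] by blast
  then show ?thesis
    using Xs by (intro tendsto_integral_mult_bounded[OF g, where C = K]) (auto simp: Lbox_def Linf_def)
qed

text \<open>The Fatou property: \<open>X\<close> is the increasing limit of the functions \<open>inf {Xs k | k \<ge> n}\<close>.\<close>

lemma convex_expectation_ae_lsc:
  assumes \<rho>: "convex_expectation M \<rho>" "continuous_from_below M \<rho>"
    and ab: "a \<in> Linf M" "b \<in> Linf M"
  shows "ae_lsc_on M (Lbox M a b) \<rho>"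
  unfolding ae_lsc_on_def
proof (intro allI impI)
  fix Xs X c
  assume Xs: "\<forall>n::nat. Xs n \<in> Lbox M a b" and X: "X \<in> Lbox M a b"
    and lim: "AE \<omega> in M. (\<lambda>n. Xs n \<omega>) \<longlonglongrightarrow> X \<omega>" and c: "c < \<rho> X"
  obtain K where K: "0 \<le> K" "\<And>X. X \<in> Lbox M a b \<Longrightarrow> AE \<omega> in M. \<bar>X \<omega>\<bar> \<le> K"
    using Lbox_bound[OF ab] by blast
  have [measurable]: "Xs n \<in> borel_measurable M" for n
    using Xs by (simp add: Lbox_def Linf_def)
  define Z where "Z n \<omega> = (INF k\<in>{n..}. Xs k \<omega>)" for n \<omega>
  have [measurable]: "Z n \<in> borel_measurable M" for n
    unfolding Z_def by (intro borel_measurable_cINF_real) auto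
  have bound: "AE \<omega> in M. \<forall>n. \<bar>Xs n \<omega>\<bar> \<le> K"
    unfolding AE_all_countable using Xs K by auto
  have bdd: "bdd_below ((\<lambda>k. Xs k \<omega>) ` {n..})" if "\<forall>n. \<bar>Xs n \<omega>\<bar> \<le> K" for n \<omega>
    by (rule bdd_belowI2[where m = "-K"]) (use that in \<open>auto simp: abs_le_iff\<close>, smt (verit))
  have Z_le: "AE \<omega> in M. Z n \<omega> \<le> Xs n \<omega>" for n
    using bound by eventually_elim (auto simp: Z_def intro!: cINF_lower bdd)
  have Z_Suc: "AE \<omega> in M. Z n \<omega> \<le> Z (Suc n) \<omega>" for n
    using bound by eventually_elim (auto simp: Z_def intro!: cINF_superset_mono bdd)
  have Z_bound: "AE \<omega> in M. \<bar>Z n \<omega>\<bar> \<le> K" for n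
    using bound
  proof eventually_elim
    case (elim \<omega>)
    have "- K \<le> Z n \<omega>" unfolding Z_def by (rule cINF_greatest) (use elim in \<open>auto simp: abs_le_iff\<close>, smt (verit))
    moreover have "Z n \<omega> \<le> Xs n \<omega>" unfolding Z_def by (rule cINF_lower[OF bdd[OF elim]]) auto
    ultimately show ?case using elim by (smt (verit))
  qed
  have Z_lim: "AE \<omega> in M. (\<lambda>n. Z n \<omega>) \<longlonglongrightarrow> X \<omega>"
    using bound lim
  proof eventually_elim
    case (elim \<omega>)
    show ?case
    proof (rule LIMSEQ_I)
      fix e :: real assume "0 < e"
      then obtain N where N: "\<And>k. k \<ge> N \<Longrightarrow> \<bar>Xs k \<omega> - X \<omega>\<bar> < e / 2"
        using LIMSEQ_D[OF elim(2), of "e / 2"] by auto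
      have "norm (Z n \<omega> - X \<omega>) < e" if "n \<ge> N" for n
      proof -
        have "X \<omega> - e / 2 \<le> Z n \<omega>"
          unfolding Z_def
        proof (rule cINF_greatest)
          fix k assume "k \<in> {n..}"
          then show "X \<omega> - e / 2 \<le> Xs k \<omega>" using N[of k] that by (simp add: abs_if split: if_splits)
        qed auto
        moreover have "Z n \<omega> \<le> Xs n \<omega>"
          unfolding Z_def by (rule cINF_lower[OF bdd[OF elim(1)]]) auto
        ultimately show ?thesis using N[OF that] by (simp add: abs_less_iff) (smt (verit) \<open>0 < e\<close> field_sum_of_halves)
      qed
      then show "\<exists>N. \<forall>n\<ge>N. norm (Z n \<omega> - X \<omega>) < e" by blast
    qed
  qed
  have ZL: "Z n \<in> Linf M" for n using Z_bound by (intro LinfI) auto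
  have "(\<lambda>n. \<rho> (Z n)) \<longlonglongrightarrow> \<rho> X"
    using \<rho>(2) ZL Z_Suc Z_lim Lbox_Linf[OF X] unfolding continuous_from_below_def by blast
  then have "\<forall>\<^sub>F n in sequentially. c < \<rho> (Z n)"
    using c by (rule order_tendstoD(1))
  then show "\<forall>\<^sub>F n in sequentially. c < \<rho> (Xs n)"
  proof eventually_elim
    case (elim n)
    also have "\<rho> (Z n) \<le> \<rho> (Xs n)"
      using Xs by (intro convex_expectation_mono[OF \<rho>(1) ZL _ Z_le]) (auto simp: Lbox_def)
    finally show ?case .
  qed
qed

subsection \<open>Almost optimal densities for a convex expectation\<close>

text \<open>The sublevel sets at \<open>v + 1 / Suc n\<close> decrease, are closed by lower
  semicontinuity and are stable under midpoints, so they share a point; its value is at most the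
  infimum \<open>v\<close>.\<close>

lemma (in prob_space) ae_lsc_attains_min:
  assumes ab: "a \<in> Linf M" "b \<in> Linf M" and ne: "Lbox M a b \<noteq> {}"
    and lsc: "ae_lsc_on M (Lbox M a b) f"
    and mid: "\<And>X Y. X \<in> Lbox M a b \<Longrightarrow> Y \<in> Lbox M a b \<Longrightarrow>
      f (\<lambda>\<omega>. (X \<omega> + Y \<omega>) / 2) \<le> (f X + f Y) / 2"
    and bdd: "\<And>X. X \<in> Lbox M a b \<Longrightarrow> m \<le> f X"
  obtains X where "X \<in> Lbox M a b" "\<And>Y. Y \<in> Lbox M a b \<Longrightarrow> f X \<le> f Y"
proof -
  define v where "v = (INF X\<in>Lbox M a b. f X)"
  have bb: "bdd_below (f ` Lbox M a b)" by (rule bdd_belowI2[OF bdd])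
  have v_le: "v \<le> f X" if "X \<in> Lbox M a b" for X
    unfolding v_def by (rule cINF_lower[OF bb that])
  define C where "C n = {X \<in> Lbox M a b. f X \<le> v + 1 / Suc n}" for n
  obtain X where X: "\<And>n. X \<in> C n"
  proof (rule decreasing_convex_sets_common_point[OF ab, of C])
    fix n
    have "\<exists>X\<in>Lbox M a b. f X < v + 1 / Suc n"
      using cINF_less_iff[OF ne bb, of "v + 1 / Suc n"] by (simp add: v_def)
    then show "C n \<noteq> {}" by (auto simp: C_def intro: less_imp_le)
    have "1 / real (Suc (Suc n)) \<le> 1 / Suc n" by (simp add: field_simps)
    then show "C (Suc n) \<subseteq> C n"
      unfolding C_def by (smt (verit) Collect_mono)
    show "C n \<subseteq> Lbox M a b" by (auto simp: C_def)
  next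
    fix n X Y assume XY: "X \<in> C n" "Y \<in> C n"
    then have "f (\<lambda>\<omega>. (X \<omega> + Y \<omega>) / 2) \<le> (f X + f Y) / 2"
      by (intro mid) (auto simp: C_def)
    moreover have "(\<lambda>\<omega>. (X \<omega> + Y \<omega>) / 2) \<in> Lbox M a b"
      unfolding midpoint_eq using XY by (intro Lbox_convex) (auto simp: C_def)
    moreover have "f X \<le> v + 1 / Suc n" "f Y \<le> v + 1 / Suc n" using XY by (auto simp: C_def)
    ultimately show "(\<lambda>\<omega>. (X \<omega> + Y \<omega>) / 2) \<in> C n" unfolding C_def by simp
  next
    fix n Xs X assume *: "\<And>k::nat. Xs k \<in> C n" "X \<in> Lbox M a b"
      "AE \<omega> in M. (\<lambda>k. Xs k \<omega>) \<longlonglongrightarrow> X \<omega>"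
    have "f X \<le> v + 1 / Suc n"
      by (rule ae_lsc_onD_le[OF lsc, of Xs]) (use * in \<open>auto simp: C_def\<close>)
    then show "X \<in> C n" using * by (simp add: C_def)
  qed blast
  have "f X \<le> v"
  proof (rule field_le_epsilon)
    fix e :: real assume "0 < e"
    then obtain n where "1 / Suc n < e" by (rule nat_approx_posE)
    moreover have "f X \<le> v + 1 / Suc n" using X[of n] by (simp add: C_def)
    ultimately show "f X \<le> v + e" by linarith
  qed
  then show thesis using that[of X] X[of 0] v_le by (force simp: C_def)
qed

section \<open>Squared distances to the intervals [-n, n] and the penalties built from them\<close>

definition overshoot :: "nat \<Rightarrow> real \<Rightarrow> real" where
  "overshoot n y = y - max (- real n) (min (real n) y)"

lemma overshoot_0 [simp]: "overshoot 0 y = y"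
  by (auto simp: overshoot_def)

lemma overshoot_eq_0_iff: "overshoot n y = 0 \<longleftrightarrow> \<bar>y\<bar> \<le> n"
  by (auto simp: overshoot_def max_def min_def)

text \<open>The truncation of \<open>y\<close> is the nearest point of [-n, n], so any other
  \<open>c\<close> in this interval is at least as far away. Taking the truncation of
  \<open>y\<close> as nearby point of \<open>y + d\<close> gives the second-order bound
  \<open>overshoot_square_add_le\<close>; taking the average of two truncations gives midpoint
  convexity.\<close>

lemma overshoot_square_le:
  assumes "\<bar>c\<bar> \<le> n" shows "(overshoot n y)\<^sup>2 \<le> (y - c)\<^sup>2"
proof -
  have "\<bar>overshoot n y\<bar> \<le> \<bar>y - c\<bar>" using assms by (auto simp: overshoot_def max_def min_def)
  then show ?thesis by (simp add: abs_le_square_iff)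
qed

lemma overshoot_square_add_le:
  "(overshoot n (y + d))\<^sup>2 \<le> (overshoot n y)\<^sup>2 + 2 * overshoot n y * d + d\<^sup>2"
proof -
  have "(overshoot n (y + d))\<^sup>2 \<le> (y + d - max (- real n) (min (real n) y))\<^sup>2"
    by (rule overshoot_square_le) auto
  also have "\<dots> = (overshoot n y)\<^sup>2 + 2 * overshoot n y * d + d\<^sup>2"
    by (simp add: overshoot_def power2_eq_square algebra_simps)
  finally show ?thesis .
qed

lemma overshoot_square_midpoint:
  "(overshoot n ((x + y) / 2))\<^sup>2 \<le> ((overshoot n x)\<^sup>2 + (overshoot n y)\<^sup>2) / 2"
proof -
  define p where "p z = max (- real n) (min (real n) z)" for z
  have "(overshoot n ((x + y) / 2))\<^sup>2 \<le> ((x + y) / 2 - (p x + p y) / 2)\<^sup>2"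
    by (rule overshoot_square_le) (auto simp: p_def)
  also have "(x + y) / 2 - (p x + p y) / 2 = (overshoot n x + overshoot n y) / 2"
    by (simp add: overshoot_def p_def field_simps)
  also have "((overshoot n x + overshoot n y) / 2)\<^sup>2 \<le> ((overshoot n x)\<^sup>2 + (overshoot n y)\<^sup>2) / 2"
  proof -
    have "0 \<le> (overshoot n x - overshoot n y)\<^sup>2" by simp
    then show ?thesis by (simp add: power2_eq_square field_simps)
  qed
  finally show ?thesis .
qed

lemma overshoot_square_le_mult: "(overshoot n y)\<^sup>2 \<le> overshoot n y * y"
proof -
  have "0 \<le> overshoot n y * (y - overshoot n y)"
    by (auto simp: overshoot_def max_def min_def mult_le_0_iff)
  then show ?thesis by (simp add: power2_eq_square algebra_simps)
qed

lemma overshoot_continuous [continuous_intros]: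
  "continuous_on A h \<Longrightarrow> continuous_on A (\<lambda>x. overshoot n (h x))"
  unfolding overshoot_def by (intro continuous_intros)

lemma overshoot_measurable [measurable]: "overshoot n \<in> borel_measurable borel"
  unfolding overshoot_def by measurable

lemma abs_overshoot_le: "\<bar>overshoot n y\<bar> \<le> \<bar>y\<bar>"
  by (auto simp: overshoot_def max_def min_def)

lemma Linf_overshoot [intro]:
  assumes "Y \<in> Linf M" shows "(\<lambda>\<omega>. overshoot n (Y \<omega>)) \<in> Linf M"
proof -
  obtain C where C: "0 \<le> C" "AE \<omega> in M. \<bar>Y \<omega>\<bar> \<le> C" by (rule LinfE[OF assms])
  have [measurable]: "Y \<in> borel_measurable M" using assms by (simp add: Linf_def)
  have "AE \<omega> in M. \<bar>overshoot n (Y \<omega>)\<bar> \<le> C"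
    using C(2) by eventually_elim (use abs_overshoot_le in \<open>blast intro: order_trans\<close>)
  then show ?thesis by (intro LinfI) auto
qed

text \<open>This is \<open>E[F Y]\<close> for
  \<open>F y = (\<Sum>i. c i * (overshoot i y)\<^sup>2)\<close> as long as
  \<open>|Y| \<le> n\<close>, since the terms with \<open>i \<ge> n\<close> vanish there. With free
  coefficients \<open>F\<close> can grow at any rate, and \<open>c i\<close> acts only beyond level
  \<open>i\<close>, which allows the coefficients to be chosen one after the other.\<close>

definition level_penalty :: "'a measure \<Rightarrow> (nat \<Rightarrow> real) \<Rightarrow> nat \<Rightarrow> ('a \<Rightarrow> real) \<Rightarrow> real" where
  "level_penalty M c n Y = (\<Sum>i<n. c i * (LINT \<omega>|M. (overshoot i (Y \<omega>))\<^sup>2))"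

lemma (in prob_space) integrable_overshoot_square:
  "Y \<in> Linf M \<Longrightarrow> integrable M (\<lambda>\<omega>. (overshoot i (Y \<omega>))\<^sup>2)"
  by (intro Linf_integrable Linf_power Linf_overshoot)

lemma level_penalty_nonneg: "(\<And>i. 0 \<le> c i) \<Longrightarrow> 0 \<le> level_penalty M c n Y"
  unfolding level_penalty_def by (intro sum_nonneg mult_nonneg_nonneg) auto

lemma (in prob_space) integral_overshoot_square_midpoint:
  assumes "X \<in> Linf M" "Y \<in> Linf M"
  shows "(LINT \<omega>|M. (overshoot i ((X \<omega> + Y \<omega>) / 2))\<^sup>2) \<le>
    ((LINT \<omega>|M. (overshoot i (X \<omega>))\<^sup>2) + (LINT \<omega>|M. (overshoot i (Y \<omega>))\<^sup>2)) / 2 -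
    (if i = 0 then (LINT \<omega>|M. (X \<omega> - Y \<omega>)\<^sup>2) / 4 else 0)"
proof (cases "i = 0")
  case True
  then show ?thesis using integral_midpoint_square[OF assms] by simp
next
  case False
  have "(LINT \<omega>|M. (overshoot i ((X \<omega> + Y \<omega>) / 2))\<^sup>2) \<le>
      (LINT \<omega>|M. ((overshoot i (X \<omega>))\<^sup>2 + (overshoot i (Y \<omega>))\<^sup>2) / 2)"
    using assms by (intro integral_mono overshoot_square_midpoint integrable_overshoot_square
        Linf_cdivide Linf_add Linf_integrable Linf_power Linf_overshoot)
  then show ?thesis
    using False integrable_overshoot_square[OF assms(1), of i]
      integrable_overshoot_square[OF assms(2), of i] by simp
qed

text \<open>Every summand is midpoint convex, but only \<open>i = 0\<close>, where
  \<open>overshoot 0 y = y\<close>, contributes a quadratic gain. This single term makes the penalty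
  uniformly convex.\<close>

lemma (in prob_space) level_penalty_midpoint:
  assumes XY: "X \<in> Linf M" "Y \<in> Linf M" and c: "\<And>i. 0 \<le> c i"
  shows "level_penalty M c n (\<lambda>\<omega>. (X \<omega> + Y \<omega>) / 2) \<le>
    (level_penalty M c n X + level_penalty M c n Y) / 2 -
    (if 0 < n then c 0 * (LINT \<omega>|M. (X \<omega> - Y \<omega>)\<^sup>2) / 4 else 0)"
proof -
  let ?D = "(LINT \<omega>|M. (X \<omega> - Y \<omega>)\<^sup>2) / 4"
  let ?w = "\<lambda>i X. LINT \<omega>|M. (overshoot i (X \<omega>))\<^sup>2"
  have "level_penalty M c n (\<lambda>\<omega>. (X \<omega> + Y \<omega>) / 2) \<le>
      (\<Sum>i<n. c i * ((?w i X + ?w i Y) / 2 - (if i = 0 then ?D else 0)))"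
    unfolding level_penalty_def
    by (intro sum_mono mult_left_mono integral_overshoot_square_midpoint XY c)
  also have "\<dots> = (\<Sum>i<n. c i * ?w i X / 2 + c i * ?w i Y / 2 - (if i = 0 then c 0 * ?D else 0))"
    by (intro sum.cong) (auto simp: field_simps)
  also have "\<dots> = (level_penalty M c n X + level_penalty M c n Y) / 2 - (if 0 < n then c 0 * ?D else 0)"
    by (simp add: level_penalty_def sum.distrib sum_subtractf sum_divide_distrib add_divide_distrib
        sum.delta')
  finally show ?thesis by (simp split: if_splits)
qed

lemma (in prob_space) level_penalty_midpoint_le:
  assumes "X \<in> Linf M" "Y \<in> Linf M" and c: "\<And>i. 0 \<le> c i"
  shows "level_penalty M c n (\<lambda>\<omega>. (X \<omega> + Y \<omega>) / 2) \<le>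
    (level_penalty M c n X + level_penalty M c n Y) / 2"
proof -
  have "0 \<le> c 0 * (LINT \<omega>|M. (X \<omega> - Y \<omega>)\<^sup>2) / 4" using c[of 0] by simp
  then show ?thesis using level_penalty_midpoint[where c = c and n = n, OF assms]
    by (cases "0 < n") (simp_all, argo)
qed

lemma level_penalty_tendsto:
  assumes "prob_space M" "a \<in> Linf M" "b \<in> Linf M" "\<And>n::nat. Xs n \<in> Lbox M a b" "X \<in> Lbox M a b"
    "AE \<omega> in M. (\<lambda>n. Xs n \<omega>) \<longlonglongrightarrow> X \<omega>"
  shows "(\<lambda>k. level_penalty M c n (Xs k)) \<longlonglongrightarrow> level_penalty M c n X"
proof -
  interpret prob_space M by fact
  obtain K where K: "0 \<le> K" "\<And>X. X \<in> Lbox M a b \<Longrightarrow> AE \<omega> in M. \<bar>X \<omega>\<bar> \<le> K"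
    using Lbox_bound[OF assms(2,3)] by blast
  have [measurable]: "X \<in> borel_measurable M" "Xs k \<in> borel_measurable M" for k
    using assms(4)[of k] assms(5) by (simp_all add: Lbox_def Linf_def)
  have "(\<lambda>k. LINT \<omega>|M. 1 * (overshoot i (Xs k \<omega>))\<^sup>2) \<longlonglongrightarrow> (LINT \<omega>|M. 1 * (overshoot i (X \<omega>))\<^sup>2)" for i
  proof (rule tendsto_integral_mult_bounded[where C = "K\<^sup>2"])
    show "AE \<omega> in M. \<bar>(overshoot i (Xs k \<omega>))\<^sup>2\<bar> \<le> K\<^sup>2" for k
      using K(2)[OF assms(4)[of k]]
    proof eventually_elim
      case (elim \<omega>)
      then have "\<bar>overshoot i (Xs k \<omega>)\<bar> \<le> \<bar>K\<bar>" using abs_overshoot_le[of i "Xs k \<omega>"] by linarith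
      then show ?case by (simp add: abs_le_square_iff)
    qed
    have cont: "isCont (overshoot i) y" for y
      using overshoot_continuous[of UNIV "\<lambda>x. x" i] by (auto simp: continuous_on_eq_continuous_at)
    show "AE \<omega> in M. (\<lambda>k. (overshoot i (Xs k \<omega>))\<^sup>2) \<longlonglongrightarrow> (overshoot i (X \<omega>))\<^sup>2"
      using assms(6) by eventually_elim (intro tendsto_intros isCont_tendsto_compose[OF cont])
  qed auto
  then show ?thesis
    unfolding level_penalty_def by (intro tendsto_intros) simp
qed

lemma level_penalty_ae_lsc:
  assumes "prob_space M" "a \<in> Linf M" "b \<in> Linf M"
  shows "ae_lsc_on M (Lbox M a b) (level_penalty M c n)"
  by (rule ae_lsc_on_tendsto) (rule level_penalty_tendsto[OF assms])

lemma level_penalty_cong: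
  "(\<And>i. i < n \<Longrightarrow> c i = c' i) \<Longrightarrow> level_penalty M c n Y = level_penalty M c' n Y"
  unfolding level_penalty_def by (intro sum.cong) auto

text \<open>
  This step replaces the Krein--Smulian argument: if no coefficient \<open>x\<close> works, compactness of the
  box yields a function bounded by \<open>n\<close> that violates the hypothesis.
\<close>

lemma (in prob_space) level_penalty_step:
  assumes \<rho>: "convex_expectation M \<rho>" "continuous_from_below M \<rho>"
    and c: "\<And>i. 0 \<le> c i" and d: "d < d'"
    and le: "\<And>Y. Y \<in> Lbox M (\<lambda>_. - real n) (\<lambda>_. real n) \<Longrightarrow> - \<rho> Y \<le> level_penalty M c n Y + d"
  shows "\<exists>x\<ge>1. \<forall>Y\<in>Lbox M (\<lambda>_. - real (Suc n)) (\<lambda>_. real (Suc n)).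
    - \<rho> Y \<le> level_penalty M c n Y + x * (LINT \<omega>|M. (overshoot n (Y \<omega>))\<^sup>2) + d'"
proof (rule ccontr)
  assume neg: "\<not> ?thesis"
  let ?B = "Lbox M (\<lambda>_. - real (Suc n)) (\<lambda>_. real (Suc n))"
  define w where "w Y = (LINT \<omega>|M. (overshoot n (Y \<omega>))\<^sup>2)" for Y
  define F where "F k Y = \<rho> Y + level_penalty M (c(n := real k)) (Suc n) Y" for k Y
  have F_eq: "F k Y = \<rho> Y + level_penalty M c n Y + real k * w Y" for k Y
    by (simp add: F_def level_penalty_def w_def)
  have w0: "0 \<le> w Y" for Y by (simp add: w_def)
  \<comment> \<open>\<open>Suc k\<close>, because the negated claim supplies violating functions
    only for coefficients that are at least 1.\<close>
  define C where "C k = {Y \<in> ?B. F (Suc k) Y \<le> - d'}" for k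
  obtain Y where Y: "\<And>k. Y \<in> C k"
  proof (rule decreasing_convex_sets_common_point[of "\<lambda>_. - real (Suc n)" "\<lambda>_. real (Suc n)" C])
    fix k
    have "1 \<le> real (Suc k)" by simp
    then obtain Y where "Y \<in> ?B" "\<not> - \<rho> Y \<le> level_penalty M c n Y + real (Suc k) * w Y + d'"
      using neg unfolding w_def by blast
    then have "Y \<in> C k" unfolding C_def F_eq by simp
    then show "C k \<noteq> {}" by blast
    have "F (Suc k) Y \<le> F (Suc (Suc k)) Y" for Y
      unfolding F_eq using w0[of Y] by (simp add: algebra_simps)
    then show "C (Suc k) \<subseteq> C k" unfolding C_def using order_trans by blast
    show "C k \<subseteq> ?B" by (auto simp: C_def)
  next
    fix k X Y assume XY: "X \<in> C k" "Y \<in> C k"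
    then have L: "X \<in> Linf M" "Y \<in> Linf M" by (auto simp: C_def Lbox_def)
    have "0 \<le> (c(n := real (Suc k))) i" for i using c by simp
    then have "F (Suc k) (\<lambda>\<omega>. (X \<omega> + Y \<omega>) / 2) \<le> (F (Suc k) X + F (Suc k) Y) / 2"
      using convex_expectation_midpoint[OF \<rho>(1) L]
        level_penalty_midpoint_le[OF L, of "c(n := real (Suc k))" "Suc n"]
      unfolding F_def by argo
    also have "\<dots> \<le> - d'" using XY by (simp add: C_def)
    finally have "F (Suc k) (\<lambda>\<omega>. (X \<omega> + Y \<omega>) / 2) \<le> - d'" .
    moreover have "(\<lambda>\<omega>. (X \<omega> + Y \<omega>) / 2) \<in> ?B"
      unfolding midpoint_eq using XY by (intro Lbox_convex) (auto simp: C_def)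
    ultimately show "(\<lambda>\<omega>. (X \<omega> + Y \<omega>) / 2) \<in> C k" by (simp add: C_def)
  next
    fix k Xs X assume *: "\<And>j::nat. Xs j \<in> C k" "X \<in> ?B"
      "AE \<omega> in M. (\<lambda>j. Xs j \<omega>) \<longlonglongrightarrow> X \<omega>"
    have "ae_lsc_on M ?B (F (Suc k))"
      unfolding F_def
      by (intro ae_lsc_on_add convex_expectation_ae_lsc \<rho> level_penalty_ae_lsc prob_space_axioms) auto
    then have "F (Suc k) X \<le> - d'"
      by (rule ae_lsc_onD_le) (use * in \<open>auto simp: C_def\<close>)
    then show "X \<in> C k" using * by (simp add: C_def)
  qed auto
  have YL: "Y \<in> Linf M" and YF: "\<rho> Y + level_penalty M c n Y + real (Suc k) * w Y \<le> - d'" for k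
    using Y[of k] unfolding C_def F_eq by (auto simp: Lbox_def)
  \<comment> \<open>The one function \<open>Y\<close> violates the estimate for every coefficient
    \<open>Suc k\<close>, which is possible only if it stays in [-n, n] a.e.; there the hypothesis
    applies with the smaller constant \<open>d\<close>.\<close>
  have "w Y = 0"
  proof (rule ccontr)
    assume "w Y \<noteq> 0"
    then have "0 < w Y" using w0[of Y] by simp
    then obtain k :: nat where "- d' - \<rho> Y - level_penalty M c n Y < real k * w Y"
      using reals_Archimedean3 by blast
    moreover have "real k * w Y \<le> real (Suc k) * w Y" using \<open>0 < w Y\<close> by (simp add: algebra_simps)
    ultimately show False using YF[of k] by linarith
  qed
  then have "AE \<omega> in M. (overshoot n (Y \<omega>))\<^sup>2 = 0"
    using integral_nonneg_eq_0_iff_AE[OF integrable_overshoot_square[OF YL, of n]] by (simp add: w_def)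
  then have "AE \<omega> in M. - real n \<le> Y \<omega> \<and> Y \<omega> \<le> real n"
    by eventually_elim (auto simp: overshoot_eq_0_iff)
  then have "- \<rho> Y \<le> level_penalty M c n Y + d"
    using YL by (intro le) (simp add: Lbox_def)
  then show False using YF[of 0] \<open>w Y = 0\<close> d by simp
qed

text \<open>\<open>level_penalty_step\<close> fixes one coefficient at a time and leaves the earlier
  ones untouched, so the successive choices have a diagonal. Each step consumes a strictly larger
  error, hence the increasing budget \<open>d n\<close>, which starts at 0 and stays below
  \<open>e\<close>.\<close>

lemma (in prob_space) level_penalty_exists:
  assumes \<rho>: "convex_expectation M \<rho>" "continuous_from_below M \<rho>" "\<rho> (\<lambda>_. 0) = 0" and e: "0 < e"
  obtains c where "\<And>i. 1 \<le> c i"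
    "\<And>n Y. Y \<in> Lbox M (\<lambda>_. - real n) (\<lambda>_. real n) \<Longrightarrow> - \<rho> Y \<le> level_penalty M c n Y + e"
proof -
  define d where "d n = e * (1 - 1 / real (Suc n))" for n
  have d_less: "d n < d (Suc n)" for n
    unfolding d_def using e by (intro mult_strict_left_mono) (auto simp: field_simps)
  let ?P = "\<lambda>n c. (\<forall>i. 1 \<le> c i) \<and>
    (\<forall>Y\<in>Lbox M (\<lambda>_. - real n) (\<lambda>_. real n). - \<rho> Y \<le> level_penalty M c n Y + d n)"
  have "\<exists>c. \<forall>n. ?P n (c n) \<and> (\<forall>i<n. c (Suc n) i = c n i)"
  proof (rule dependent_nat_choice)
    have "- \<rho> Y \<le> 0" if "Y \<in> Lbox M (\<lambda>_. - real 0) (\<lambda>_. real 0)" for Y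
      using that convex_expectation_ge[OF \<rho>(1), of Y 0] by (auto simp: Lbox_def \<rho>(3))
    then show "\<exists>c. ?P 0 c"
      by (intro exI[of _ "\<lambda>_. 1"]) (auto simp: d_def level_penalty_def)
  next
    fix c n assume c: "?P n c"
    then obtain x where x: "1 \<le> x" "\<And>Y. Y \<in> Lbox M (\<lambda>_. - real (Suc n)) (\<lambda>_. real (Suc n)) \<Longrightarrow>
        - \<rho> Y \<le> level_penalty M c n Y + x * (LINT \<omega>|M. (overshoot n (Y \<omega>))\<^sup>2) + d (Suc n)"
    proof -
      have "0 \<le> c i" for i using c order_trans[OF zero_le_one] by blast
      then show thesis
        using level_penalty_step[where c = c and n = n, OF \<rho>(1,2) _ d_less[of n]] c that by blast
    qed
    have "level_penalty M c n Y + x * (LINT \<omega>|M. (overshoot n (Y \<omega>))\<^sup>2) =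
        level_penalty M (c(n := x)) (Suc n) Y" for Y
      by (simp add: level_penalty_def)
    with x c show "\<exists>c'. ?P (Suc n) c' \<and> (\<forall>i<n. c' i = c i)"
      by (intro exI[of _ "c(n := x)"]) auto
  qed
  then obtain c where c: "\<And>n. ?P n (c n)" "\<And>n i. i < n \<Longrightarrow> c (Suc n) i = c n i"
    by blast
  \<comment> \<open>Coefficient \<open>i\<close> is frozen from stage \<open>Suc i\<close>
    on.\<close>
  define c' where "c' i = c (Suc i) i" for i
  have stable: "c (Suc i + k) i = c' i" for i k
    by (induction k) (auto simp: c'_def c(2))
  show thesis
  proof (rule that[of c'])
    show "1 \<le> c' i" for i using c(1) by (simp add: c'_def)
    fix n Y assume Y: "Y \<in> Lbox M (\<lambda>_. - real n) (\<lambda>_. real n)"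
    then have "- \<rho> Y \<le> level_penalty M (c n) n Y + d n" using c(1)[of n] by blast
    also have "level_penalty M (c n) n Y = level_penalty M c' n Y"
    proof (rule level_penalty_cong)
      fix i assume "i < n"
      then show "c n i = c' i" using stable[of i "n - Suc i"] by simp
    qed
    also have "d n \<le> e" using e by (simp add: d_def field_simps)
    finally show "- \<rho> Y \<le> level_penalty M c' n Y + e" by simp
  qed
qed

text \<open>Half the derivative of the locally finite sum \<open>\<Sum>i. c i * (overshoot i y)\<^sup>2\<close>.\<close>

definition slope :: "(nat \<Rightarrow> real) \<Rightarrow> real \<Rightarrow> real" where
  "slope c y = (\<Sum>i<nat \<lceil>\<bar>y\<bar>\<rceil>. c i * overshoot i y)"

lemma slope_eq:
  assumes "\<bar>y\<bar> \<le> real n" shows "slope c y = (\<Sum>i<n. c i * overshoot i y)"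
  unfolding slope_def
proof (rule sum.mono_neutral_left)
  show "{..<nat \<lceil>\<bar>y\<bar>\<rceil>} \<subseteq> {..<n}" using assms by (auto simp: ceiling_le_iff nat_le_iff less_le_trans)
  show "\<forall>i\<in>{..<n} - {..<nat \<lceil>\<bar>y\<bar>\<rceil>}. c i * overshoot i y = 0"
    by (auto simp: overshoot_eq_0_iff)
qed simp

lemma slope_isCont: "isCont (slope c) y"
proof -
  define n where "n = nat \<lceil>\<bar>y\<bar>\<rceil> + 1"
  have y: "\<bar>y\<bar> < real n" unfolding n_def by linarith
  have "isCont (\<lambda>y. \<Sum>i<n. c i * overshoot i y) y"
  proof -
    have "continuous_on UNIV (\<lambda>y. \<Sum>i<n. c i * overshoot i y)" by (intro continuous_intros)
    then show ?thesis by (simp add: continuous_on_eq_continuous_at)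
  qed
  moreover have "\<forall>\<^sub>F z in nhds y. slope c z = (\<Sum>i<n. c i * overshoot i z)"
  proof -
    have "\<forall>\<^sub>F z in nhds y. z \<in> {- real n<..<real n}"
      by (rule eventually_nhds_in_open) (use y in auto)
    then show ?thesis by eventually_elim (rule slope_eq, auto)
  qed
  ultimately show ?thesis by (simp add: isCont_cong)
qed

lemma slope_measurable [measurable]: "slope c \<in> borel_measurable borel"
  by (intro borel_measurable_continuous_onI continuous_at_imp_continuous_on ballI slope_isCont)

lemma overshoot_mult_nonneg: "0 \<le> overshoot n y * y"
  using overshoot_square_le_mult[of n y] zero_le_power2[of "overshoot n y"] by linarith

lemma slope_mult_nonneg: "(\<And>i. 0 \<le> c i) \<Longrightarrow> 0 \<le> slope c y * y"
  unfolding slope_def sum_distrib_right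
  by (intro sum_nonneg) (simp add: mult.assoc overshoot_mult_nonneg)

text \<open>For \<open>|y| \<le> 1\<close> the slope is \<open>c 0 * y\<close>, and beyond that the
  factor \<open>|y|\<close> only enlarges it. A bound on the integral of
  \<open>slope c y * y\<close> thereby becomes an L1 bound on the slope itself.\<close>

lemma abs_slope_le:
  assumes "\<And>i. 0 \<le> c i"
  shows "\<bar>slope c y\<bar> \<le> c 0 + slope c y * y"
proof (cases "\<bar>y\<bar> \<le> 1")
  case True
  then have "slope c y = c 0 * y" using slope_eq[of y 1 c] by simp
  then have "\<bar>slope c y\<bar> \<le> c 0" using True assms[of 0] by (simp add: abs_mult mult_left_le)
  then show ?thesis using slope_mult_nonneg[of c y] assms by simp
next
  case False
  then have "\<bar>slope c y\<bar> * 1 \<le> \<bar>slope c y\<bar> * \<bar>y\<bar>" by (intro mult_left_mono) auto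
  also have "\<dots> = slope c y * y" using slope_mult_nonneg[of c y] assms by (simp add: abs_mult[symmetric])
  finally show ?thesis using assms[of 0] by simp
qed

section \<open>Uniform integrability through truncation\<close>

definition clamp_real :: "nat \<Rightarrow> real \<Rightarrow> real" where
  "clamp_real n y = max (- real n) (min (real n) y)"

lemma clamp_real_measurable [measurable]: "clamp_real n \<in> borel_measurable borel"
  unfolding clamp_real_def by measurable

text \<open>\<open>slope c\<close> is nondecreasing and vanishes at 0, and truncation moves
  \<open>y\<close> towards 0 without crossing it. The common bound \<open>N\<close> turns both
  slopes into sums over the same index set.\<close>

lemma slope_clamp_between:
  assumes c: "\<And>i. 0 \<le> c i"
  shows "(0 \<le> y \<longrightarrow> 0 \<le> slope c (clamp_real n y) \<and> slope c (clamp_real n y) \<le> slope c y) \<and>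
    (y \<le> 0 \<longrightarrow> slope c y \<le> slope c (clamp_real n y) \<and> slope c (clamp_real n y) \<le> 0)"
proof -
  define N where "N = nat \<lceil>\<bar>y\<bar>\<rceil> + n"
  have "\<bar>y\<bar> \<le> real N" "\<bar>clamp_real n y\<bar> \<le> real N"
    unfolding N_def clamp_real_def by linarith+
  then have *: "slope c y = (\<Sum>i<N. c i * overshoot i y)"
    "slope c (clamp_real n y) = (\<Sum>i<N. c i * overshoot i (clamp_real n y))"
    by (auto intro: slope_eq)
  have "(0 \<le> y \<longrightarrow> 0 \<le> overshoot i (clamp_real n y) \<and> overshoot i (clamp_real n y) \<le> overshoot i y) \<and>
    (y \<le> 0 \<longrightarrow> overshoot i y \<le> overshoot i (clamp_real n y) \<and> overshoot i (clamp_real n y) \<le> 0)" for i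
    by (auto simp: overshoot_def clamp_real_def max_def min_def)
  then show ?thesis
    unfolding * by (auto intro!: sum_mono sum_nonneg sum_nonpos mult_left_mono c mult_nonneg_nonneg
        mult_nonneg_nonpos)
qed

text \<open>Truncation changes something only where \<open>|y| > n\<close>, and there
  \<open>n\<close> may be replaced by \<open>|y|\<close>. Divided by \<open>n\<close>, this makes
  the truncation error small uniformly over a sequence of bounded energy, as in the de la
  Vallee-Poussin criterion.\<close>

lemma slope_clamp_error:
  assumes c: "\<And>i. 0 \<le> c i"
  shows "real n * \<bar>slope c y - slope c (clamp_real n y)\<bar> \<le> slope c y * y"
proof (cases "\<bar>y\<bar> \<le> real n")
  case True
  then have "clamp_real n y = y" by (auto simp: clamp_real_def)
  then show ?thesis using slope_mult_nonneg[of c y] c by simp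
next
  case False
  have "\<bar>slope c y - slope c (clamp_real n y)\<bar> \<le> \<bar>slope c y\<bar>"
    using slope_clamp_between[of c y n, OF c] by (cases "0 \<le> y") auto
  then have "real n * \<bar>slope c y - slope c (clamp_real n y)\<bar> \<le> \<bar>y\<bar> * \<bar>slope c y\<bar>"
    using False by (intro mult_mono) auto
  also have "\<dots> = slope c y * y"
    using slope_mult_nonneg[of c y] c by (simp add: abs_mult[symmetric] mult.commute)
  finally show ?thesis .
qed

lemma abs_slope_clamp_le:
  assumes c: "\<And>i. 0 \<le> c i"
  shows "\<bar>slope c (clamp_real n y)\<bar> \<le> \<bar>slope c y\<bar>"
    and "\<bar>slope c (clamp_real n y)\<bar> \<le> (\<Sum>i<n. c i * real n)"
proof -
  show "\<bar>slope c (clamp_real n y)\<bar> \<le> \<bar>slope c y\<bar>"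
    using slope_clamp_between[of c y n, OF c] by (cases "0 \<le> y") auto
  have "\<bar>clamp_real n y\<bar> \<le> real n" by (auto simp: clamp_real_def)
  then have "\<bar>slope c (clamp_real n y)\<bar> \<le> (\<Sum>i<n. \<bar>c i * overshoot i (clamp_real n y)\<bar>)"
    by (simp add: slope_eq)
  also have "\<dots> \<le> (\<Sum>i<n. c i * real n)"
  proof (rule sum_mono)
    fix i
    have "\<bar>overshoot i (clamp_real n y)\<bar> \<le> real n"
      using abs_overshoot_le[of i "clamp_real n y"] \<open>\<bar>clamp_real n y\<bar> \<le> real n\<close> by linarith
    then show "\<bar>c i * overshoot i (clamp_real n y)\<bar> \<le> c i * real n"
      using c[of i] by (auto simp: abs_mult intro: mult_left_mono)
  qed
  finally show "\<bar>slope c (clamp_real n y)\<bar> \<le> (\<Sum>i<n. c i * real n)" .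
qed

section \<open>First variation of the penalty\<close>

lemma Lbox_ball_AE: "Y \<in> Lbox M (\<lambda>_. - real n) (\<lambda>_. real n) \<longleftrightarrow> Y \<in> Linf M \<and> (AE \<omega> in M. \<bar>Y \<omega>\<bar> \<le> real n)"
proof -
  have "(- real n \<le> y \<and> y \<le> real n) \<longleftrightarrow> \<bar>y\<bar> \<le> real n" for y by auto
  then show ?thesis by (simp add: Lbox_def)
qed

lemma Linf_slope:
  assumes "Y \<in> Linf M" shows "(\<lambda>\<omega>. slope c (Y \<omega>)) \<in> Linf M"
proof -
  obtain C where C: "0 \<le> C" "AE \<omega> in M. \<bar>Y \<omega>\<bar> \<le> C" by (rule LinfE[OF assms])
  obtain n :: nat where n: "C \<le> real n" using real_arch_simple by blast
  have L: "(\<lambda>\<omega>. \<Sum>i<n. c i * overshoot i (Y \<omega>)) \<in> Linf M"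
    by (intro Linf_sum Linf_cmult Linf_overshoot assms)
  obtain D where D: "0 \<le> D" "AE \<omega> in M. \<bar>\<Sum>i<n. c i * overshoot i (Y \<omega>)\<bar> \<le> D" by (rule LinfE[OF L])
  have [measurable]: "Y \<in> borel_measurable M" using assms by (simp add: Linf_def)
  have "AE \<omega> in M. \<bar>slope c (Y \<omega>)\<bar> \<le> D"
    using C(2) D(2) by eventually_elim (use n in \<open>simp add: slope_eq[of _ n]\<close>)
  then show ?thesis by (intro LinfI) auto
qed

text \<open>Summing \<open>overshoot_square_add_le\<close> gives an upper bound with the derivative
  as linear term and a remainder of order \<open>t\<^sup>2\<close>. \<open>Y\<close> lies in the
  ball of radius \<open>n\<close>, so the finite sum is its full slope, whereas the perturbed
  function may leave the ball.\<close>

lemma (in prob_space) level_penalty_perturb: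
  assumes Y: "Y \<in> Lbox M (\<lambda>_. - real n) (\<lambda>_. real n)" and D: "D \<in> Linf M" and c: "\<And>i. 0 \<le> c i"
  shows "level_penalty M c n (\<lambda>\<omega>. Y \<omega> + t * D \<omega>) \<le> level_penalty M c n Y +
    2 * t * (LINT \<omega>|M. slope c (Y \<omega>) * D \<omega>) + t\<^sup>2 * ((\<Sum>i<n. c i) * (LINT \<omega>|M. (D \<omega>)\<^sup>2))"
proof -
  have YL: "Y \<in> Linf M" using Y by (rule Lbox_Linf)
  have i1: "integrable M (\<lambda>\<omega>. (overshoot i (Y \<omega>))\<^sup>2)" "integrable M (\<lambda>\<omega>. overshoot i (Y \<omega>) * D \<omega>)"
    "integrable M (\<lambda>\<omega>. (D \<omega>)\<^sup>2)" for i
    by (intro Linf_integrable Linf_mult Linf_power Linf_overshoot YL D)+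
  have "(LINT \<omega>|M. (overshoot i (Y \<omega> + t * D \<omega>))\<^sup>2) \<le>
      (LINT \<omega>|M. (overshoot i (Y \<omega>))\<^sup>2 + (2 * t) * (overshoot i (Y \<omega>) * D \<omega>) + t\<^sup>2 * (D \<omega>)\<^sup>2)" for i
  proof (rule integral_mono)
    show "integrable M (\<lambda>\<omega>. (overshoot i (Y \<omega> + t * D \<omega>))\<^sup>2)"
      by (intro integrable_overshoot_square Linf_add Linf_cmult YL D)
    show "(overshoot i (Y \<omega> + t * D \<omega>))\<^sup>2 \<le>
        (overshoot i (Y \<omega>))\<^sup>2 + (2 * t) * (overshoot i (Y \<omega>) * D \<omega>) + t\<^sup>2 * (D \<omega>)\<^sup>2" for \<omega>
      using overshoot_square_add_le[of i "Y \<omega>" "t * D \<omega>"] by (simp add: power_mult_distrib mult_ac)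
  qed (intro Bochner_Integration.integrable_add integrable_mult_right i1)
  then have "(LINT \<omega>|M. (overshoot i (Y \<omega> + t * D \<omega>))\<^sup>2) \<le> (LINT \<omega>|M. (overshoot i (Y \<omega>))\<^sup>2) +
      (2 * t) * (LINT \<omega>|M. overshoot i (Y \<omega>) * D \<omega>) + t\<^sup>2 * (LINT \<omega>|M. (D \<omega>)\<^sup>2)" for i
    using i1 by simp
  then have "level_penalty M c n (\<lambda>\<omega>. Y \<omega> + t * D \<omega>) \<le> (\<Sum>i<n. c i * ((LINT \<omega>|M. (overshoot i (Y \<omega>))\<^sup>2) +
      (2 * t) * (LINT \<omega>|M. overshoot i (Y \<omega>) * D \<omega>) + t\<^sup>2 * (LINT \<omega>|M. (D \<omega>)\<^sup>2)))"
    unfolding level_penalty_def by (intro sum_mono mult_left_mono c)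
  also have "\<dots> = level_penalty M c n Y + 2 * t * (\<Sum>i<n. c i * (LINT \<omega>|M. overshoot i (Y \<omega>) * D \<omega>))
      + t\<^sup>2 * ((\<Sum>i<n. c i) * (LINT \<omega>|M. (D \<omega>)\<^sup>2))"
    by (simp add: level_penalty_def algebra_simps sum.distrib sum_distrib_left sum_distrib_right)
  also have "(\<Sum>i<n. c i * (LINT \<omega>|M. overshoot i (Y \<omega>) * D \<omega>)) = (LINT \<omega>|M. slope c (Y \<omega>) * D \<omega>)"
  proof -
    have "(\<Sum>i<n. c i * (LINT \<omega>|M. overshoot i (Y \<omega>) * D \<omega>)) =
        (LINT \<omega>|M. (\<Sum>i<n. c i * (overshoot i (Y \<omega>) * D \<omega>)))"
      using i1 by simp
    also have "\<dots> = (LINT \<omega>|M. slope c (Y \<omega>) * D \<omega>)"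
    proof (rule integral_cong_AE)
      have [measurable]: "Y \<in> borel_measurable M" "D \<in> borel_measurable M"
        using YL D by (simp_all add: Linf_def)
      show "AE \<omega> in M. (\<Sum>i<n. c i * (overshoot i (Y \<omega>) * D \<omega>)) = slope c (Y \<omega>) * D \<omega>"
        using Y unfolding Lbox_ball_AE
        by (auto elim!: eventually_mono simp: slope_eq sum_distrib_right mult.assoc)
    qed (use YL D in \<open>auto simp: Linf_def\<close>)
    finally show ?thesis .
  qed
  finally show ?thesis .
qed

text \<open>\<open>overshoot_square_le_mult\<close>, term by term. It lets the penalty at a
  minimiser be absorbed by the first-order term.\<close>

lemma (in prob_space) level_penalty_le_slope:
  assumes Y: "Y \<in> Lbox M (\<lambda>_. - real n) (\<lambda>_. real n)" and c: "\<And>i. 0 \<le> c i"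
  shows "level_penalty M c n Y \<le> (LINT \<omega>|M. slope c (Y \<omega>) * Y \<omega>)"
proof -
  have YL: "Y \<in> Linf M" using Y by (rule Lbox_Linf)
  have i1: "integrable M (\<lambda>\<omega>. (overshoot i (Y \<omega>))\<^sup>2)" for i
    by (intro Linf_integrable Linf_power Linf_overshoot YL)
  have "level_penalty M c n Y = (LINT \<omega>|M. (\<Sum>i<n. c i * (overshoot i (Y \<omega>))\<^sup>2))"
    unfolding level_penalty_def using i1 by simp
  also have "\<dots> \<le> (LINT \<omega>|M. slope c (Y \<omega>) * Y \<omega>)"
  proof (rule integral_mono_AE)
    show "AE \<omega> in M. (\<Sum>i<n. c i * (overshoot i (Y \<omega>))\<^sup>2) \<le> slope c (Y \<omega>) * Y \<omega>"
      using Y unfolding Lbox_ball_AE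
    proof (elim conjE eventually_mono)
      fix \<omega> assume "\<bar>Y \<omega>\<bar> \<le> real n"
      then show "(\<Sum>i<n. c i * (overshoot i (Y \<omega>))\<^sup>2) \<le> slope c (Y \<omega>) * Y \<omega>"
        by (auto simp: slope_eq sum_distrib_right mult.assoc
            intro!: sum_mono mult_left_mono overshoot_square_le_mult c)
    qed
  qed (intro Linf_integrable Linf_sum Linf_cmult Linf_power Linf_overshoot Linf_mult Linf_slope YL)+
  finally show ?thesis .
qed

lemma level_penalty_extend:
  assumes Y: "Y \<in> Lbox M (\<lambda>_. - real n) (\<lambda>_. real n)" and "n \<le> m"
  shows "level_penalty M c m Y = level_penalty M c n Y"
  unfolding level_penalty_def
proof (rule sum.mono_neutral_right)
  show "\<forall>i\<in>{..<m} - {..<n}. c i * (LINT \<omega>|M. (overshoot i (Y \<omega>))\<^sup>2) = 0"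
  proof
    fix i assume i: "i \<in> {..<m} - {..<n}"
    have [measurable]: "Y \<in> borel_measurable M" using Y by (simp add: Lbox_def Linf_def)
    have "AE \<omega> in M. (overshoot i (Y \<omega>))\<^sup>2 = 0"
      using Y unfolding Lbox_ball_AE
      by (elim conjE eventually_mono) (use i in \<open>auto simp: overshoot_eq_0_iff\<close>)
    then show "c i * (LINT \<omega>|M. (overshoot i (Y \<omega>))\<^sup>2) = 0"
      by (subst integral_cong_AE[where g = "\<lambda>_. 0"]) auto
  qed
qed (use assms in auto)

text \<open>The first-order condition at a minimiser of \<open>\<rho> + 2 * level_penalty M c k\<close> over a ball.\<close>

lemma (in prob_space) penalized_minimizer:
  assumes \<rho>: "convex_expectation M \<rho>" "continuous_from_below M \<rho>" "\<rho> (\<lambda>_. 0) = 0"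
    and c: "\<And>i. 0 \<le> c i"
    and le: "\<And>n Y. Y \<in> Lbox M (\<lambda>_. - real n) (\<lambda>_. real n) \<Longrightarrow> - \<rho> Y \<le> level_penalty M c n Y + e"
  obtains Y where "Y \<in> Lbox M (\<lambda>_. - real k) (\<lambda>_. real k)"
    "\<And>Z. Z \<in> Lbox M (\<lambda>_. - real k) (\<lambda>_. real k) \<Longrightarrow>
      \<rho> Y + 2 * level_penalty M c k Y \<le> \<rho> Z + 2 * level_penalty M c k Z"
    "\<And>Z. Z \<in> Lbox M (\<lambda>_. - real k) (\<lambda>_. real k) \<Longrightarrow>
      - 4 * (LINT \<omega>|M. slope c (Y \<omega>) * Z \<omega>) \<le> \<rho> Z + e"
    "(LINT \<omega>|M. slope c (Y \<omega>) * Y \<omega>) \<le> e"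
proof -
  let ?B = "Lbox M (\<lambda>_. - real k) (\<lambda>_. real k)"
  define J where "J Y = \<rho> Y + (level_penalty M c k Y + level_penalty M c k Y)" for Y
  have zero: "(\<lambda>_. 0) \<in> ?B" by (simp add: Lbox_def)
  obtain Y where Y: "Y \<in> ?B" "\<And>Z. Z \<in> ?B \<Longrightarrow> J Y \<le> J Z"
  proof (rule ae_lsc_attains_min[of "\<lambda>_. - real k" "\<lambda>_. real k" J "- e"])
    show "?B \<noteq> {}" using zero by blast
    show "ae_lsc_on M ?B J"
      unfolding J_def
      by (intro ae_lsc_on_add convex_expectation_ae_lsc \<rho> level_penalty_ae_lsc prob_space_axioms) auto
    show "J (\<lambda>\<omega>. (X \<omega> + Y \<omega>) / 2) \<le> (J X + J Y) / 2" if "X \<in> ?B" "Y \<in> ?B" for X Y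
      using convex_expectation_midpoint[OF \<rho>(1), of X Y] level_penalty_midpoint_le[of X Y c k] that c
      unfolding J_def by (auto simp: Lbox_def field_simps)
    show "- e \<le> J X" if "X \<in> ?B" for X
      using le[OF that] level_penalty_nonneg[of c M k X] c by (simp add: J_def)
  qed auto
  have YL: "Y \<in> Linf M" using Y(1) by (rule Lbox_Linf)
  define G where "G D = (LINT \<omega>|M. slope c (Y \<omega>) * D \<omega>)" for D
  have G_diff: "G (\<lambda>\<omega>. Z \<omega> - Y \<omega>) = G Z - G Y" if "Z \<in> Linf M" for Z
  proof -
    have "integrable M (\<lambda>\<omega>. slope c (Y \<omega>) * Z \<omega>)" "integrable M (\<lambda>\<omega>. slope c (Y \<omega>) * Y \<omega>)"
      by (intro Linf_integrable Linf_mult Linf_slope YL that)+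
    then show ?thesis by (simp add: G_def right_diff_distrib)
  qed
  \<comment> \<open>The factor 4 comes from two copies of the penalty in \<open>J\<close>, each with
    derivative twice the slope.\<close>
  have first_order: "0 \<le> \<rho> Z - \<rho> Y + 4 * (G Z - G Y)" if Z: "Z \<in> ?B" for Z
  proof (rule field_le_epsilon)
    have ZL: "Z \<in> Linf M" using Z by (rule Lbox_Linf)
    define S where "S = 2 * ((\<Sum>i<k. c i) * (LINT \<omega>|M. (Z \<omega> - Y \<omega>)\<^sup>2))"
    have S0: "0 \<le> S" by (auto simp: S_def intro!: mult_nonneg_nonneg sum_nonneg c)
    fix d :: real assume "0 < d"
    \<comment> \<open>Small enough for the second-order remainder, after division by
      \<open>t\<close>, to be at most \<open>d\<close>; the added 1 avoids division by zero.\<close>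
    define t where "t = min 1 (d / (S + 1))"
    have t: "0 < t" "t \<le> 1" using \<open>0 < d\<close> S0 by (auto simp: t_def)
    have "t * S \<le> d"
    proof -
      have "t * S \<le> d / (S + 1) * (S + 1)" using S0 t \<open>0 < d\<close> by (intro mult_mono) (auto simp: t_def)
      then show ?thesis using S0 by simp
    qed
    have "J Y \<le> J (\<lambda>\<omega>. t * Z \<omega> + (1 - t) * Y \<omega>)"
      using t by (intro Y(2) Lbox_convex Z Y(1)) auto
    also have "\<dots> \<le> t * \<rho> Z + (1 - t) * \<rho> Y + 2 * level_penalty M c k (\<lambda>\<omega>. Y \<omega> + t * (Z \<omega> - Y \<omega>))"
    proof -
      have "(\<lambda>\<omega>. Y \<omega> + t * (Z \<omega> - Y \<omega>)) = (\<lambda>\<omega>. t * Z \<omega> + (1 - t) * Y \<omega>)"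
        by (auto simp: algebra_simps)
      then show ?thesis
        using convex_expectation_convex[OF \<rho>(1) ZL YL, of t] t by (simp add: J_def)
    qed
    also have "\<dots> \<le> t * \<rho> Z + (1 - t) * \<rho> Y + 2 * (level_penalty M c k Y + 2 * t * (G Z - G Y)) + t\<^sup>2 * S"
      using level_penalty_perturb[OF Y(1) Linf_diff[OF ZL YL], of c t] c
      unfolding G_diff[OF ZL, symmetric] by (simp add: G_def S_def)
    finally have "0 \<le> t * (\<rho> Z - \<rho> Y + 4 * (G Z - G Y) + t * S)"
      by (simp add: J_def algebra_simps power2_eq_square)
    then have "0 \<le> \<rho> Z - \<rho> Y + 4 * (G Z - G Y) + t * S"
      using t by (simp add: zero_le_mult_iff)
    then show "0 \<le> \<rho> Z - \<rho> Y + 4 * (G Z - G Y) + d"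
      using \<open>t * S \<le> d\<close> by linarith
  qed
  have WY: "0 \<le> level_penalty M c k Y" "level_penalty M c k Y \<le> G Y"
    using level_penalty_nonneg c level_penalty_le_slope[OF Y(1)] by (auto simp: G_def)
  show thesis
  proof (rule that[OF Y(1)])
    show "\<rho> Y + 2 * level_penalty M c k Y \<le> \<rho> Z + 2 * level_penalty M c k Z" if "Z \<in> ?B" for Z
      using Y(2)[OF that] by (simp add: J_def)
    \<comment> \<open>\<open>- \<rho> Y\<close> is at most \<open>level_penalty M c k Y + e\<close>,
      hence at most \<open>G Y + e\<close>; as \<open>G Y \<ge> 0\<close>, the term
      \<open>- 4 * G Y\<close> absorbs the excess. The same computation with \<open>Z = 0\<close>
      gives the energy bound that follows.\<close>
    show "- 4 * (LINT \<omega>|M. slope c (Y \<omega>) * Z \<omega>) \<le> \<rho> Z + e" if "Z \<in> ?B" for Z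
      using first_order[OF that] le[OF Y(1)] WY by (simp add: G_def)
    show "(LINT \<omega>|M. slope c (Y \<omega>) * Y \<omega>) \<le> e"
      using first_order[OF zero] le[OF Y(1)] WY by (simp add: G_def \<rho>(3))
  qed
qed

text \<open>The balls grow, so the minimal values \<open>v k\<close> decrease, and they stay above
  \<open>- e\<close>. Testing the minimality of \<open>Y m\<close> with the midpoint of
  \<open>Y k\<close> and \<open>Y m\<close> turns the quadratic gain with coefficient
  \<open>c 0 \<ge> 1\<close> into the bound \<open>v k - v m\<close> on the squared
  distance.\<close>

lemma (in prob_space) penalized_minimizers_Cauchy:
  assumes \<rho>: "convex_expectation M \<rho>"
    and c: "\<And>i. 1 \<le> c i"
    and le: "\<And>n Y. Y \<in> Lbox M (\<lambda>_. - real n) (\<lambda>_. real n) \<Longrightarrow> - \<rho> Y \<le> level_penalty M c n Y + e"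
    and Y: "\<And>k. Y k \<in> Lbox M (\<lambda>_. - real (Suc k)) (\<lambda>_. real (Suc k))"
    and min: "\<And>k Z. Z \<in> Lbox M (\<lambda>_. - real (Suc k)) (\<lambda>_. real (Suc k)) \<Longrightarrow>
      \<rho> (Y k) + 2 * level_penalty M c (Suc k) (Y k) \<le> \<rho> Z + 2 * level_penalty M c (Suc k) Z"
    and d: "0 < d"
  shows "\<exists>N. \<forall>n\<ge>N. \<forall>m\<ge>n. (LINT \<omega>|M. (Y n \<omega> - Y m \<omega>)\<^sup>2) < d"
proof -
  have c0: "0 \<le> c i" for i using c[of i] by linarith
  define v where "v k = \<rho> (Y k) + 2 * level_penalty M c (Suc k) (Y k)" for k
  have YL: "Y k \<in> Linf M" for k using Y by (rule Lbox_Linf)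
  have est: "(LINT \<omega>|M. (Y k \<omega> - Y m \<omega>)\<^sup>2) \<le> v k - v m" if "k \<le> m" for k m
  proof -
    define D where "D = (LINT \<omega>|M. (Y k \<omega> - Y m \<omega>)\<^sup>2)"
    have "0 \<le> D" by (simp add: D_def)
    have Yk: "Y k \<in> Lbox M (\<lambda>_. - real (Suc m)) (\<lambda>_. real (Suc m))"
      using Y[of k] that unfolding Lbox_ball_AE by (auto elim!: eventually_mono)
    have "v m \<le> \<rho> (\<lambda>\<omega>. (Y k \<omega> + Y m \<omega>) / 2) +
        2 * level_penalty M c (Suc m) (\<lambda>\<omega>. (Y k \<omega> + Y m \<omega>) / 2)"
      unfolding v_def midpoint_eq by (intro min Lbox_convex Yk Y) auto
    also have "\<dots> \<le> (\<rho> (Y k) + \<rho> (Y m)) / 2 + 2 * ((level_penalty M c (Suc m) (Y k) +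
        level_penalty M c (Suc m) (Y m)) / 2 - c 0 * D / 4)"
    proof -
      have "level_penalty M c (Suc m) (\<lambda>\<omega>. (Y k \<omega> + Y m \<omega>) / 2) \<le>
          (level_penalty M c (Suc m) (Y k) + level_penalty M c (Suc m) (Y m)) / 2 - c 0 * D / 4"
        using level_penalty_midpoint[where c = c and n = "Suc m", OF YL YL c0, of k m] by (simp add: D_def)
      then show ?thesis using convex_expectation_midpoint[OF \<rho> YL YL, of k m] by argo
    qed
    also have "level_penalty M c (Suc m) (Y k) = level_penalty M c (Suc k) (Y k)"
      by (rule level_penalty_extend[OF Y]) (use that in simp)
    finally have "c 0 * D \<le> v k - v m" by (simp add: v_def field_simps)
    moreover have "1 * D \<le> c 0 * D" by (rule mult_right_mono[OF c \<open>0 \<le> D\<close>])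
    ultimately show ?thesis by (simp add: D_def)
  qed
  have "decseq v"
    unfolding decseq_def
  proof (intro allI impI)
    fix k m :: nat assume "k \<le> m"
    have "0 \<le> (LINT \<omega>|M. (Y k \<omega> - Y m \<omega>)\<^sup>2)" by simp
    then show "v m \<le> v k" using est[OF \<open>k \<le> m\<close>] by linarith
  qed
  moreover have "- e \<le> v k" for k
    using le[OF Y, of k] level_penalty_nonneg[of c M "Suc k" "Y k"] c0 by (simp add: v_def)
  ultimately obtain l where l: "v \<longlonglongrightarrow> l" "\<And>i. l \<le> v i"
    using decseq_convergent[of v "- e"] by metis
  have "\<forall>\<^sub>F n in sequentially. v n < l + d" using l(1) d by (intro order_tendstoD) auto
  then obtain N where N: "\<And>n. n \<ge> N \<Longrightarrow> v n < l + d" by (auto simp: eventually_sequentially)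
  show ?thesis
  proof (intro exI allI impI)
    fix n m assume "N \<le> n" "n \<le> m"
    then show "(LINT \<omega>|M. (Y n \<omega> - Y m \<omega>)\<^sup>2) < d"
      using est[of n m] N[of n] l(2)[of m] by linarith
  qed
qed

text \<open>
  The bound on \<open>\<integral> slope c (y k) * y k\<close> makes the functions \<open>slope c (y k)\<close> uniformly integrable.
\<close>

lemma (in prob_space) slope_limit:
  assumes c: "\<And>i. 0 \<le> c i"
    and yL: "\<And>k. y k \<in> Linf M" and Y: "Y \<in> borel_measurable M"
    and lim: "AE \<omega> in M. (\<lambda>k. y k \<omega>) \<longlonglongrightarrow> Y \<omega>"
    and energy: "\<And>k. (LINT \<omega>|M. slope c (y k \<omega>) * y k \<omega>) \<le> e"
  shows "integrable M (\<lambda>\<omega>. slope c (Y \<omega>))"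
    and "Z \<in> Linf M \<Longrightarrow> \<forall>\<^sub>F k in sequentially. s \<le> (LINT \<omega>|M. slope c (y k \<omega>) * Z \<omega>) \<Longrightarrow>
      s \<le> (LINT \<omega>|M. slope c (Y \<omega>) * Z \<omega>)"
proof -
  note [measurable] = Y
  have [measurable]: "y k \<in> borel_measurable M" for k using yL by (simp add: Linf_def)
  have energy_int: "integrable M (\<lambda>\<omega>. slope c (y k \<omega>) * y k \<omega>)" for k
    by (intro Linf_integrable Linf_mult Linf_slope yL)
  have slope_lim: "AE \<omega> in M. (\<lambda>k. slope c (y k \<omega>)) \<longlonglongrightarrow> slope c (Y \<omega>)"
    using lim by eventually_elim (rule isCont_tendsto_compose[OF slope_isCont])
  \<comment> \<open>An L1 bound that does not depend on \<open>k\<close>; with Fatou's lemma it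
    makes the limit slope integrable.\<close>
  have bound: "(\<integral>\<^sup>+\<omega>. ennreal \<bar>slope c (y k \<omega>)\<bar> \<partial>M) \<le> ennreal (c 0 + e)" for k
  proof -
    have "(\<integral>\<^sup>+\<omega>. ennreal \<bar>slope c (y k \<omega>)\<bar> \<partial>M) \<le> (\<integral>\<^sup>+\<omega>. ennreal (c 0 + slope c (y k \<omega>) * y k \<omega>) \<partial>M)"
      by (intro nn_integral_mono ennreal_leI abs_slope_le c)
    also have "\<dots> = ennreal (LINT \<omega>|M. c 0 + slope c (y k \<omega>) * y k \<omega>)"
      using energy_int by (intro nn_integral_eq_integral) (auto intro!: add_nonneg_nonneg c slope_mult_nonneg)
    also have "\<dots> \<le> ennreal (c 0 + e)"
      using energy_int[of k] energy[of k] by (intro ennreal_leI) (simp add: prob_space)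
    finally show ?thesis .
  qed
  show int: "integrable M (\<lambda>\<omega>. slope c (Y \<omega>))"
  proof (rule integrableI_bounded)
    have "(\<integral>\<^sup>+\<omega>. ennreal (norm (slope c (Y \<omega>))) \<partial>M) =
        (\<integral>\<^sup>+\<omega>. liminf (\<lambda>k. ennreal \<bar>slope c (y k \<omega>)\<bar>) \<partial>M)"
    proof (rule nn_integral_cong_AE)
      show "AE \<omega> in M. ennreal (norm (slope c (Y \<omega>))) = liminf (\<lambda>k. ennreal \<bar>slope c (y k \<omega>)\<bar>)"
        using slope_lim
      proof eventually_elim
        case (elim \<omega>)
        then have "(\<lambda>k. ennreal \<bar>slope c (y k \<omega>)\<bar>) \<longlonglongrightarrow> ennreal \<bar>slope c (Y \<omega>)\<bar>"
          by (intro tendsto_ennrealI tendsto_rabs)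
        from lim_imp_Liminf[OF _ this] show ?case by simp
      qed
    qed
    also have "\<dots> \<le> liminf (\<lambda>k. \<integral>\<^sup>+\<omega>. ennreal \<bar>slope c (y k \<omega>)\<bar> \<partial>M)"
      by (rule nn_integral_liminf) simp
    also have "\<dots> \<le> ennreal (c 0 + e)"
      by (rule order_trans[OF Liminf_mono[OF always_eventually[OF allI[OF bound]]]]) (simp add: Liminf_const)
    finally show "(\<integral>\<^sup>+\<omega>. ennreal (norm (slope c (Y \<omega>))) \<partial>M) < \<infinity>"
      by (rule le_less_trans) simp
  qed simp
  assume Z: "Z \<in> Linf M" and s: "\<forall>\<^sub>F k in sequentially. s \<le> (LINT \<omega>|M. slope c (y k \<omega>) * Z \<omega>)"
  obtain C where C: "0 \<le> C" "AE \<omega> in M. \<bar>Z \<omega>\<bar> \<le> C" by (rule LinfE[OF Z])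
  have [measurable]: "Z \<in> borel_measurable M" using Z by (simp add: Linf_def)
  have [measurable]: "clamp_real n \<in> borel_measurable borel" for n by simp
  have clamp_lim: "(\<lambda>k. LINT \<omega>|M. slope c (clamp_real n (y k \<omega>)) * Z \<omega>)
      \<longlonglongrightarrow> (LINT \<omega>|M. slope c (clamp_real n (Y \<omega>)) * Z \<omega>)" for n
  proof -
    have cont: "isCont (clamp_real n) x" for x
    proof -
      have "continuous_on UNIV (clamp_real n)" unfolding clamp_real_def by (intro continuous_intros)
      then show ?thesis by (simp add: continuous_on_eq_continuous_at)
    qed
    have "(\<lambda>k. LINT \<omega>|M. Z \<omega> * slope c (clamp_real n (y k \<omega>)))
      \<longlonglongrightarrow> (LINT \<omega>|M. Z \<omega> * slope c (clamp_real n (Y \<omega>)))"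
    proof (rule tendsto_integral_mult_bounded[where C = "\<Sum>i<n. c i * real n"])
      show "AE \<omega> in M. (\<lambda>k. slope c (clamp_real n (y k \<omega>))) \<longlonglongrightarrow> slope c (clamp_real n (Y \<omega>))"
        using lim
        by eventually_elim (intro isCont_tendsto_compose[OF slope_isCont] isCont_tendsto_compose[OF cont])
    qed (use Z in \<open>auto intro: abs_slope_clamp_le c\<close>)
    then show ?thesis by (simp add: mult.commute)
  qed
  \<comment> \<open>For fixed \<open>n\<close> the truncated slopes are uniformly bounded, so their
    integrals converge in \<open>k\<close>. Truncating costs at most \<open>C * (e / n)\<close> for
    every \<open>k\<close>; letting \<open>n\<close> grow afterwards removes this error.\<close>
  have clamp_err: "s - C * (e / real n) \<le> (LINT \<omega>|M. slope c (clamp_real n (Y \<omega>)) * Z \<omega>)" if "0 < n" for n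
  proof (rule tendsto_lowerbound[OF clamp_lim])
    show "\<forall>\<^sub>F k in sequentially. s - C * (e / real n) \<le> (LINT \<omega>|M. slope c (clamp_real n (y k \<omega>)) * Z \<omega>)"
      using s
    proof eventually_elim
      case (elim k)
      have cL: "(\<lambda>\<omega>. slope c (clamp_real n (y k \<omega>))) \<in> Linf M"
        by (rule LinfI[where C = "\<Sum>i<n. c i * real n"]) (auto intro: abs_slope_clamp_le c)
      have "(LINT \<omega>|M. slope c (y k \<omega>) * Z \<omega>) - (LINT \<omega>|M. slope c (clamp_real n (y k \<omega>)) * Z \<omega>) =
          (LINT \<omega>|M. slope c (y k \<omega>) * Z \<omega> - slope c (clamp_real n (y k \<omega>)) * Z \<omega>)"
        by (intro Bochner_Integration.integral_diff[symmetric] Linf_integrable Linf_mult Linf_slope yL Z cL)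
      also have "\<dots> \<le> (LINT \<omega>|M. C / real n * (slope c (y k \<omega>) * y k \<omega>))"
      proof (rule integral_mono_AE)
        show "AE \<omega> in M. slope c (y k \<omega>) * Z \<omega> - slope c (clamp_real n (y k \<omega>)) * Z \<omega> \<le>
            C / real n * (slope c (y k \<omega>) * y k \<omega>)"
          using C(2)
        proof eventually_elim
          case (elim \<omega>)
          let ?d = "slope c (y k \<omega>) - slope c (clamp_real n (y k \<omega>))"
          have "slope c (y k \<omega>) * Z \<omega> - slope c (clamp_real n (y k \<omega>)) * Z \<omega> = ?d * Z \<omega>"
            by (simp add: algebra_simps)
          also have "\<dots> \<le> \<bar>?d\<bar> * \<bar>Z \<omega>\<bar>" by (simp add: abs_mult[symmetric])
          also have "\<dots> \<le> (slope c (y k \<omega>) * y k \<omega> / real n) * C"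
            using slope_clamp_error[of c n "y k \<omega>", OF c] \<open>0 < n\<close> elim slope_mult_nonneg[of c "y k \<omega>"] c
            by (intro mult_mono) (auto simp: field_simps)
          finally show ?case by (simp add: field_simps)
        qed
      qed (intro Bochner_Integration.integrable_diff integrable_mult_right Linf_integrable Linf_mult Linf_slope yL Z cL)+
      also have "\<dots> \<le> C * (e / real n)"
        using energy[of k] C(1) \<open>0 < n\<close> by (simp add: divide_right_mono mult_left_mono)
      finally show ?case using elim by linarith
    qed
  qed simp
  have "(\<lambda>n. LINT \<omega>|M. slope c (clamp_real n (Y \<omega>)) * Z \<omega>) \<longlonglongrightarrow> (LINT \<omega>|M. slope c (Y \<omega>) * Z \<omega>)"
  proof (rule integral_dominated_convergence[where w = "\<lambda>\<omega>. \<bar>slope c (Y \<omega>) * Z \<omega>\<bar>"])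
    show "integrable M (\<lambda>\<omega>. \<bar>slope c (Y \<omega>) * Z \<omega>\<bar>)" using int Z by (intro integrable_abs) auto
    show "AE \<omega> in M. (\<lambda>n. slope c (clamp_real n (Y \<omega>)) * Z \<omega>) \<longlonglongrightarrow> slope c (Y \<omega>) * Z \<omega>"
    proof (rule AE_I2)
      fix \<omega>
      have "\<forall>\<^sub>F n in sequentially. slope c (clamp_real n (Y \<omega>)) * Z \<omega> = slope c (Y \<omega>) * Z \<omega>"
      proof (rule eventually_sequentiallyI)
        fix n assume "nat \<lceil>\<bar>Y \<omega>\<bar>\<rceil> \<le> n"
        then have "\<bar>Y \<omega>\<bar> \<le> real n" by linarith
        then have "clamp_real n (Y \<omega>) = Y \<omega>" by (auto simp: clamp_real_def)
        then show "slope c (clamp_real n (Y \<omega>)) * Z \<omega> = slope c (Y \<omega>) * Z \<omega>" by simp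
      qed
      then show "(\<lambda>n. slope c (clamp_real n (Y \<omega>)) * Z \<omega>) \<longlonglongrightarrow> slope c (Y \<omega>) * Z \<omega>"
        by (rule tendsto_eventually)
    qed
    show "AE \<omega> in M. norm (slope c (clamp_real n (Y \<omega>)) * Z \<omega>) \<le> \<bar>slope c (Y \<omega>) * Z \<omega>\<bar>" for n
      by (auto simp: abs_mult intro!: mult_right_mono abs_slope_clamp_le c)
  qed auto
  moreover have "(\<lambda>n. s - C * (e / real n)) \<longlonglongrightarrow> s - C * 0"
    by (intro tendsto_intros lim_const_over_n)
  ultimately show "s \<le> (LINT \<omega>|M. slope c (Y \<omega>) * Z \<omega>)"
    using clamp_err by (intro LIMSEQ_le[of "\<lambda>n. s - C * (e / real n)" s]) (auto intro!: exI[of _ 1])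
qed

text \<open>A fixed bounded \<open>Z\<close> lies in all sufficiently large balls, so the
  first-order inequality of the \<open>k\<close>-th minimiser eventually applies to it and survives
  the limit. The limit \<open>y\<close> itself may be unbounded; only its slope has to be
  integrable.\<close>

lemma (in prob_space) almost_optimal_integrand:
  assumes \<rho>: "convex_expectation M \<rho>" "continuous_from_below M \<rho>" "\<rho> (\<lambda>_. 0) = 0" and e: "0 < e"
  obtains g where "integrable M g" "\<And>Z. Z \<in> Linf M \<Longrightarrow> (LINT \<omega>|M. g \<omega> * Z \<omega>) \<le> \<rho> Z + e"
proof -
  obtain c where c: "\<And>i. 1 \<le> c i"
    and le: "\<And>n Y. Y \<in> Lbox M (\<lambda>_. - real n) (\<lambda>_. real n) \<Longrightarrow> - \<rho> Y \<le> level_penalty M c n Y + e"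
    using level_penalty_exists[OF \<rho> e] by blast
  have c0: "0 \<le> c i" for i using c[of i] by linarith
  let ?B = "\<lambda>k. Lbox M (\<lambda>_. - real (Suc k)) (\<lambda>_. real (Suc k))"
  define W where "W k Y = \<rho> Y + 2 * level_penalty M c (Suc k) Y" for k Y
  define opt where "opt k Y \<longleftrightarrow> Y \<in> ?B k \<and> (\<forall>Z\<in>?B k. W k Y \<le> W k Z) \<and>
      (\<forall>Z\<in>?B k. - 4 * (LINT \<omega>|M. slope c (Y \<omega>) * Z \<omega>) \<le> \<rho> Z + e) \<and>
      (LINT \<omega>|M. slope c (Y \<omega>) * Y \<omega>) \<le> e" for k Y
  have ex: "\<exists>Y. opt k Y" for k
    unfolding opt_def W_def by (rule penalized_minimizer[OF \<rho> c0 le, where k = "Suc k"]) blast+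
  define Y where "Y k = (SOME Y. opt k Y)" for k
  have "opt k (Y k)" for k unfolding Y_def by (rule someI_ex[OF ex])
  then have Y: "\<And>k. Y k \<in> ?B k" "\<And>k Z. Z \<in> ?B k \<Longrightarrow> W k (Y k) \<le> W k Z"
      "\<And>k Z. Z \<in> ?B k \<Longrightarrow> - 4 * (LINT \<omega>|M. slope c (Y k \<omega>) * Z \<omega>) \<le> \<rho> Z + e"
      "\<And>k. (LINT \<omega>|M. slope c (Y k \<omega>) * Y k \<omega>) \<le> e"
    unfolding opt_def by blast+
  have YL: "Y k \<in> Linf M" for k using Y(1) by (rule Lbox_Linf)
  obtain r y where r: "strict_mono r" and y: "y \<in> borel_measurable M"
      "AE \<omega> in M. (\<lambda>k. Y (r k) \<omega>) \<longlonglongrightarrow> y \<omega>"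
    using L2_Cauchy_AE_subseq[of Y, OF YL penalized_minimizers_Cauchy[OF \<rho>(1) c le Y(1) Y(2)[unfolded W_def]]] by blast
  note limit = slope_limit[where c = c and y = "\<lambda>k. Y (r k)", OF c0 YL y Y(4)]
  show thesis
  proof (rule that[of "\<lambda>\<omega>. - 4 * slope c (y \<omega>)"])
    show "integrable M (\<lambda>\<omega>. - 4 * slope c (y \<omega>))" using limit(1) by (rule integrable_mult_right)
    fix Z assume Z: "Z \<in> Linf M"
    obtain C where C: "0 \<le> C" "AE \<omega> in M. \<bar>Z \<omega>\<bar> \<le> C" by (rule LinfE[OF Z])
    obtain n :: nat where n: "C \<le> real n" using real_arch_simple by blast
    have "- (\<rho> Z + e) / 4 \<le> (LINT \<omega>|M. slope c (y \<omega>) * Z \<omega>)"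
    proof (rule limit(2)[OF Z])
      show "\<forall>\<^sub>F k in sequentially. - (\<rho> Z + e) / 4 \<le> (LINT \<omega>|M. slope c (Y (r k) \<omega>) * Z \<omega>)"
      proof (rule eventually_sequentiallyI)
        fix k assume "n \<le> k"
        then have "n \<le> r k" using seq_suble[OF r, of k] by linarith
        then have "Z \<in> ?B (r k)"
          unfolding Lbox_ball_AE using Z C(2) n by (auto elim!: eventually_mono)
        from Y(3)[OF this] show "- (\<rho> Z + e) / 4 \<le> (LINT \<omega>|M. slope c (Y (r k) \<omega>) * Z \<omega>)" by simp
      qed
    qed
    moreover have "(LINT \<omega>|M. - 4 * slope c (y \<omega>) * Z \<omega>) = - 4 * (LINT \<omega>|M. slope c (y \<omega>) * Z \<omega>)"
      by (simp add: mult.assoc)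
    ultimately show "(LINT \<omega>|M. - 4 * slope c (y \<omega>) * Z \<omega>) \<le> \<rho> Z + e" by simp
  qed
qed

section \<open>Normalisation to probability densities\<close>

definition prob_density :: "'a measure \<Rightarrow> ('a \<Rightarrow> real) \<Rightarrow> bool" where
  "prob_density M g \<longleftrightarrow> integrable M g \<and> (AE \<omega> in M. 0 \<le> g \<omega>) \<and> (LINT \<omega>|M. g \<omega>) = 1"

lemma prob_density_measurable: "prob_density M g \<Longrightarrow> g \<in> borel_measurable M"
  by (auto simp: prob_density_def)

lemma nonpos_if_multiples_bounded:
  fixes x y :: real
  assumes "\<And>t. 0 < t \<Longrightarrow> t * x \<le> y"
  shows "x \<le> 0"
proof (rule ccontr)
  assume "\<not> x \<le> 0"
  then have "0 < x" by simp
  have "0 < (\<bar>y\<bar> + 1) / x" using \<open>0 < x\<close> by simp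
  from assms[OF this] \<open>0 < x\<close> show False by simp
qed

text \<open>The error \<open>e\<close> stays fixed while \<open>Z\<close> may be scaled without
  bound, so any linear defect of \<open>g\<close> would outgrow it. Constants of both signs force
  total mass 1, and multiples of the negative indicator of \<open>{g < 0}\<close> force
  \<open>g \<ge> 0\<close> a.e.\<close>

theorem (in prob_space) almost_optimal_density:
  assumes \<rho>: "convex_expectation M \<rho>" "continuous_from_below M \<rho>" "\<rho> (\<lambda>_. 0) = 0" and e: "0 < e"
  obtains g where "prob_density M g" "\<And>Z. Z \<in> Linf M \<Longrightarrow> (LINT \<omega>|M. g \<omega> * Z \<omega>) \<le> \<rho> Z + e"
proof -
  obtain g where g: "integrable M g" "\<And>Z. Z \<in> Linf M \<Longrightarrow> (LINT \<omega>|M. g \<omega> * Z \<omega>) \<le> \<rho> Z + e"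
    using almost_optimal_integrand[OF \<rho> e] by blast
  have [measurable]: "g \<in> borel_measurable M" using g(1) by simp
  have const: "(LINT \<omega>|M. g \<omega>) * t \<le> t + e" for t
    using g(2)[OF Linf_const, of t] convex_expectation_const[OF \<rho>(1), of t] \<rho>(3) by simp
  have "(LINT \<omega>|M. g \<omega>) - 1 \<le> 0"
    by (rule nonpos_if_multiples_bounded[of _ e]) (use const in \<open>auto simp: algebra_simps\<close>)
  moreover have "1 - (LINT \<omega>|M. g \<omega>) \<le> 0"
    by (rule nonpos_if_multiples_bounded[of _ e]) (use const[of "- t" for t] in \<open>auto simp: algebra_simps\<close>)
  ultimately have mass: "(LINT \<omega>|M. g \<omega>) = 1" by simp
  define I where "I \<omega> = (if g \<omega> < 0 then - 1 else 0 :: real)" for \<omega>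
  have [measurable]: "I \<in> borel_measurable M" unfolding I_def by measurable
  have IL: "I \<in> Linf M" by (rule LinfI[where C = 1]) (auto simp: I_def)
  have int: "integrable M (\<lambda>\<omega>. g \<omega> * I \<omega>)" using g(1) IL by auto
  have "(LINT \<omega>|M. g \<omega> * I \<omega>) \<le> 0"
  proof (rule nonpos_if_multiples_bounded[of _ e])
    fix t :: real assume "0 < t"
    have tL: "(\<lambda>\<omega>. t * I \<omega>) \<in> Linf M" using IL by auto
    have "(LINT \<omega>|M. g \<omega> * (t * I \<omega>)) \<le> \<rho> (\<lambda>\<omega>. t * I \<omega>) + e" by (rule g(2)[OF tL])
    also have "\<rho> (\<lambda>\<omega>. t * I \<omega>) \<le> 0"
      using convex_expectation_le[OF \<rho>(1) tL, of 0] \<open>0 < t\<close> by (simp add: \<rho>(3) I_def)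
    finally show "t * (LINT \<omega>|M. g \<omega> * I \<omega>) \<le> e" by (simp add: mult.left_commute)
  qed
  moreover have nn: "0 \<le> g \<omega> * I \<omega>" for \<omega> by (auto simp: I_def)
  ultimately have "(LINT \<omega>|M. g \<omega> * I \<omega>) = 0" by (intro antisym integral_nonneg_AE) auto
  then have "AE \<omega> in M. g \<omega> * I \<omega> = 0"
    using integral_nonneg_eq_0_iff_AE[OF int] nn by simp
  then have "AE \<omega> in M. 0 \<le> g \<omega>"
    by eventually_elim (auto simp: I_def split: if_splits)
  then show thesis using that[of g] g mass by (simp add: prob_density_def)
qed

text \<open>
  Apply the previous theorem to the inf-convolution \<open>S \<mapsto> inf {\<rho> (X + S) + \<theta> X} - m\<close>, which is again a
  convex expectation; its continuity from below comes from compactness of the box.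
\<close>

lemma (in prob_space) almost_optimal_density_box:
  assumes \<rho>: "convex_expectation M \<rho>" "continuous_from_below M \<rho>" and e: "0 < e"
    and ab: "a \<in> Linf M" "b \<in> Linf M" and ne: "Lbox M a b \<noteq> {}"
    and lsc: "ae_lsc_on M (Lbox M a b) \<theta>"
    and conv: "\<And>X Y l. X \<in> Lbox M a b \<Longrightarrow> Y \<in> Lbox M a b \<Longrightarrow> 0 \<le> l \<Longrightarrow> l \<le> 1 \<Longrightarrow>
      \<theta> (\<lambda>\<omega>. l * X \<omega> + (1 - l) * Y \<omega>) \<le> l * \<theta> X + (1 - l) * \<theta> Y"
    and bdd: "\<And>X. X \<in> Lbox M a b \<Longrightarrow> k \<le> \<theta> X"
    and m: "m = (INF X\<in>Lbox M a b. \<rho> X + \<theta> X)"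
  obtains g where "prob_density M g"
    "\<And>X Y. X \<in> Lbox M a b \<Longrightarrow> Y \<in> Linf M \<Longrightarrow>
      m - e \<le> (LINT \<omega>|M. g \<omega> * (X \<omega> - Y \<omega>)) + \<rho> Y + \<theta> X"
proof -
  let ?D = "Lbox M a b"
  obtain K where K: "0 \<le> K" "\<And>X. X \<in> ?D \<Longrightarrow> AE \<omega> in M. \<bar>X \<omega>\<bar> \<le> K"
    using Lbox_bound[OF ab] by blast
  define F where "F S X = \<rho> (\<lambda>\<omega>. X \<omega> + S \<omega>) + \<theta> X" for S X
  \<comment> \<open>Subtracting the unperturbed infimum normalises the value at 0 to 0, as
    \<open>almost_optimal_density\<close> requires.\<close>
  define \<sigma> where "\<sigma> S = (INF X\<in>?D. F S X) - m" for S
  have F_bdd: "bdd_below (F S ` ?D)" if S: "S \<in> Linf M" for S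
  proof -
    obtain C where C: "0 \<le> C" "AE \<omega> in M. \<bar>S \<omega>\<bar> \<le> C" by (rule LinfE[OF S])
    show ?thesis
    proof (rule bdd_belowI2)
      fix X assume X: "X \<in> ?D"
      have "AE \<omega> in M. - K - C \<le> X \<omega> + S \<omega>"
        using K(2)[OF X] C(2) by eventually_elim auto
      then have "\<rho> (\<lambda>_. 0) + (- K - C) \<le> \<rho> (\<lambda>\<omega>. X \<omega> + S \<omega>)"
        using X S by (intro convex_expectation_ge[OF \<rho>(1)] Linf_add) (auto simp: Lbox_def)
      then show "\<rho> (\<lambda>_. 0) + (- K - C) + k \<le> F S X" using bdd[OF X] by (simp add: F_def)
    qed
  qed
  have \<sigma>_le: "\<sigma> S \<le> F S X - m" if "S \<in> Linf M" "X \<in> ?D" for S X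
    unfolding \<sigma>_def using cINF_lower[OF F_bdd[OF that(1)] that(2)] by simp
  have \<sigma>_ge: "c \<le> \<sigma> S" if "\<And>X. X \<in> ?D \<Longrightarrow> c \<le> F S X - m" for S c
    unfolding \<sigma>_def using cINF_greatest[OF ne, of "c + m" "F S"] that by (simp add: algebra_simps)
  have \<sigma>_less: "\<exists>X\<in>?D. F S X < c + m" if "S \<in> Linf M" "\<sigma> S < c" for S c
    using cINF_less_iff[OF ne F_bdd[OF that(1)], of "c + m"] that(2) by (simp add: \<sigma>_def)
  have \<sigma>_mono: "\<sigma> S \<le> \<sigma> T" if ST: "S \<in> Linf M" "T \<in> Linf M" "AE \<omega> in M. S \<omega> \<le> T \<omega>" for S T
  proof (rule \<sigma>_ge)
    fix X assume X: "X \<in> ?D"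
    have "\<rho> (\<lambda>\<omega>. X \<omega> + S \<omega>) \<le> \<rho> (\<lambda>\<omega>. X \<omega> + T \<omega>)"
      using X ST by (intro convex_expectation_mono[OF \<rho>(1)] Linf_add) (auto simp: Lbox_def)
    then show "\<sigma> S \<le> F T X - m" using \<sigma>_le[OF ST(1) X] by (simp add: F_def)
  qed
  have F_convex: "F (\<lambda>\<omega>. l * S \<omega> + (1 - l) * T \<omega>) (\<lambda>\<omega>. l * X \<omega> + (1 - l) * Y \<omega>) \<le> l * F S X + (1 - l) * F T Y"
    if "S \<in> Linf M" "T \<in> Linf M" "X \<in> ?D" "Y \<in> ?D" "0 \<le> l" "l \<le> 1" for S T X Y l
  proof -
    have "\<rho> (\<lambda>\<omega>. l * (X \<omega> + S \<omega>) + (1 - l) * (Y \<omega> + T \<omega>)) \<le>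
        l * \<rho> (\<lambda>\<omega>. X \<omega> + S \<omega>) + (1 - l) * \<rho> (\<lambda>\<omega>. Y \<omega> + T \<omega>)"
      using that by (intro convex_expectation_convex[OF \<rho>(1)] Linf_add) (auto simp: Lbox_def)
    moreover have "(\<lambda>\<omega>. l * (X \<omega> + S \<omega>) + (1 - l) * (Y \<omega> + T \<omega>)) =
        (\<lambda>\<omega>. l * X \<omega> + (1 - l) * Y \<omega> + (l * S \<omega> + (1 - l) * T \<omega>))"
      by (auto simp: algebra_simps)
    ultimately show ?thesis
      using conv[OF that(3-6)] by (simp add: F_def algebra_simps)
  qed
  have ce: "convex_expectation M \<sigma>"
    unfolding convex_expectation_def
  proof (intro conjI ballI allI impI)
    show "\<sigma> S \<ge> \<sigma> T" if "S \<in> Linf M" "T \<in> Linf M" "AE \<omega> in M. S \<omega> \<ge> T \<omega>" for S T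
      by (rule \<sigma>_mono[OF that(2,1,3)])
    fix S assume S: "S \<in> Linf M"
    have F_const: "F (\<lambda>\<omega>. S \<omega> + c) X = F S X + c" if "X \<in> ?D" for X c
      using convex_expectation_add_const[OF \<rho>(1) Linf_add[OF Lbox_Linf[OF that] S], of c]
      by (simp add: F_def add.assoc)
    show "\<sigma> (\<lambda>\<omega>. S \<omega> + c) = \<sigma> S + c" for c
    proof (rule antisym)
      have "\<sigma> (\<lambda>\<omega>. S \<omega> + c) - c \<le> \<sigma> S"
      proof (rule \<sigma>_ge)
        fix X assume X: "X \<in> ?D"
        show "\<sigma> (\<lambda>\<omega>. S \<omega> + c) - c \<le> F S X - m"
          using \<sigma>_le[OF Linf_add[OF S Linf_const] X, of c] F_const[OF X, of c] by simp
      qed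
      then show "\<sigma> (\<lambda>\<omega>. S \<omega> + c) \<le> \<sigma> S + c" by simp
      show "\<sigma> S + c \<le> \<sigma> (\<lambda>\<omega>. S \<omega> + c)"
        using \<sigma>_le[OF S] F_const by (intro \<sigma>_ge) simp
    qed
    fix T l assume T: "T \<in> Linf M" and l: "l \<in> {0..1::real}"
    show "\<sigma> (\<lambda>\<omega>. l * S \<omega> + (1 - l) * T \<omega>) \<le> l * \<sigma> S + (1 - l) * \<sigma> T"
    proof (rule field_le_epsilon)
      fix d :: real assume "0 < d"
      obtain X Y where XY: "X \<in> ?D" "F S X < \<sigma> S + d + m" "Y \<in> ?D" "F T Y < \<sigma> T + d + m"
        using \<sigma>_less[OF S, of "\<sigma> S + d"] \<sigma>_less[OF T, of "\<sigma> T + d"] \<open>0 < d\<close> by auto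
      have "\<sigma> (\<lambda>\<omega>. l * S \<omega> + (1 - l) * T \<omega>) \<le>
          F (\<lambda>\<omega>. l * S \<omega> + (1 - l) * T \<omega>) (\<lambda>\<omega>. l * X \<omega> + (1 - l) * Y \<omega>) - m"
        using S T XY l by (intro \<sigma>_le Linf_add Linf_cmult Lbox_convex) auto
      also have "\<dots> \<le> l * F S X + (1 - l) * F T Y - m"
        using F_convex[OF S T XY(1,3), of l] l by simp
      also have "\<dots> \<le> l * (\<sigma> S + d + m) + (1 - l) * (\<sigma> T + d + m) - m"
        using XY l by (intro diff_right_mono add_mono mult_left_mono) auto
      also have "\<dots> = l * \<sigma> S + (1 - l) * \<sigma> T + d" by (simp add: algebra_simps)
      finally show "\<sigma> (\<lambda>\<omega>. l * S \<omega> + (1 - l) * T \<omega>) \<le> l * \<sigma> S + (1 - l) * \<sigma> T + d" .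
    qed
  qed
  have F_lsc: "ae_lsc_on M ?D (F S)" if S: "S \<in> Linf M" for S
    unfolding F_def
  proof (rule ae_lsc_on_add[OF _ lsc])
    let ?D' = "Lbox M (\<lambda>\<omega>. a \<omega> + S \<omega>) (\<lambda>\<omega>. b \<omega> + S \<omega>)"
    have lsc': "ae_lsc_on M ?D' \<rho>"
      by (intro convex_expectation_ae_lsc \<rho> Linf_add ab S)
    show "ae_lsc_on M ?D (\<lambda>X. \<rho> (\<lambda>\<omega>. X \<omega> + S \<omega>))"
      unfolding ae_lsc_on_def
    proof (intro allI impI)
      fix Xs X c assume *: "\<forall>n::nat. Xs n \<in> ?D" "X \<in> ?D" "AE \<omega> in M. (\<lambda>n. Xs n \<omega>) \<longlonglongrightarrow> X \<omega>"
        "c < \<rho> (\<lambda>\<omega>. X \<omega> + S \<omega>)"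
      have in_D': "(\<lambda>\<omega>. X \<omega> + S \<omega>) \<in> ?D'" if "X \<in> ?D" for X
        using that S by (auto simp: Lbox_def)
      have "AE \<omega> in M. (\<lambda>n. Xs n \<omega> + S \<omega>) \<longlonglongrightarrow> X \<omega> + S \<omega>"
        using *(3) by eventually_elim (intro tendsto_intros)
      then show "\<forall>\<^sub>F n in sequentially. c < \<rho> (\<lambda>\<omega>. Xs n \<omega> + S \<omega>)"
        using ae_lsc_onD[OF lsc', of "\<lambda>n \<omega>. Xs n \<omega> + S \<omega>" "\<lambda>\<omega>. X \<omega> + S \<omega>" c] in_D' * by blast
    qed
  qed
  have cfb: "continuous_from_below M \<sigma>"
    unfolding continuous_from_below_def
  proof (intro allI impI)
    fix Ss S assume Ss: "\<forall>n::nat. Ss n \<in> Linf M" and S: "S \<in> Linf M"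
      and inc: "\<forall>n. AE \<omega> in M. Ss n \<omega> \<le> Ss (Suc n) \<omega>" and lim: "AE \<omega> in M. (\<lambda>n. Ss n \<omega>) \<longlonglongrightarrow> S \<omega>"
    have inc_AE: "AE \<omega> in M. \<forall>n. Ss n \<omega> \<le> Ss (Suc n) \<omega>" using inc by (simp add: AE_all_countable)
    have le_S: "AE \<omega> in M. Ss n \<omega> \<le> S \<omega>" for n
      using inc_AE lim
      by eventually_elim (rule incseq_le[OF incseq_SucI], auto)
    have "incseq (\<lambda>n. \<sigma> (Ss n))" using Ss inc by (intro incseq_SucI \<sigma>_mono) auto
    moreover have \<sigma>_le_S: "\<sigma> (Ss n) \<le> \<sigma> S" for n using Ss S le_S by (intro \<sigma>_mono) auto
    ultimately obtain L where L: "(\<lambda>n. \<sigma> (Ss n)) \<longlonglongrightarrow> L" "\<forall>n. \<sigma> (Ss n) \<le> L"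
      using incseq_convergent[of "\<lambda>n. \<sigma> (Ss n)" "\<sigma> S"] by metis
    have "L \<le> \<sigma> S" using L(1) \<sigma>_le_S by (intro LIMSEQ_le_const2) auto
    moreover have "\<sigma> S \<le> L"
    proof (rule field_le_epsilon)
      fix d :: real assume "0 < d"
      \<comment> \<open>The values \<open>F (Ss n) X\<close> increase with \<open>n\<close>, so
        these sublevel sets decrease. A single \<open>X\<close> in all of them is nearly optimal for
        every \<open>n\<close>, and continuity from below of \<open>\<rho>\<close> along
        \<open>X + Ss n\<close> transfers this to \<open>S\<close>.\<close>
      define C where "C n = {X \<in> ?D. F (Ss n) X \<le> L + d + m}" for n
      obtain X where X: "\<And>n. X \<in> C n"
      proof (rule decreasing_convex_sets_common_point[OF ab, of C])
        fix n
        have "\<sigma> (Ss n) < L + d" using L(2) \<open>0 < d\<close> by (smt (verit))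
        from \<sigma>_less[OF _ this] Ss obtain X where "X \<in> ?D" "F (Ss n) X < L + d + m" by blast
        then have "X \<in> C n" by (simp add: C_def)
        then show "C n \<noteq> {}" by blast
        have "F (Ss n) X \<le> F (Ss (Suc n)) X" if "X \<in> ?D" for X
        proof -
          have "\<rho> (\<lambda>\<omega>. X \<omega> + Ss n \<omega>) \<le> \<rho> (\<lambda>\<omega>. X \<omega> + Ss (Suc n) \<omega>)"
            using that Ss inc by (intro convex_expectation_mono[OF \<rho>(1)] Linf_add) (auto simp: Lbox_def)
          then show ?thesis by (simp add: F_def)
        qed
        then show "C (Suc n) \<subseteq> C n" unfolding C_def by (auto intro: order_trans)
        show "C n \<subseteq> ?D" by (auto simp: C_def)
      next
        fix n X Y assume XY: "X \<in> C n" "Y \<in> C n"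
        have "(\<lambda>\<omega>. (1 / 2) * Ss n \<omega> + (1 - 1 / 2) * Ss n \<omega>) = Ss n" by auto
        then have "F (Ss n) (\<lambda>\<omega>. (X \<omega> + Y \<omega>) / 2) \<le> (1 / 2) * F (Ss n) X + (1 - 1 / 2) * F (Ss n) Y"
          unfolding midpoint_eq using F_convex[of "Ss n" "Ss n" X Y "1 / 2"] XY Ss by (simp add: C_def)
        also have "\<dots> \<le> L + d + m" using XY by (simp add: C_def)
        finally have "F (Ss n) (\<lambda>\<omega>. (X \<omega> + Y \<omega>) / 2) \<le> L + d + m" .
        moreover have "(\<lambda>\<omega>. (X \<omega> + Y \<omega>) / 2) \<in> ?D"
          unfolding midpoint_eq using XY by (intro Lbox_convex) (auto simp: C_def)
        ultimately show "(\<lambda>\<omega>. (X \<omega> + Y \<omega>) / 2) \<in> C n" by (simp add: C_def)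
      next
        fix n Xs X assume *: "\<And>j::nat. Xs j \<in> C n" "X \<in> ?D" "AE \<omega> in M. (\<lambda>j. Xs j \<omega>) \<longlonglongrightarrow> X \<omega>"
        have "F (Ss n) X \<le> L + d + m"
          by (rule ae_lsc_onD_le[OF F_lsc, of "Ss n" Xs X]) (use * Ss in \<open>auto simp: C_def\<close>)
        then show "X \<in> C n" using * by (simp add: C_def)
      qed blast
      have XD: "X \<in> ?D" using X[of 0] by (simp add: C_def)
      have "AE \<omega> in M. X \<omega> + Ss n \<omega> \<le> X \<omega> + Ss (Suc n) \<omega>" for n
        using inc by auto
      moreover have "AE \<omega> in M. (\<lambda>n. X \<omega> + Ss n \<omega>) \<longlonglongrightarrow> X \<omega> + S \<omega>"
        using lim by eventually_elim (intro tendsto_intros)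
      ultimately have "(\<lambda>n. \<rho> (\<lambda>\<omega>. X \<omega> + Ss n \<omega>)) \<longlonglongrightarrow> \<rho> (\<lambda>\<omega>. X \<omega> + S \<omega>)"
        using \<rho>(2) Ss S Lbox_Linf[OF XD] unfolding continuous_from_below_def
        by (elim allE[of _ "\<lambda>n \<omega>. X \<omega> + Ss n \<omega>"] allE[of _ "\<lambda>\<omega>. X \<omega> + S \<omega>"]) blast
      then have "(\<lambda>n. F (Ss n) X) \<longlonglongrightarrow> F S X" unfolding F_def by (intro tendsto_intros)
      then have "F S X \<le> L + d + m"
        by (rule LIMSEQ_le_const2) (use X in \<open>auto simp: C_def\<close>)
      then show "\<sigma> S \<le> L + d" using \<sigma>_le[OF S XD] by simp
    qed
    ultimately show "(\<lambda>n. \<sigma> (Ss n)) \<longlonglongrightarrow> \<sigma> S" using L(1) by simp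
  qed
  have "\<sigma> (\<lambda>_. 0) = 0" by (simp add: \<sigma>_def F_def m)
  then obtain g where g: "prob_density M g" "\<And>Z. Z \<in> Linf M \<Longrightarrow> (LINT \<omega>|M. g \<omega> * Z \<omega>) \<le> \<sigma> Z + e"
    using almost_optimal_density[OF ce cfb _ e] by blast
  show thesis
  proof (rule that[OF g(1)])
    fix X Y assume X: "X \<in> ?D" and Y: "Y \<in> Linf M"
    \<comment> \<open>The shift \<open>Y - X\<close> turns \<open>X\<close> into \<open>Y\<close>,
      whence \<open>\<sigma> (Y - X) \<le> \<rho> Y + \<theta> X - m\<close>. The free function
      \<open>Y\<close> carries the penalty of \<open>g\<close> without naming it.\<close>
    have L: "(\<lambda>\<omega>. Y \<omega> - X \<omega>) \<in> Linf M" using X Y by (auto simp: Lbox_def)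
    have "(LINT \<omega>|M. g \<omega> * (Y \<omega> - X \<omega>)) \<le> \<rho> Y + \<theta> X - m + e"
      using g(2)[OF L] \<sigma>_le[OF L X] by (simp add: F_def)
    moreover have "(LINT \<omega>|M. g \<omega> * (X \<omega> - Y \<omega>)) = - (LINT \<omega>|M. g \<omega> * (Y \<omega> - X \<omega>))"
      by (subst integral_minus[symmetric]) (simp add: algebra_simps)
    ultimately show "m - e \<le> (LINT \<omega>|M. g \<omega> * (X \<omega> - Y \<omega>)) + \<rho> Y + \<theta> X" by simp
  qed
qed

subsection \<open>Optimal densities\<close>

lemma prob_density_nn_integral:
  assumes "g \<in> borel_measurable M"
  shows "prob_density M g \<longleftrightarrow> (AE \<omega> in M. 0 \<le> g \<omega>) \<and> (\<integral>\<^sup>+\<omega>. ennreal (g \<omega>) \<partial>M) = 1"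
proof
  assume g: "prob_density M g"
  then show "(AE \<omega> in M. 0 \<le> g \<omega>) \<and> (\<integral>\<^sup>+\<omega>. ennreal (g \<omega>) \<partial>M) = 1"
    by (simp add: prob_density_def nn_integral_eq_integral)
next
  assume g: "(AE \<omega> in M. 0 \<le> g \<omega>) \<and> (\<integral>\<^sup>+\<omega>. ennreal (g \<omega>) \<partial>M) = 1"
  then have "integrable M g"
    using assms by (intro integrableI_nonneg) auto
  moreover have "(LINT \<omega>|M. g \<omega>) = 1"
    using g assms by (simp add: integral_eq_nn_integral)
  ultimately show "prob_density M g" using g by (simp add: prob_density_def)
qed

lemma (in prob_space) ac_probs_density:
  assumes P: "P \<in> ac_probs M"
  shows "P = density M (\<lambda>\<omega>. ennreal (dens M P \<omega>))" "prob_density M (dens M P)"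
proof -
  have ac: "absolutely_continuous M P" "sets P = sets M" and "prob_space P"
    using P by (auto simp: ac_probs_def)
  interpret P: prob_space P by fact
  have [measurable]: "dens M P \<in> borel_measurable M"
    unfolding dens_def by measurable
  \<comment> \<open>\<open>enn2real\<close> sends infinity to 0, so \<open>dens\<close> represents
    \<open>P\<close> only because the derivative is finite a.e.\<close>
  have "AE \<omega> in M. RN_deriv M P \<omega> \<noteq> \<infinity>"
    by (rule RN_deriv_finite[OF P.sigma_finite_measure_axioms ac])
  then have "AE \<omega> in M. RN_deriv M P \<omega> = ennreal (dens M P \<omega>)"
    by eventually_elim (simp add: dens_def less_top)
  then have "density M (RN_deriv M P) = density M (\<lambda>\<omega>. ennreal (dens M P \<omega>))"
    by (intro density_cong) auto
  then show eq: "P = density M (\<lambda>\<omega>. ennreal (dens M P \<omega>))"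
    using density_RN_deriv[OF ac] by simp
  have "1 = emeasure P (space P)" by (simp add: P.emeasure_space_1)
  also have "\<dots> = emeasure (density M (\<lambda>\<omega>. ennreal (dens M P \<omega>))) (space M)"
    using eq sets_eq_imp_space_eq[OF ac(2)] by simp
  also have "\<dots> = (\<integral>\<^sup>+\<omega>. ennreal (dens M P \<omega>) \<partial>M)"
    by (subst emeasure_density) (auto intro!: nn_integral_cong)
  finally show "prob_density M (dens M P)"
    by (simp add: prob_density_nn_integral) (simp add: dens_def)
qed

lemma (in prob_space) density_ac_probs:
  assumes g: "prob_density M g"
  shows "density M (\<lambda>\<omega>. ennreal (g \<omega>)) \<in> ac_probs M"
    and "AE \<omega> in M. dens M (density M (\<lambda>\<omega>. ennreal (g \<omega>))) \<omega> = g \<omega>"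
proof -
  have [measurable]: "g \<in> borel_measurable M" using g by (rule prob_density_measurable)
  have "emeasure (density M (\<lambda>\<omega>. ennreal (g \<omega>))) (space M) = 1"
    using g by (subst emeasure_density) (auto simp: prob_density_nn_integral cong: nn_integral_cong)
  then have "prob_space (density M (\<lambda>\<omega>. ennreal (g \<omega>)))"
    by (intro prob_spaceI) simp
  then show "density M (\<lambda>\<omega>. ennreal (g \<omega>)) \<in> ac_probs M"
    by (simp add: ac_probs_def absolutely_continuousI_density)
  have "AE \<omega> in M. ennreal (g \<omega>) = RN_deriv M (density M (\<lambda>\<omega>. ennreal (g \<omega>))) \<omega>"
    by (rule RN_deriv_unique) auto
  moreover have "AE \<omega> in M. 0 \<le> g \<omega>" using g by (simp add: prob_density_def)
  ultimately show "AE \<omega> in M. dens M (density M (\<lambda>\<omega>. ennreal (g \<omega>))) \<omega> = g \<omega>"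
    by eventually_elim (metis dens_def enn2real_ennreal)
qed

lemma (in prob_space) penalty_le_iff:
  assumes P: "P \<in> ac_probs M"
  shows "penalty M \<rho> P \<le> ereal c \<longleftrightarrow> (\<forall>X\<in>Linf M. (LINT \<omega>|M. dens M P \<omega> * X \<omega>) \<le> \<rho> X + c)"
proof -
  have d: "dens M P \<in> borel_measurable M" "AE \<omega> in M. 0 \<le> dens M P \<omega>"
    using ac_probs_density(2)[OF P] by (auto simp: prob_density_def)
  have "(LINT \<omega>|P. X \<omega>) = (LINT \<omega>|M. dens M P \<omega> * X \<omega>)" if "X \<in> Linf M" for X
    using integral_real_density[OF d, of X] ac_probs_density(1)[OF P] that
    by (simp add: Linf_def)
  then show ?thesis
    by (auto simp: penalty_def SUP_le_iff algebra_simps)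
qed

text \<open>Radon-Nikodym removes the measures: a level set is cut out by the linear inequalities
  \<open>E[g X] \<le> \<rho> X + c\<close>, so its convexity is evident and membership of a function
  can be tested directly.\<close>

lemma (in prob_space) density_level_set_iff:
  "g \<in> density_level_set M \<rho> c \<longleftrightarrow>
    prob_density M g \<and> (\<forall>X\<in>Linf M. (LINT \<omega>|M. g \<omega> * X \<omega>) \<le> \<rho> X + c)"
proof
  assume "g \<in> density_level_set M \<rho> c"
  then obtain P where P: "P \<in> ac_probs M" "penalty M \<rho> P \<le> ereal c"
    and g: "g \<in> borel_measurable M" "AE \<omega> in M. g \<omega> = dens M P \<omega>"
    by (auto simp: density_level_set_def finite_penalty_probs_def)
  have d: "prob_density M (dens M P)" by (rule ac_probs_density(2)[OF P(1)])
  then have [measurable]: "dens M P \<in> borel_measurable M" by (rule prob_density_measurable)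
  note [measurable] = g(1)
  have "AE \<omega> in M. 0 \<le> g \<omega>"
    using g(2) d[unfolded prob_density_def, THEN conjunct2, THEN conjunct1] by eventually_elim simp
  moreover have "(\<integral>\<^sup>+\<omega>. ennreal (g \<omega>) \<partial>M) = (\<integral>\<^sup>+\<omega>. ennreal (dens M P \<omega>) \<partial>M)"
    using g(2) by (intro nn_integral_cong_AE) (auto elim: eventually_mono)
  ultimately have "prob_density M g" using d by (simp add: prob_density_nn_integral)
  moreover have "(LINT \<omega>|M. g \<omega> * X \<omega>) = (LINT \<omega>|M. dens M P \<omega> * X \<omega>)" if "X \<in> Linf M" for X
  proof (rule integral_cong_AE)
    show "AE \<omega> in M. g \<omega> * X \<omega> = dens M P \<omega> * X \<omega>" using g(2) by eventually_elim simp
  qed (use that in \<open>auto simp: Linf_def\<close>)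
  ultimately show "prob_density M g \<and> (\<forall>X\<in>Linf M. (LINT \<omega>|M. g \<omega> * X \<omega>) \<le> \<rho> X + c)"
    using penalty_le_iff[OF P(1), of \<rho> c] P(2) by simp
next
  assume g: "prob_density M g \<and> (\<forall>X\<in>Linf M. (LINT \<omega>|M. g \<omega> * X \<omega>) \<le> \<rho> X + c)"
  define P where "P = density M (\<lambda>\<omega>. ennreal (g \<omega>))"
  have P: "P \<in> ac_probs M" "AE \<omega> in M. dens M P \<omega> = g \<omega>"
    using density_ac_probs g by (auto simp: P_def)
  have [measurable]: "g \<in> borel_measurable M" "dens M P \<in> borel_measurable M"
    using g ac_probs_density(2)[OF P(1)] by (simp_all add: prob_density_measurable)
  have "(LINT \<omega>|M. dens M P \<omega> * X \<omega>) = (LINT \<omega>|M. g \<omega> * X \<omega>)" if "X \<in> Linf M" for X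
  proof (rule integral_cong_AE)
    show "AE \<omega> in M. dens M P \<omega> * X \<omega> = g \<omega> * X \<omega>" using P(2) by eventually_elim simp
  qed (use that in \<open>auto simp: Linf_def\<close>)
  then have "penalty M \<rho> P \<le> ereal c" using penalty_le_iff[OF P(1), of \<rho> c] g by simp
  moreover from this have "penalty M \<rho> P < \<infinity>" by (rule order_le_less_trans) simp
  moreover have "AE \<omega> in M. g \<omega> = dens M P \<omega>" using P(2) by eventually_elim simp
  ultimately show "g \<in> density_level_set M \<rho> c"
    using P(1) by (auto simp: density_level_set_def finite_penalty_probs_def)
qed

text \<open>Scheffe's lemma: no mass escapes because the a.e. limit is again a probability density,
  so the convergence holds in L1 and passes through any bounded factor.\<close>

lemma prob_density_tendsto:
  assumes "\<And>n. prob_density M (g n)" "prob_density M h" "AE \<omega> in M. (\<lambda>n. g n \<omega>) \<longlonglongrightarrow> h \<omega>"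
    and Z: "Z \<in> Linf M"
  shows "(\<lambda>n. LINT \<omega>|M. g n \<omega> * Z \<omega>) \<longlonglongrightarrow> (LINT \<omega>|M. h \<omega> * Z \<omega>)"
proof (rule tendsto_L1_int)
  obtain C where C: "0 \<le> C" "AE \<omega> in M. \<bar>Z \<omega>\<bar> \<le> C" by (rule LinfE[OF Z])
  have gi: "integrable M (g n)" "integrable M h" for n
    using assms(1,2) by (auto simp: prob_density_def)
  show "integrable M (\<lambda>\<omega>. g n \<omega> * Z \<omega>)" "integrable M (\<lambda>\<omega>. h \<omega> * Z \<omega>)" for n
    using gi Z by auto
  have mass: "(\<integral>\<^sup>+\<omega>. norm (f \<omega>) \<partial>M) = 1" if "prob_density M f" for f
  proof -
    have "(\<integral>\<^sup>+\<omega>. norm (f \<omega>) \<partial>M) = (\<integral>\<^sup>+\<omega>. ennreal (f \<omega>) \<partial>M)"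
      using that by (intro nn_integral_cong_AE) (auto simp: prob_density_def elim!: eventually_mono)
    moreover have "f \<in> borel_measurable M" using that by (auto simp: prob_density_def)
    ultimately show ?thesis using that by (simp add: prob_density_nn_integral)
  qed
  have "(\<lambda>n. \<integral>\<^sup>+\<omega>. norm (g n \<omega> - h \<omega>) \<partial>M) \<longlonglongrightarrow> 0"
    using gi assms mass by (intro Scheffe_lemma2) auto
  then have "(\<lambda>n. ennreal C * (\<integral>\<^sup>+\<omega>. norm (g n \<omega> - h \<omega>) \<partial>M)) \<longlonglongrightarrow> ennreal C * 0"
    by (intro tendsto_intros) auto
  then have lim: "(\<lambda>n. ennreal C * (\<integral>\<^sup>+\<omega>. norm (g n \<omega> - h \<omega>) \<partial>M)) \<longlonglongrightarrow> 0" by simp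
  show "(\<lambda>n. \<integral>\<^sup>+\<omega>. norm (g n \<omega> * Z \<omega> - h \<omega> * Z \<omega>) \<partial>M) \<longlonglongrightarrow> 0"
  proof (rule tendsto_sandwich[OF _ _ tendsto_const lim])
    show "\<forall>\<^sub>F n in sequentially. (\<integral>\<^sup>+\<omega>. norm (g n \<omega> * Z \<omega> - h \<omega> * Z \<omega>) \<partial>M) \<le>
        ennreal C * (\<integral>\<^sup>+\<omega>. norm (g n \<omega> - h \<omega>) \<partial>M)"
    proof (rule always_eventually, rule allI)
      fix n
      have [measurable]: "g n \<in> borel_measurable M" "h \<in> borel_measurable M" using gi by auto
      have "(\<integral>\<^sup>+\<omega>. norm (g n \<omega> * Z \<omega> - h \<omega> * Z \<omega>) \<partial>M) \<le>
          (\<integral>\<^sup>+\<omega>. ennreal C * norm (g n \<omega> - h \<omega>) \<partial>M)"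
      proof (rule nn_integral_mono_AE)
        show "AE \<omega> in M. ennreal (norm (g n \<omega> * Z \<omega> - h \<omega> * Z \<omega>)) \<le> ennreal C * ennreal (norm (g n \<omega> - h \<omega>))"
          using C(2)
        proof eventually_elim
          case (elim \<omega>)
          have "norm (g n \<omega> * Z \<omega> - h \<omega> * Z \<omega>) = \<bar>Z \<omega>\<bar> * \<bar>g n \<omega> - h \<omega>\<bar>"
            by (simp add: abs_mult[symmetric] algebra_simps)
          also have "\<dots> \<le> C * \<bar>g n \<omega> - h \<omega>\<bar>" using elim by (intro mult_right_mono) auto
          finally show ?case
            using C(1) by (simp add: ennreal_mult[symmetric])
        qed
      qed
      also have "\<dots> = ennreal C * (\<integral>\<^sup>+\<omega>. norm (g n \<omega> - h \<omega>) \<partial>M)"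
        by (rule nn_integral_cmult) simp
      finally show "(\<integral>\<^sup>+\<omega>. norm (g n \<omega> * Z \<omega> - h \<omega> * Z \<omega>) \<partial>M) \<le>
        ennreal C * (\<integral>\<^sup>+\<omega>. norm (g n \<omega> - h \<omega>) \<partial>M)" .
    qed
  qed simp
qed

section \<open>Limits from convex sets of densities\<close>

lemma prob_density_midpoint:
  assumes "prob_density M g" "prob_density M h"
  shows "prob_density M (\<lambda>\<omega>. (g \<omega> + h \<omega>) / 2)"
proof -
  have "AE \<omega> in M. 0 \<le> g \<omega>" "AE \<omega> in M. 0 \<le> h \<omega>" using assms by (auto simp: prob_density_def)
  then have "AE \<omega> in M. 0 \<le> (g \<omega> + h \<omega>) / 2" by eventually_elim simp
  then show ?thesis using assms by (simp add: prob_density_def)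
qed

text \<open>With \<open>a = 1 / (1 + x)\<close> and \<open>b = 1 / (1 + y)\<close> the left side is
  the harmonic mean of \<open>a\<close> and \<open>b\<close>. It falls short of the arithmetic mean
  by \<open>(a - b)\<^sup>2 / (2 * (a + b))\<close>, and \<open>a + b \<le> 2\<close>.\<close>

lemma inverse_midpoint_le:
  fixes x y :: real
  assumes "0 \<le> x" "0 \<le> y"
  shows "1 / (1 + (x + y) / 2) \<le> (1 / (1 + x) + 1 / (1 + y)) / 2 - (1 / (1 + x) - 1 / (1 + y))\<^sup>2 / 4"
proof -
  define a b where "a = 1 / (1 + x)" and "b = 1 / (1 + y)"
  have ab: "0 < a" "a \<le> 1" "0 < b" "b \<le> 1" using assms by (auto simp: a_def b_def)
  have "1 / (1 + (x + y) / 2) = 2 / ((1 + x) + (1 + y))" using assms by (simp add: field_simps)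
  also have "\<dots> = 2 / (1 / a + 1 / b)" by (simp add: a_def b_def)
  also have "\<dots> = 2 * a * b / (a + b)" using ab by (simp add: field_simps)
  also have "\<dots> = (a + b) / 2 - (a - b)\<^sup>2 / (2 * (a + b))"
    using ab by (simp add: field_simps power2_eq_square)
  also have "\<dots> \<le> (a + b) / 2 - (a - b)\<^sup>2 / 4"
    using ab by (intro diff_left_mono divide_left_mono) auto
  finally show ?thesis by (simp add: a_def b_def)
qed

text \<open>
  Substitute for Komlos' theorem: minimise the uniformly convex functional \<open>\<integral> 1 / (1 + g)\<close>. By Fatou's
  lemma the limit of the functions \<open>1 / (1 + g)\<close> is positive almost everywhere.
\<close>

lemma (in prob_space) decreasing_density_sets_AE_convergent:
  assumes C: "\<And>n. C n \<noteq> {}" "\<And>n. C (Suc n) \<subseteq> C n" "\<And>n g. g \<in> C n \<Longrightarrow> prob_density M g"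
    and mid: "\<And>n g h. g \<in> C n \<Longrightarrow> h \<in> C n \<Longrightarrow> (\<lambda>\<omega>. (g \<omega> + h \<omega>) / 2) \<in> C n"
  obtains g h where "\<And>n k. g (n + k) \<in> C n" "h \<in> borel_measurable M"
    "AE \<omega> in M. (\<lambda>n. g n \<omega>) \<longlonglongrightarrow> h \<omega>"
proof (rule uniformly_convex_selection[of C "\<lambda>g. LINT \<omega>|M. 1 / (1 + g \<omega>)" 1 "\<lambda>g \<omega>. 1 / (1 + g \<omega>)"])
  have nonneg: "AE \<omega> in M. 0 \<le> g \<omega>" and meas: "g \<in> borel_measurable M" if "g \<in> C n" for g n
    using C(3)[OF that] by (auto simp: prob_density_def)
  have L: "(\<lambda>\<omega>. 1 / (1 + g \<omega>)) \<in> Linf M" if "g \<in> C n" for g n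
  proof (rule LinfI)
    show "AE \<omega> in M. \<bar>1 / (1 + g \<omega>)\<bar> \<le> 1" using nonneg[OF that] by eventually_elim simp
  qed (use meas[OF that] in measurable)
  then show "\<And>n g. g \<in> C n \<Longrightarrow> (\<lambda>\<omega>. 1 / (1 + g \<omega>)) \<in> Linf M" .
  show "0 \<le> (LINT \<omega>|M. 1 / (1 + g \<omega>))" if "g \<in> C n" for g n
  proof (rule integral_nonneg_AE)
    show "AE \<omega> in M. 0 \<le> 1 / (1 + g \<omega>)" using nonneg[OF that] by eventually_elim simp
  qed
  show "(LINT \<omega>|M. 1 / (1 + g \<omega>)) \<le> 1" if "g \<in> C n" for g n
  proof -
    have "(LINT \<omega>|M. 1 / (1 + g \<omega>)) \<le> (LINT \<omega>|M. 1)"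
    proof (rule integral_mono_AE)
      show "AE \<omega> in M. 1 / (1 + g \<omega>) \<le> 1" using nonneg[OF that] by eventually_elim simp
    qed (use L[OF that] in \<open>auto intro: Linf_integrable\<close>)
    then show ?thesis by (simp add: prob_space)
  qed
  show "\<exists>z\<in>C n. (LINT \<omega>|M. 1 / (1 + z \<omega>)) \<le> ((LINT \<omega>|M. 1 / (1 + g \<omega>)) + (LINT \<omega>|M. 1 / (1 + h \<omega>))) / 2 -
      (LINT \<omega>|M. (1 / (1 + g \<omega>) - 1 / (1 + h \<omega>))\<^sup>2) / 4" if "g \<in> C n" "h \<in> C n" for n g h
  proof (rule bexI[OF _ mid[OF that]])
    have i: "integrable M (\<lambda>\<omega>. 1 / (1 + g \<omega>))" "integrable M (\<lambda>\<omega>. 1 / (1 + h \<omega>))"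
      "integrable M (\<lambda>\<omega>. (1 / (1 + g \<omega>) - 1 / (1 + h \<omega>))\<^sup>2)"
      by (intro Linf_integrable Linf_power Linf_diff L[OF that(1)] L[OF that(2)])+
    have "(LINT \<omega>|M. 1 / (1 + (g \<omega> + h \<omega>) / 2)) \<le>
        (LINT \<omega>|M. (1 / (1 + g \<omega>) + 1 / (1 + h \<omega>)) / 2 - (1 / (1 + g \<omega>) - 1 / (1 + h \<omega>))\<^sup>2 / 4)"
    proof (rule integral_mono_AE)
      show "AE \<omega> in M. 1 / (1 + (g \<omega> + h \<omega>) / 2) \<le>
          (1 / (1 + g \<omega>) + 1 / (1 + h \<omega>)) / 2 - (1 / (1 + g \<omega>) - 1 / (1 + h \<omega>))\<^sup>2 / 4"
        using nonneg[OF that(1)] nonneg[OF that(2)]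
        by eventually_elim (rule inverse_midpoint_le)
      show "integrable M (\<lambda>\<omega>. 1 / (1 + (g \<omega> + h \<omega>) / 2))"
        by (rule Linf_integrable[OF L[OF mid[OF that]]])
    qed (use i in simp)
    also have "\<dots> = ((LINT \<omega>|M. 1 / (1 + g \<omega>)) + (LINT \<omega>|M. 1 / (1 + h \<omega>))) / 2 -
        (LINT \<omega>|M. (1 / (1 + g \<omega>) - 1 / (1 + h \<omega>))\<^sup>2) / 4"
      using i by simp
    finally show "(LINT \<omega>|M. 1 / (1 + (g \<omega> + h \<omega>) / 2)) \<le>
        ((LINT \<omega>|M. 1 / (1 + g \<omega>)) + (LINT \<omega>|M. 1 / (1 + h \<omega>))) / 2 -
        (LINT \<omega>|M. (1 / (1 + g \<omega>) - 1 / (1 + h \<omega>))\<^sup>2) / 4" .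
  qed
  fix g A assume g: "\<And>n k. g (n + k) \<in> C n" and A: "A \<in> borel_measurable M"
    "AE \<omega> in M. (\<lambda>n. 1 / (1 + g n \<omega>)) \<longlonglongrightarrow> A \<omega>"
  have g0: "g k \<in> C 0" for k using g[of 0 k] by simp
  have [measurable]: "g k \<in> borel_measurable M" for k using meas[OF g0] .
  have nn: "AE \<omega> in M. \<forall>k. 0 \<le> g k \<omega>" unfolding AE_all_countable using nonneg[OF g0] by blast
  have "(\<integral>\<^sup>+\<omega>. liminf (\<lambda>k. ennreal (g k \<omega>)) \<partial>M) \<le> liminf (\<lambda>k. \<integral>\<^sup>+\<omega>. ennreal (g k \<omega>) \<partial>M)"
    by (rule nn_integral_liminf) simp
  also have "(\<lambda>k. \<integral>\<^sup>+\<omega>. ennreal (g k \<omega>) \<partial>M) = (\<lambda>k. 1)"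
    using C(3)[OF g0] by (simp add: prob_density_nn_integral)
  finally have "(\<integral>\<^sup>+\<omega>. liminf (\<lambda>k. ennreal (g k \<omega>)) \<partial>M) \<le> 1" by (simp add: Liminf_const)
  then have "(\<integral>\<^sup>+\<omega>. liminf (\<lambda>k. ennreal (g k \<omega>)) \<partial>M) \<noteq> \<infinity>" by (auto simp: top_unique)
  then have fin: "AE \<omega> in M. liminf (\<lambda>k. ennreal (g k \<omega>)) \<noteq> \<infinity>"
    by (rule nn_integral_noteq_infinite[rotated]) simp
  show thesis
  proof (rule that[OF g])
    show "(\<lambda>\<omega>. 1 / A \<omega> - 1) \<in> borel_measurable M" using A(1) by measurable
    show "AE \<omega> in M. (\<lambda>n. g n \<omega>) \<longlonglongrightarrow> 1 / A \<omega> - 1"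
      using A(2) nn fin
    proof eventually_elim
      case (elim \<omega>)
      \<comment> \<open>Where \<open>A\<close> vanishes, \<open>g k\<close> tends to infinity,
        against the finiteness of its liminf obtained from the unit masses. Hence
        \<open>1 / (1 + g n)\<close> may be inverted in the limit.\<close>
      have "A \<omega> \<noteq> 0"
      proof
        assume A0: "A \<omega> = 0"
        have "of_nat N \<le> liminf (\<lambda>k. ennreal (g k \<omega>))" for N :: nat
        proof (rule Liminf_bounded)
          have "\<forall>\<^sub>F k in sequentially. 1 / (1 + g k \<omega>) < 1 / (1 + real N)"
            using elim(1) A0 by (intro order_tendstoD(2)[where y = 0]) auto
          then show "\<forall>\<^sub>F k in sequentially. of_nat N \<le> ennreal (g k \<omega>)"
          proof eventually_elim
            case (elim k)
            then have "real N \<le> g k \<omega>" using \<open>\<forall>k. 0 \<le> g k \<omega>\<close>[rule_format, of k] by (simp add: field_simps)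
            then show ?case by (metis ennreal_leI ennreal_of_nat_eq_real_of_nat)
          qed
        qed
        then have "\<not> liminf (\<lambda>k. ennreal (g k \<omega>)) < top"
          using ennreal_Ex_less_of_nat by (fastforce simp: not_less[symmetric])
        with elim(3) show False by (simp add: less_top)
      qed
      then have "(\<lambda>n. 1 / (1 / (1 + g n \<omega>)) - 1) \<longlonglongrightarrow> 1 / A \<omega> - 1"
        using elim(1) by (intro tendsto_intros)
      then show ?case by simp
    qed
  qed
qed (rule C(1,2))+

text \<open>The bound on \<open>u\<close> places almost optimal densities in the level set.
  Selecting from these convex sets gives an a.e. limit, closedness keeps it in the level set and so
  makes it a density, and by L1 convergence the errors vanish in the limit.\<close>

lemma (in prob_space) optimal_density_box:
  assumes \<rho>: "convex_expectation M \<rho>" "continuous_from_below M \<rho>"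
    and ab: "a \<in> Linf M" "b \<in> Linf M" and ne: "Lbox M a b \<noteq> {}"
    and range: "\<And>X. X \<in> Lbox M a b \<Longrightarrow> AE \<omega> in M. 0 \<le> X \<omega> \<and> X \<omega> \<le> K"
    and lsc: "ae_lsc_on M (Lbox M a b) \<theta>"
    and conv: "\<And>X Y l. X \<in> Lbox M a b \<Longrightarrow> Y \<in> Lbox M a b \<Longrightarrow> 0 \<le> l \<Longrightarrow> l \<le> 1 \<Longrightarrow>
      \<theta> (\<lambda>\<omega>. l * X \<omega> + (1 - l) * Y \<omega>) \<le> l * \<theta> X + (1 - l) * \<theta> Y"
    and bdd: "\<And>X. X \<in> Lbox M a b \<Longrightarrow> k \<le> \<theta> X"
    and u: "K - \<rho> (\<lambda>_. 0) + 1 < u"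
    and closed: "closed_under_ae_convergence M (density_level_set M \<rho> u)"
    and m: "\<And>X. X \<in> Lbox M a b \<Longrightarrow> m \<le> \<rho> X + \<theta> X"
  obtains g where "g \<in> density_level_set M \<rho> u"
    "\<And>X Y. X \<in> Lbox M a b \<Longrightarrow> Y \<in> Linf M \<Longrightarrow>
      m \<le> (LINT \<omega>|M. g \<omega> * (X \<omega> - Y \<omega>)) + \<rho> Y + \<theta> X"
proof -
  let ?D = "Lbox M a b"
  \<comment> \<open>The true infimum rather than its lower bound \<open>m\<close>, since
    near-minimisers are needed to locate the densities in the level set.\<close>
  define m' where "m' = (INF X\<in>?D. \<rho> X + \<theta> X)"
  have bb: "bdd_below ((\<lambda>X. \<rho> X + \<theta> X) ` ?D)" by (rule bdd_belowI2[OF m])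
  have mm': "m \<le> m'" unfolding m'_def by (rule cINF_greatest[OF ne m])
  define \<Phi> where "\<Phi> g X Y = (LINT \<omega>|M. g \<omega> * (X \<omega> - Y \<omega>)) + \<rho> Y + \<theta> X" for g X Y
  \<comment> \<open>Starting the errors at \<open>n + 2\<close> keeps them at most 1/2.\<close>
  define C where "C n = {g \<in> density_level_set M \<rho> u.
    \<forall>X\<in>?D. \<forall>Y\<in>Linf M. m' - 1 / real (n + 2) \<le> \<Phi> g X Y}" for n
  have Cd: "prob_density M g" if "g \<in> C n" for g n
    using that by (simp add: C_def density_level_set_iff)
  show thesis
  proof (rule decreasing_density_sets_AE_convergent[of C])
    fix n
    show "C n \<noteq> {}"
    proof -
      define e where "e = 1 / real (n + 2)"
      have e: "0 < e" "e \<le> 1 / 2" by (auto simp: e_def field_simps)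
      obtain g where g: "prob_density M g"
        "\<And>X Y. X \<in> ?D \<Longrightarrow> Y \<in> Linf M \<Longrightarrow> m' - e \<le> \<Phi> g X Y"
        unfolding \<Phi>_def
        using almost_optimal_density_box[OF \<rho> e(1) ab ne lsc conv bdd m'_def] by blast
      \<comment> \<open>\<open>X\<close> is optimal up to 1/2, and \<open>g\<close> up to
        \<open>e \<le> 1 / 2\<close>. Inserting \<open>X\<close>, with \<open>E[g X] \<le> K\<close>
        and \<open>\<rho> X \<ge> \<rho> 0\<close>, bounds the penalty of \<open>g\<close> by
        \<open>K - \<rho> 0 + 1\<close>, which is below \<open>u\<close>.\<close>
      obtain X where X: "X \<in> ?D" "\<rho> X + \<theta> X < m' + 1 / 2"
        using cINF_less_iff[OF ne bb, of "m' + 1 / 2"] by (auto simp: m'_def)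
      have XL: "X \<in> Linf M" using X(1) by (rule Lbox_Linf)
      have gi: "integrable M g" "AE \<omega> in M. 0 \<le> g \<omega>" "(LINT \<omega>|M. g \<omega>) = 1"
        using g(1) by (auto simp: prob_density_def)
      have "(LINT \<omega>|M. g \<omega> * X \<omega>) \<le> (LINT \<omega>|M. g \<omega> * K)"
      proof (rule integral_mono_AE)
        show "AE \<omega> in M. g \<omega> * X \<omega> \<le> g \<omega> * K"
          using range[OF X(1)] gi(2) by eventually_elim (auto intro: mult_left_mono)
      qed (use gi XL in auto)
      then have gX: "(LINT \<omega>|M. g \<omega> * X \<omega>) \<le> K" using gi by simp
      have "\<rho> (\<lambda>_. 0) + 0 \<le> \<rho> X"
        using range[OF X(1)] by (intro convex_expectation_ge[OF \<rho>(1) XL]) (auto elim: eventually_mono)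
      moreover have "(LINT \<omega>|M. g \<omega> * Y \<omega>) \<le> \<rho> Y + (LINT \<omega>|M. g \<omega> * X \<omega>) + \<theta> X - m' + e"
        if Y: "Y \<in> Linf M" for Y
      proof -
        have "(LINT \<omega>|M. g \<omega> * (X \<omega> - Y \<omega>)) = (LINT \<omega>|M. g \<omega> * X \<omega>) - (LINT \<omega>|M. g \<omega> * Y \<omega>)"
          using integrable_mult_Linf[OF gi(1) XL] integrable_mult_Linf[OF gi(1) Y]
          by (simp add: right_diff_distrib)
        then show ?thesis using g(2)[OF X(1) Y] by (simp add: \<Phi>_def)
      qed
      ultimately have "(LINT \<omega>|M. g \<omega> * Y \<omega>) \<le> \<rho> Y + u" if "Y \<in> Linf M" for Y
        using that X(2) gX u e(2) by fastforce
      then have "g \<in> C n" using g by (simp add: C_def density_level_set_iff e_def)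
      then show ?thesis by blast
    qed
    have "1 / real (Suc n + 2) \<le> 1 / real (n + 2)" by (simp add: field_simps)
    then show "C (Suc n) \<subseteq> C n" unfolding C_def by (fastforce intro: order_trans)
  next
    fix n g h assume gh: "g \<in> C n" "h \<in> C n"
    have mid_int: "(LINT \<omega>|M. (g \<omega> + h \<omega>) / 2 * Z \<omega>) = ((LINT \<omega>|M. g \<omega> * Z \<omega>) + (LINT \<omega>|M. h \<omega> * Z \<omega>)) / 2"
      if "Z \<in> Linf M" for Z
    proof -
      have "integrable M (\<lambda>\<omega>. g \<omega> * Z \<omega>)" "integrable M (\<lambda>\<omega>. h \<omega> * Z \<omega>)"
        using Cd[OF gh(1)] Cd[OF gh(2)] that by (auto simp: prob_density_def)
      then show ?thesis by (simp add: distrib_right)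
    qed
    show "(\<lambda>\<omega>. (g \<omega> + h \<omega>) / 2) \<in> C n"
      unfolding C_def density_level_set_iff
    proof (intro CollectI conjI ballI)
      show "prob_density M (\<lambda>\<omega>. (g \<omega> + h \<omega>) / 2)" by (intro prob_density_midpoint Cd[of _ n] gh)
      show "(LINT \<omega>|M. (g \<omega> + h \<omega>) / 2 * X \<omega>) \<le> \<rho> X + u" if "X \<in> Linf M" for X
      proof -
        have "(LINT \<omega>|M. g \<omega> * X \<omega>) \<le> \<rho> X + u" "(LINT \<omega>|M. h \<omega> * X \<omega>) \<le> \<rho> X + u"
          using gh that by (auto simp: C_def density_level_set_iff)
        then show ?thesis unfolding mid_int[OF that] by argo
      qed
      fix X Y assume XY: "X \<in> ?D" "Y \<in> Linf M"
      then have L: "(\<lambda>\<omega>. X \<omega> - Y \<omega>) \<in> Linf M" by (intro Linf_diff) (auto simp: Lbox_def)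
      have "m' - 1 / real (n + 2) \<le> \<Phi> g X Y" "m' - 1 / real (n + 2) \<le> \<Phi> h X Y"
        using gh XY unfolding C_def by blast+
      then show "m' - 1 / real (n + 2) \<le> \<Phi> (\<lambda>\<omega>. (g \<omega> + h \<omega>) / 2) X Y"
        unfolding \<Phi>_def mid_int[OF L] by argo
    qed
  next
    fix g h assume g: "\<And>n k. g (n + k) \<in> C n" and h: "h \<in> borel_measurable M"
      "AE \<omega> in M. (\<lambda>n. g n \<omega>) \<longlonglongrightarrow> h \<omega>"
    have g0: "g k \<in> C 0" for k using g[of 0 k] by simp
    then have "g k \<in> density_level_set M \<rho> u" for k by (simp add: C_def)
    then have hl: "h \<in> density_level_set M \<rho> u"
      using closed h unfolding closed_under_ae_convergence_def by blast
    show thesis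
    proof (rule that[OF hl])
      fix X Y assume XY: "X \<in> ?D" "Y \<in> Linf M"
      then have L: "(\<lambda>\<omega>. X \<omega> - Y \<omega>) \<in> Linf M" by (intro Linf_diff) (auto simp: Lbox_def)
      have "(\<lambda>n. \<Phi> (g n) X Y) \<longlonglongrightarrow> \<Phi> h X Y"
        unfolding \<Phi>_def
        using hl by (intro tendsto_add prob_density_tendsto[OF Cd[OF g0] _ h(2) L] tendsto_const)
          (simp add: density_level_set_iff)
      moreover have "(\<lambda>n. m' - 1 / real (n + 2)) \<longlonglongrightarrow> m' - 0"
        by (intro tendsto_diff tendsto_const LIMSEQ_ignore_initial_segment[OF lim_1_over_n])
      moreover have "m' - 1 / real (n + 2) \<le> \<Phi> (g n) X Y" for n
        using g[of n 0] XY by (simp add: C_def)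
      ultimately have "m' - 0 \<le> \<Phi> h X Y" by (intro LIMSEQ_le) auto
      then show "m \<le> (LINT \<omega>|M. h \<omega> * (X \<omega> - Y \<omega>)) + \<rho> Y + \<theta> X"
        using mm' by (simp add: \<Phi>_def)
    qed
  qed (rule Cd)
qed

subsection \<open>Duality for the testing problem\<close>

text \<open>Each point with \<open>c x > 0\<close> bounds the multiplier from below and each point
  with \<open>c y < 0\<close> from above. A mixture of the two that meets the constraint shows these
  bounds to be compatible, so the supremum of the lower ones works; the element 0 keeps it
  nonnegative and \<open>x0\<close> keeps it finite.\<close>

lemma lagrange_multiplier:
  fixes f c :: "'b \<Rightarrow> real"
  assumes x0: "x0 \<in> D" "c x0 < 0"
    and V: "\<And>x. x \<in> D \<Longrightarrow> c x \<le> 0 \<Longrightarrow> V \<le> f x"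
    and conv: "\<And>x y t. x \<in> D \<Longrightarrow> y \<in> D \<Longrightarrow> 0 \<le> t \<Longrightarrow> t \<le> 1 \<Longrightarrow>
      \<exists>w\<in>D. f w \<le> t * f x + (1 - t) * f y \<and> c w \<le> t * c x + (1 - t) * c y"
  obtains l where "0 \<le> l" "\<And>x. x \<in> D \<Longrightarrow> V \<le> f x + l * c x"
proof -
  define S where "S = insert 0 ((\<lambda>x. (V - f x) / c x) ` {x \<in> D. 0 < c x})"
  have cross: "s \<le> (f y - V) / - c y" if "s \<in> S" and y: "y \<in> D" "c y < 0" for s y
  proof -
    consider "s = 0" | x where "x \<in> D" "0 < c x" "s = (V - f x) / c x"
      using \<open>s \<in> S\<close> by (auto simp: S_def)
    then show ?thesis
    proof cases
      case 1
      then show ?thesis using V[OF y(1)] y(2) by (simp add: divide_le_0_iff)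
    next
      case 2
      \<comment> \<open>The weight at which the mixed constraint values cancel.\<close>
      define t where "t = c x / (c x - c y)"
      have t: "0 \<le> t" "t \<le> 1" "t * c y + (1 - t) * c x = 0"
        using 2 y by (auto simp: t_def field_simps)
      obtain w where w: "w \<in> D" "f w \<le> t * f y + (1 - t) * f x" "c w \<le> t * c y + (1 - t) * c x"
        using conv[OF y(1) 2(1) t(1,2)] by blast
      have "V \<le> t * f y + (1 - t) * f x" using V[OF w(1)] w(2,3) t(3) by linarith
      then have "(c x - c y) * V \<le> (c x - c y) * (t * f y + (1 - t) * f x)"
        using 2 y by (intro mult_left_mono) auto
      also have "\<dots> = c x * f y - c y * f x"
      proof -
        have "(c x - c y) * t = c x" using 2 y by (simp add: t_def)
        moreover from this have "(c x - c y) * (1 - t) = - c y" by (simp add: right_diff_distrib)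
        moreover have "(c x - c y) * (t * f y + (1 - t) * f x) =
            (c x - c y) * t * f y + (c x - c y) * (1 - t) * f x"
          by (simp add: algebra_simps)
        ultimately show ?thesis by simp
      qed
      finally have "(V - f x) * - c y \<le> (f y - V) * c x" by (simp add: algebra_simps)
      then have "V - f x \<le> (f y - V) * c x / - c y" using y(2) by (subst pos_le_divide_eq) auto
      then show ?thesis using 2 by (simp add: pos_divide_le_eq)
    qed
  qed
  have bdd: "bdd_above S" by (rule bdd_aboveI[of _ "(f x0 - V) / - c x0"]) (rule cross[OF _ x0])
  show thesis
  proof (rule that[of "Sup S"])
    show "0 \<le> Sup S" by (rule cSup_upper[OF _ bdd]) (simp add: S_def)
    fix x assume x: "x \<in> D"
    consider "c x = 0" | "0 < c x" | "c x < 0" by linarith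
    then show "V \<le> f x + Sup S * c x"
    proof cases
      case 1
      then show ?thesis using V[OF x] by simp
    next
      case 2
      then have "(V - f x) / c x \<le> Sup S" using x by (intro cSup_upper[OF _ bdd]) (auto simp: S_def)
      then show ?thesis using 2 by (simp add: field_simps)
    next
      case 3
      have "Sup S \<le> (f x - V) / - c x"
        by (rule cSup_least) (use cross[OF _ x 3] in \<open>auto simp: S_def\<close>)
      then have "Sup S * - c x \<le> f x - V" using 3 by (subst (asm) pos_le_divide_eq) auto
      then show ?thesis by simp
    qed
  qed
qed

section \<open>Iterated minimax for the two expectations\<close>

lemma Lbox_reflect:
  assumes "X \<in> Lbox M a b" "k \<in> Linf M"
  shows "(\<lambda>\<omega>. k \<omega> - X \<omega>) \<in> Lbox M (\<lambda>\<omega>. k \<omega> - b \<omega>) (\<lambda>\<omega>. k \<omega> - a \<omega>)"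
  using assms by (auto simp: Lbox_def elim!: eventually_mono)

lemma Lbox_reflect_back:
  assumes "X \<in> Lbox M (\<lambda>\<omega>. k \<omega> - b \<omega>) (\<lambda>\<omega>. k \<omega> - a \<omega>)" "k \<in> Linf M"
  shows "(\<lambda>\<omega>. k \<omega> - X \<omega>) \<in> Lbox M a b"
  using Lbox_reflect[OF assms] by simp

lemma ae_lsc_on_reflect:
  assumes "ae_lsc_on M (Lbox M (\<lambda>\<omega>. k \<omega> - b \<omega>) (\<lambda>\<omega>. k \<omega> - a \<omega>)) f" "k \<in> Linf M"
  shows "ae_lsc_on M (Lbox M a b) (\<lambda>X. f (\<lambda>\<omega>. k \<omega> - X \<omega>))"
  unfolding ae_lsc_on_def
proof (intro allI impI)
  fix Xs X c
  assume *: "\<forall>n::nat. Xs n \<in> Lbox M a b" "X \<in> Lbox M a b" "AE \<omega> in M. (\<lambda>n. Xs n \<omega>) \<longlonglongrightarrow> X \<omega>"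
    "c < f (\<lambda>\<omega>. k \<omega> - X \<omega>)"
  have "AE \<omega> in M. (\<lambda>n. k \<omega> - Xs n \<omega>) \<longlonglongrightarrow> k \<omega> - X \<omega>"
    using *(3) by eventually_elim (intro tendsto_intros)
  then show "\<forall>\<^sub>F n in sequentially. c < f (\<lambda>\<omega>. k \<omega> - Xs n \<omega>)"
    using ae_lsc_onD[OF assms(1), of "\<lambda>n \<omega>. k \<omega> - Xs n \<omega>" "\<lambda>\<omega>. k \<omega> - X \<omega>" c] *
      Lbox_reflect[OF _ assms(2)] by blast
qed

text \<open>Once \<open>g\<close> is found and frozen, infimising over \<open>Y\<close> leaves a
  function affine in \<open>X\<close>, which serves as the convex part for \<open>\<rho>2\<close> in
  the reflected variable \<open>k - X\<close>. Keeping \<open>b\<close> and \<open>k\<close> apart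
  covers both later uses, the interval \<open>[K1, K2]\<close> and the single point
  \<open>K1\<close>.\<close>

lemma (in prob_space) dual_densities:
  assumes \<rho>1: "convex_expectation M \<rho>1" "continuous_from_below M \<rho>1"
    and \<rho>2: "convex_expectation M \<rho>2" "continuous_from_below M \<rho>2"
    and L: "a \<in> Linf M" "b \<in> Linf M" "k \<in> Linf M"
    and range: "AE \<omega> in M. 0 \<le> a \<omega> \<and> a \<omega> \<le> b \<omega> \<and> b \<omega> \<le> k \<omega> \<and> k \<omega> \<le> K"
    and u: "K - \<rho>1 (\<lambda>_. 0) + 1 < u" and v: "K - \<rho>2 (\<lambda>_. 0) + 1 < v"
    and closed1: "closed_under_ae_convergence M (density_level_set M \<rho>1 u)"
    and closed2: "closed_under_ae_convergence M (density_level_set M \<rho>2 v)"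
    and l: "0 \<le> l"
    and V: "\<And>X. X \<in> Lbox M a b \<Longrightarrow> V \<le> l * \<rho>1 X + \<rho>2 (\<lambda>\<omega>. k \<omega> - X \<omega>)"
  obtains g h where "g \<in> density_level_set M \<rho>1 u" "h \<in> density_level_set M \<rho>2 v"
    "\<And>X Y Z. X \<in> Lbox M a b \<Longrightarrow> Y \<in> Linf M \<Longrightarrow> Z \<in> Linf M \<Longrightarrow>
      V \<le> l * ((LINT \<omega>|M. g \<omega> * (X \<omega> - Y \<omega>)) + \<rho>1 Y) +
        ((LINT \<omega>|M. h \<omega> * (k \<omega> - X \<omega> - Z \<omega>)) + \<rho>2 Z)"
proof -
  let ?D = "Lbox M a b" and ?D' = "Lbox M (\<lambda>\<omega>. k \<omega> - b \<omega>) (\<lambda>\<omega>. k \<omega> - a \<omega>)"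
  have L': "(\<lambda>\<omega>. k \<omega> - b \<omega>) \<in> Linf M" "(\<lambda>\<omega>. k \<omega> - a \<omega>) \<in> Linf M" using L by auto
  have ne: "?D \<noteq> {}" and ne': "?D' \<noteq> {}"
  proof -
    have "a \<in> ?D" using L range by (auto simp: Lbox_def elim!: eventually_mono)
    then show "?D \<noteq> {}" "?D' \<noteq> {}" using Lbox_reflect[OF _ L(3)] by blast+
  qed
  have D_range: "AE \<omega> in M. 0 \<le> X \<omega> \<and> X \<omega> \<le> k \<omega>" "AE \<omega> in M. 0 \<le> X \<omega> \<and> X \<omega> \<le> K" if "X \<in> ?D" for X
  proof -
    have X: "AE \<omega> in M. a \<omega> \<le> X \<omega> \<and> X \<omega> \<le> b \<omega>" using that by (simp add: Lbox_def)
    show "AE \<omega> in M. 0 \<le> X \<omega> \<and> X \<omega> \<le> k \<omega>" using range X by eventually_elim auto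
    show "AE \<omega> in M. 0 \<le> X \<omega> \<and> X \<omega> \<le> K" using range X by eventually_elim auto
  qed
  have D'_range: "AE \<omega> in M. 0 \<le> X \<omega> \<and> X \<omega> \<le> K" if "X \<in> ?D'" for X
    using D_range(1)[OF Lbox_reflect_back[OF that L(3)]] range by eventually_elim auto
  obtain g where g: "g \<in> density_level_set M \<rho>1 u"
    "\<And>X Y. X \<in> ?D \<Longrightarrow> Y \<in> Linf M \<Longrightarrow>
      V \<le> l * ((LINT \<omega>|M. g \<omega> * (X \<omega> - Y \<omega>)) + \<rho>1 Y) + \<rho>2 (\<lambda>\<omega>. k \<omega> - X \<omega>)"
  proof (cases "l = 0")
    case True
    \<comment> \<open>For \<open>l = 0\<close> the estimate is the hypothesis \<open>V\<close>
      itself, and any member of the level set will do; the zero function as \<open>\<theta>\<close>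
      produces one.\<close>
    have r0: "\<rho>1 (\<lambda>_. 0) \<le> \<rho>1 X + 0" if "X \<in> ?D" for X
      using convex_expectation_ge[OF \<rho>1(1) Lbox_Linf[OF that], of 0] D_range(1)[OF that]
      by (auto elim: eventually_mono)
    obtain g where "g \<in> density_level_set M \<rho>1 u"
      by (rule optimal_density_box[OF \<rho>1 L(1,2) ne D_range(2), where \<theta> = "\<lambda>_. 0" and k = 0, OF _ _ _ _ u closed1 r0])
        (auto intro: ae_lsc_on_tendsto)
    then show thesis using that V True by simp
  next
    case False
    then have l: "0 < l" using l by simp
    \<comment> \<open>Dividing by \<open>l\<close> normalises the coefficient of
      \<open>\<rho>1\<close> to 1, the form in which the minimax theorem is stated.\<close>
    let ?\<theta> = "\<lambda>X. \<rho>2 (\<lambda>\<omega>. k \<omega> - X \<omega>) / l"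
    have lsc: "ae_lsc_on M ?D ?\<theta>"
      by (intro ae_lsc_on_divide[OF _ l] ae_lsc_on_reflect[OF _ L(3)] convex_expectation_ae_lsc \<rho>2 L')
    have conv: "?\<theta> (\<lambda>\<omega>. t * X \<omega> + (1 - t) * Y \<omega>) \<le> t * ?\<theta> X + (1 - t) * ?\<theta> Y"
      if "X \<in> ?D" "Y \<in> ?D" "0 \<le> t" "t \<le> 1" for X Y t
    proof -
      have "\<rho>2 (\<lambda>\<omega>. t * (k \<omega> - X \<omega>) + (1 - t) * (k \<omega> - Y \<omega>)) \<le>
          t * \<rho>2 (\<lambda>\<omega>. k \<omega> - X \<omega>) + (1 - t) * \<rho>2 (\<lambda>\<omega>. k \<omega> - Y \<omega>)"
        using that by (intro convex_expectation_convex[OF \<rho>2(1)] Linf_diff L(3)) (auto simp: Lbox_def)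
      moreover have "(\<lambda>\<omega>. t * (k \<omega> - X \<omega>) + (1 - t) * (k \<omega> - Y \<omega>)) =
          (\<lambda>\<omega>. k \<omega> - (t * X \<omega> + (1 - t) * Y \<omega>))"
        by (auto simp: algebra_simps)
      ultimately show ?thesis using l by (simp add: field_simps)
    qed
    have bdd: "\<rho>2 (\<lambda>_. 0) / l \<le> ?\<theta> X" if "X \<in> ?D" for X
    proof -
      have "\<rho>2 (\<lambda>_. 0) + 0 \<le> \<rho>2 (\<lambda>\<omega>. k \<omega> - X \<omega>)"
        using D_range(1)[OF that]
        by (intro convex_expectation_ge[OF \<rho>2(1)] Linf_diff L(3) Lbox_Linf[OF that]) (auto elim: eventually_mono)
      then show ?thesis using l by (simp add: divide_right_mono)
    qed
    have m: "V / l \<le> \<rho>1 X + ?\<theta> X" if "X \<in> ?D" for X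
      using V[OF that] l by (simp add: field_simps)
    obtain g where g: "g \<in> density_level_set M \<rho>1 u"
      "\<And>X Y. X \<in> ?D \<Longrightarrow> Y \<in> Linf M \<Longrightarrow> V / l \<le> (LINT \<omega>|M. g \<omega> * (X \<omega> - Y \<omega>)) + \<rho>1 Y + ?\<theta> X"
      using optimal_density_box[OF \<rho>1 L(1,2) ne D_range(2) lsc conv bdd u closed1 m] by blast
    show thesis
    proof (rule that[OF g(1)])
      fix X Y assume "X \<in> ?D" "Y \<in> Linf M"
      from mult_left_mono[OF g(2)[OF this], of l] l
      show "V \<le> l * ((LINT \<omega>|M. g \<omega> * (X \<omega> - Y \<omega>)) + \<rho>1 Y) + \<rho>2 (\<lambda>\<omega>. k \<omega> - X \<omega>)"
        by (simp add: distrib_left)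
    qed
  qed
  have gd: "integrable M g" "AE \<omega> in M. 0 \<le> g \<omega>" and gu: "\<And>Y. Y \<in> Linf M \<Longrightarrow> (LINT \<omega>|M. g \<omega> * Y \<omega>) \<le> \<rho>1 Y + u"
    using g(1) by (auto simp: density_level_set_iff prob_density_def)
  have g_diff: "(LINT \<omega>|M. g \<omega> * (X \<omega> - Y \<omega>)) = (LINT \<omega>|M. g \<omega> * X \<omega>) - (LINT \<omega>|M. g \<omega> * Y \<omega>)"
    if "X \<in> Linf M" "Y \<in> Linf M" for X Y
    using integrable_mult_Linf[OF gd(1) that(1)] integrable_mult_Linf[OF gd(1) that(2)]
    by (simp add: right_diff_distrib)
  \<comment> \<open>Minus the penalty of \<open>g\<close>; it is finite because \<open>g\<close>
    lies in the level set, which gives \<open>p \<ge> - u\<close>.\<close>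
  define p where "p = (INF Y\<in>Linf M. \<rho>1 Y - (LINT \<omega>|M. g \<omega> * Y \<omega>))"
  have p_le: "p \<le> \<rho>1 Y - (LINT \<omega>|M. g \<omega> * Y \<omega>)" if "Y \<in> Linf M" for Y
  proof -
    have "bdd_below ((\<lambda>Y. \<rho>1 Y - (LINT \<omega>|M. g \<omega> * Y \<omega>)) ` Linf M)"
      by (rule bdd_belowI2[where m = "- u"]) (use gu in fastforce)
    then show ?thesis unfolding p_def using that by (rule cINF_lower)
  qed
  have Lne: "Linf M \<noteq> {}" using L(1) by blast
  \<comment> \<open>\<open>X\<close> now stands for the reflected variable, so this is
    \<open>l\<close> times the dual bound for \<open>\<rho>1\<close> at \<open>k - X\<close>, an
    affine function.\<close>
  define \<theta> where "\<theta> X = l * ((LINT \<omega>|M. g \<omega> * k \<omega>) - (LINT \<omega>|M. g \<omega> * X \<omega>) + p)" for X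
  have lsc: "ae_lsc_on M ?D' \<theta>"
    unfolding \<theta>_def by (intro ae_lsc_on_tendsto tendsto_intros Lbox_tendsto_integral[OF L' gd(1)])
  have conv: "\<theta> (\<lambda>\<omega>. t * X \<omega> + (1 - t) * Y \<omega>) \<le> t * \<theta> X + (1 - t) * \<theta> Y"
    if "X \<in> ?D'" "Y \<in> ?D'" for X Y t
  proof -
    have "integrable M (\<lambda>\<omega>. g \<omega> * X \<omega>)" "integrable M (\<lambda>\<omega>. g \<omega> * Y \<omega>)"
      using gd(1) Lbox_Linf[OF that(1)] Lbox_Linf[OF that(2)] by auto
    moreover have "(\<lambda>\<omega>. g \<omega> * (t * X \<omega> + (1 - t) * Y \<omega>)) =
        (\<lambda>\<omega>. t * (g \<omega> * X \<omega>) + (1 - t) * (g \<omega> * Y \<omega>))"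
      by (auto simp: algebra_simps)
    ultimately have eq: "(LINT \<omega>|M. g \<omega> * (t * X \<omega> + (1 - t) * Y \<omega>)) =
        t * (LINT \<omega>|M. g \<omega> * X \<omega>) + (1 - t) * (LINT \<omega>|M. g \<omega> * Y \<omega>)"
      by simp
    show ?thesis unfolding \<theta>_def eq by (simp add: algebra_simps)
  qed
  have bdd: "l * p \<le> \<theta> X" if "X \<in> ?D'" for X
  proof -
    have "0 \<le> (LINT \<omega>|M. g \<omega> * (k \<omega> - X \<omega>))"
    proof (rule integral_nonneg_AE)
      show "AE \<omega> in M. 0 \<le> g \<omega> * (k \<omega> - X \<omega>)"
        using gd(2) D_range(1)[OF Lbox_reflect_back[OF that L(3)]] by eventually_elim auto
    qed
    then show ?thesis
      unfolding \<theta>_def g_diff[OF L(3) Lbox_Linf[OF that]] using l by (intro mult_left_mono) auto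
  qed
  have m: "V \<le> \<rho>2 X + \<theta> X" if X: "X \<in> ?D'" for X
  proof (cases "l = 0")
    case True
    then show ?thesis using g(2)[OF Lbox_reflect_back[OF X L(3)] L(1)] by (simp add: \<theta>_def)
  next
    case False
    then have l: "0 < l" using l by simp
    have "(V - \<rho>2 X) / l - (LINT \<omega>|M. g \<omega> * (k \<omega> - X \<omega>)) \<le> p"
      unfolding p_def
    proof (rule cINF_greatest[OF Lne])
      fix Y assume Y: "Y \<in> Linf M"
      have kX: "(\<lambda>\<omega>. k \<omega> - X \<omega>) \<in> Linf M" using L(3) Lbox_Linf[OF X] by auto
      have "V \<le> l * ((LINT \<omega>|M. g \<omega> * (k \<omega> - X \<omega> - Y \<omega>)) + \<rho>1 Y) + \<rho>2 X"
        using g(2)[OF Lbox_reflect_back[OF X L(3)] Y] by simp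
      then show "(V - \<rho>2 X) / l - (LINT \<omega>|M. g \<omega> * (k \<omega> - X \<omega>)) \<le> \<rho>1 Y - (LINT \<omega>|M. g \<omega> * Y \<omega>)"
        unfolding g_diff[OF kX Y] using l by (simp add: field_simps)
    qed
    then show ?thesis
      unfolding \<theta>_def g_diff[OF L(3) Lbox_Linf[OF X]] using l by (simp add: field_simps)
  qed
  obtain h where h: "h \<in> density_level_set M \<rho>2 v"
    "\<And>X Z. X \<in> ?D' \<Longrightarrow> Z \<in> Linf M \<Longrightarrow> V \<le> (LINT \<omega>|M. h \<omega> * (X \<omega> - Z \<omega>)) + \<rho>2 Z + \<theta> X"
    using optimal_density_box[OF \<rho>2 L' ne' D'_range lsc conv bdd v closed2 m] by blast
  show thesis
  proof (rule that[OF g(1) h(1)])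
    fix X Y Z assume X: "X \<in> ?D" and Y: "Y \<in> Linf M" and Z: "Z \<in> Linf M"
    have "V \<le> (LINT \<omega>|M. h \<omega> * (k \<omega> - X \<omega> - Z \<omega>)) + \<rho>2 Z + \<theta> (\<lambda>\<omega>. k \<omega> - X \<omega>)"
      by (rule h(2)[OF Lbox_reflect[OF X L(3)] Z])
    also have "\<theta> (\<lambda>\<omega>. k \<omega> - X \<omega>) = l * ((LINT \<omega>|M. g \<omega> * X \<omega>) + p)"
      by (simp add: \<theta>_def g_diff[OF L(3) Lbox_Linf[OF X]])
    also have "\<dots> \<le> l * ((LINT \<omega>|M. g \<omega> * (X \<omega> - Y \<omega>)) + \<rho>1 Y)"
      using p_le[OF Y] l by (intro mult_left_mono) (auto simp: g_diff[OF Lbox_Linf[OF X] Y])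
    finally show "V \<le> l * ((LINT \<omega>|M. g \<omega> * (X \<omega> - Y \<omega>)) + \<rho>1 Y) +
        ((LINT \<omega>|M. h \<omega> * (k \<omega> - X \<omega> - Z \<omega>)) + \<rho>2 Z)" by simp
  qed
qed

text \<open>The comparison function \<open>Y\<close> minimises pointwise over the interval and keeps
  the values of \<open>X\<close> where \<open>\<phi> = 0\<close>. So
  \<open>\<phi> * (X - Y) \<ge> 0\<close> with integral at most 0, which forces \<open>X = Y\<close>
  a.e. where \<open>\<phi> \<noteq> 0\<close>.\<close>

lemma bang_bang:
  fixes \<phi> :: "'a \<Rightarrow> real"
  assumes \<phi>: "integrable M \<phi>" and L: "a \<in> Linf M" "b \<in> Linf M" and X: "X \<in> Lbox M a b"
    and min: "\<And>Y. Y \<in> Lbox M a b \<Longrightarrow> (LINT \<omega>|M. \<phi> \<omega> * X \<omega>) \<le> (LINT \<omega>|M. \<phi> \<omega> * Y \<omega>)"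
  shows "AE \<omega> in M. (0 < \<phi> \<omega> \<longrightarrow> X \<omega> = a \<omega>) \<and> (\<phi> \<omega> < 0 \<longrightarrow> X \<omega> = b \<omega>)"
proof -
  define Y where "Y \<omega> = (if 0 < \<phi> \<omega> then a \<omega> else if \<phi> \<omega> < 0 then b \<omega> else X \<omega>)" for \<omega>
  have XL: "X \<in> Linf M" using X by (rule Lbox_Linf)
  have X_AE: "AE \<omega> in M. a \<omega> \<le> X \<omega> \<and> X \<omega> \<le> b \<omega>" using X by (simp add: Lbox_def)
  have [measurable]: "\<phi> \<in> borel_measurable M" "a \<in> borel_measurable M" "b \<in> borel_measurable M" "X \<in> borel_measurable M"
    using \<phi> L XL by (auto simp: Linf_def)
  have "Y \<in> Lbox M a b"
  proof (rule Lbox_closed[OF L, of Y "\<lambda>_. Y"])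
    show [measurable]: "Y \<in> borel_measurable M" unfolding Y_def by measurable
    obtain C where C: "0 \<le> C" "AE \<omega> in M. \<bar>a \<omega>\<bar> \<le> C" by (rule LinfE[OF L(1)])
    obtain D where D: "0 \<le> D" "AE \<omega> in M. \<bar>b \<omega>\<bar> \<le> D" by (rule LinfE[OF L(2)])
    have Y_AE: "AE \<omega> in M. a \<omega> \<le> Y \<omega> \<and> Y \<omega> \<le> b \<omega>"
      using X_AE by eventually_elim (auto simp: Y_def)
    have "AE \<omega> in M. \<bar>Y \<omega>\<bar> \<le> C + D"
      using C(2) D(2) Y_AE by eventually_elim (use C(1) D(1) in linarith)
    then show "Y \<in> Lbox M a b" for n :: nat using Y_AE by (auto simp: Lbox_def intro: LinfI)
  qed auto
  then have YL: "Y \<in> Linf M" and le: "(LINT \<omega>|M. \<phi> \<omega> * X \<omega>) \<le> (LINT \<omega>|M. \<phi> \<omega> * Y \<omega>)"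
    by (auto simp: Lbox_def intro: min)
  have int: "integrable M (\<lambda>\<omega>. \<phi> \<omega> * (X \<omega> - Y \<omega>))" using \<phi> XL YL by (intro integrable_mult_Linf Linf_diff)
  have nn: "AE \<omega> in M. 0 \<le> \<phi> \<omega> * (X \<omega> - Y \<omega>)"
    using X_AE by eventually_elim (auto simp: Y_def mult_nonneg_nonneg mult_nonpos_nonpos)
  have "(LINT \<omega>|M. \<phi> \<omega> * (X \<omega> - Y \<omega>)) = (LINT \<omega>|M. \<phi> \<omega> * X \<omega>) - (LINT \<omega>|M. \<phi> \<omega> * Y \<omega>)"
    using integrable_mult_Linf[OF \<phi> XL] integrable_mult_Linf[OF \<phi> YL] by (simp add: right_diff_distrib)
  then have "(LINT \<omega>|M. \<phi> \<omega> * (X \<omega> - Y \<omega>)) = 0"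
    using le integral_nonneg_AE[OF nn] by linarith
  then have "AE \<omega> in M. \<phi> \<omega> * (X \<omega> - Y \<omega>) = 0"
    using integral_nonneg_eq_0_iff_AE[OF int nn] by simp
  then show ?thesis by eventually_elim (auto simp: Y_def split: if_splits)
qed

lemma (in prob_space) AE_le_Linf_norm:
  assumes X: "X \<in> Linf M"
  shows "AE \<omega> in M. \<bar>X \<omega>\<bar> \<le> Linf_norm M X"
proof -
  obtain C where C: "0 \<le> C" "AE \<omega> in M. \<bar>X \<omega>\<bar> \<le> C" by (rule LinfE[OF X])
  have [measurable]: "X \<in> borel_measurable M" using X by (simp add: Linf_def)
  define e where "e = esssup M (\<lambda>\<omega>. ereal \<bar>X \<omega>\<bar>)"
  \<comment> \<open>Finiteness matters: \<open>real_of_ereal\<close> would turn an infinite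
    essential supremum into 0.\<close>
  have "e \<le> ereal C"
    unfolding e_def using C(2) by (intro esssup_I) (auto elim: eventually_mono)
  moreover have "AE \<omega> in M. ereal \<bar>X \<omega>\<bar> \<le> e" unfolding e_def by (rule esssup_AE)
  ultimately show ?thesis
    unfolding Linf_norm_def e_def[symmetric]
    by (cases e) (auto elim: eventually_mono)
qed

text \<open>Inserting an optimal test into the dual inequality gives a saddle-point condition: the
  test minimises a linear functional over the interval, and \<open>bang_bang\<close> applies. The
  densities and \<open>l\<close> are chosen before the test and hence serve all optimal
  tests.\<close>

lemma (in prob_space) optimal_test_slater:
  assumes \<rho>1: "convex_expectation M \<rho>1" "continuous_from_below M \<rho>1"
    and \<rho>2: "convex_expectation M \<rho>2" "continuous_from_below M \<rho>2"
    and K: "K1 \<in> Linf M" "K2 \<in> Linf M"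
    and range: "AE \<omega> in M. 0 \<le> K1 \<omega> \<and> K1 \<omega> \<le> K2 \<omega> \<and> K2 \<omega> \<le> K"
    and slater: "\<rho>1 K1 < \<alpha>"
    and u: "K - \<rho>1 (\<lambda>_. 0) + 1 < u" and v: "K - \<rho>2 (\<lambda>_. 0) + 1 < v"
    and closed1: "closed_under_ae_convergence M (density_level_set M \<rho>1 u)"
    and closed2: "closed_under_ae_convergence M (density_level_set M \<rho>2 v)"
  obtains g h l where "g \<in> density_level_set M \<rho>1 u" "h \<in> density_level_set M \<rho>2 v" "0 \<le> l"
    "\<And>X. optimal_test M \<rho>1 \<rho>2 K1 K2 \<alpha> X \<Longrightarrow>
      AE \<omega> in M. (h \<omega> < l * g \<omega> \<longrightarrow> X \<omega> = K1 \<omega>) \<and> (l * g \<omega> < h \<omega> \<longrightarrow> X \<omega> = K2 \<omega>)"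
proof -
  let ?D = "Lbox M K1 K2" and ?T = "tests M \<rho>1 K1 K2 \<alpha>"
  define f where "f X = \<rho>2 (\<lambda>\<omega>. K2 \<omega> - X \<omega>)" for X
  have T_iff: "X \<in> ?T \<longleftrightarrow> X \<in> ?D \<and> \<rho>1 X \<le> \<alpha>" for X
    by (auto simp: tests_def Lbox_def)
  define V where "V = (INF X\<in>?T. f X)"
  have f_ge: "\<rho>2 (\<lambda>_. 0) \<le> f X" if "X \<in> ?D" for X
    using convex_expectation_ge[OF \<rho>2(1) Linf_diff[OF K(2) Lbox_Linf[OF that]], of 0] that
    by (auto simp: f_def Lbox_def elim!: eventually_mono)
  have V_le: "V \<le> f X" if "X \<in> ?T" for X
    unfolding V_def using that
    by (rule cINF_lower[rotated]) (use f_ge T_iff in \<open>auto intro!: bdd_belowI2[where m = "\<rho>2 (\<lambda>_. 0)"]\<close>)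
  have K1D: "K1 \<in> ?D" using K range by (auto simp: Lbox_def elim!: eventually_mono)
  have conv: "\<exists>W\<in>?D. f W \<le> t * f X + (1 - t) * f Y \<and> \<rho>1 W - \<alpha> \<le> t * (\<rho>1 X - \<alpha>) + (1 - t) * (\<rho>1 Y - \<alpha>)"
    if XY: "X \<in> ?D" "Y \<in> ?D" and t: "0 \<le> t" "t \<le> 1" for X Y t
  proof (rule bexI[OF _ Lbox_convex[OF XY t]], rule conjI)
    have L: "X \<in> Linf M" "Y \<in> Linf M" using XY by (auto simp: Lbox_def)
    have "(\<lambda>\<omega>. K2 \<omega> - (t * X \<omega> + (1 - t) * Y \<omega>)) = (\<lambda>\<omega>. t * (K2 \<omega> - X \<omega>) + (1 - t) * (K2 \<omega> - Y \<omega>))"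
      by (auto simp: algebra_simps)
    then show "f (\<lambda>\<omega>. t * X \<omega> + (1 - t) * Y \<omega>) \<le> t * f X + (1 - t) * f Y"
      using convex_expectation_convex[OF \<rho>2(1) Linf_diff[OF K(2) L(1)] Linf_diff[OF K(2) L(2)] t]
      by (simp add: f_def)
    show "\<rho>1 (\<lambda>\<omega>. t * X \<omega> + (1 - t) * Y \<omega>) - \<alpha> \<le> t * (\<rho>1 X - \<alpha>) + (1 - t) * (\<rho>1 Y - \<alpha>)"
      using convex_expectation_convex[OF \<rho>1(1) L t] by (simp add: algebra_simps)
  qed
  obtain l where l: "0 \<le> l" "\<And>X. X \<in> ?D \<Longrightarrow> V \<le> f X + l * (\<rho>1 X - \<alpha>)"
  proof (rule lagrange_multiplier[of K1 ?D "\<lambda>X. \<rho>1 X - \<alpha>" V f])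
    show "\<rho>1 K1 - \<alpha> < 0" using slater by simp
    show "V \<le> f X" if "X \<in> ?D" "\<rho>1 X - \<alpha> \<le> 0" for X using V_le[of X] that by (simp add: T_iff)
  qed (use K1D conv in blast)+
  have Vl: "V + l * \<alpha> \<le> l * \<rho>1 X + \<rho>2 (\<lambda>\<omega>. K2 \<omega> - X \<omega>)" if "X \<in> ?D" for X
    using l(2)[OF that] by (simp add: f_def algebra_simps)
  have range': "AE \<omega> in M. 0 \<le> K1 \<omega> \<and> K1 \<omega> \<le> K2 \<omega> \<and> K2 \<omega> \<le> K2 \<omega> \<and> K2 \<omega> \<le> K"
    using range by eventually_elim auto
  obtain g h where g: "g \<in> density_level_set M \<rho>1 u" and h: "h \<in> density_level_set M \<rho>2 v"
    and dual: "\<And>X Y Z. X \<in> ?D \<Longrightarrow> Y \<in> Linf M \<Longrightarrow> Z \<in> Linf M \<Longrightarrow>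
      V + l * \<alpha> \<le> l * ((LINT \<omega>|M. g \<omega> * (X \<omega> - Y \<omega>)) + \<rho>1 Y) +
        ((LINT \<omega>|M. h \<omega> * (K2 \<omega> - X \<omega> - Z \<omega>)) + \<rho>2 Z)"
    using dual_densities[OF \<rho>1 \<rho>2 K(1) K(2) K(2) range' u v closed1 closed2 l(1) Vl] by blast
  have int: "integrable M g" "integrable M h"
    using g h by (auto simp: density_level_set_iff prob_density_def)
  show thesis
  proof (rule that[OF g h l(1)])
    fix X assume "optimal_test M \<rho>1 \<rho>2 K1 K2 \<alpha> X"
    then have X: "X \<in> ?D" "\<rho>1 X \<le> \<alpha>" and fX: "f X = V"
      by (auto simp: optimal_test_def T_iff f_def V_def)
    have XL: "X \<in> Linf M" using X(1) by (rule Lbox_Linf)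
    have "l * \<rho>1 X \<le> l * \<alpha>" using X(2) l(1) by (rule mult_left_mono)
    have "AE \<omega> in M. (0 < l * g \<omega> - h \<omega> \<longrightarrow> X \<omega> = K1 \<omega>) \<and> (l * g \<omega> - h \<omega> < 0 \<longrightarrow> X \<omega> = K2 \<omega>)"
    proof (rule bang_bang[OF _ K X(1)])
      show "integrable M (\<lambda>\<omega>. l * g \<omega> - h \<omega>)" using int by simp
      fix Y assume Y: "Y \<in> ?D"
      have YL: "Y \<in> Linf M" using Y by (rule Lbox_Linf)
      note i = integrable_mult_Linf[OF int(1) XL] integrable_mult_Linf[OF int(1) YL]
        integrable_mult_Linf[OF int(2) XL] integrable_mult_Linf[OF int(2) YL]
      have split: "(LINT \<omega>|M. (l * g \<omega> - h \<omega>) * Z \<omega>) = l * (LINT \<omega>|M. g \<omega> * Z \<omega>) - (LINT \<omega>|M. h \<omega> * Z \<omega>)"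
        if "integrable M (\<lambda>\<omega>. g \<omega> * Z \<omega>)" "integrable M (\<lambda>\<omega>. h \<omega> * Z \<omega>)" for Z
        using that by (simp add: left_diff_distrib mult.assoc)
      \<comment> \<open>The dual inequality at \<open>Y\<close>, with the two free functions set to
        \<open>X\<close> and \<open>K2 - X\<close>. By optimality \<open>f X = V\<close>, and
        feasibility gives \<open>l * \<rho>1 X \<le> l * \<alpha>\<close>; after cancellation only
        the integrals against \<open>g\<close> and \<open>h\<close> remain.\<close>
      have "V + l * \<alpha> \<le> l * ((LINT \<omega>|M. g \<omega> * (Y \<omega> - X \<omega>)) + \<rho>1 X) +
          ((LINT \<omega>|M. h \<omega> * (K2 \<omega> - Y \<omega> - (K2 \<omega> - X \<omega>))) + f X)"
        unfolding f_def by (rule dual[OF Y XL Linf_diff[OF K(2) XL]])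
      also have "(LINT \<omega>|M. g \<omega> * (Y \<omega> - X \<omega>)) = (LINT \<omega>|M. g \<omega> * Y \<omega>) - (LINT \<omega>|M. g \<omega> * X \<omega>)"
        using i by (simp add: right_diff_distrib)
      also have "(LINT \<omega>|M. h \<omega> * (K2 \<omega> - Y \<omega> - (K2 \<omega> - X \<omega>))) = (LINT \<omega>|M. h \<omega> * X \<omega>) - (LINT \<omega>|M. h \<omega> * Y \<omega>)"
        using i by (simp add: right_diff_distrib)
      finally show "(LINT \<omega>|M. (l * g \<omega> - h \<omega>) * X \<omega>) \<le> (LINT \<omega>|M. (l * g \<omega> - h \<omega>) * Y \<omega>)"
        unfolding split[OF i(1,3)] split[OF i(2,4)]
        using \<open>l * \<rho>1 X \<le> l * \<alpha>\<close> fX by (simp add: algebra_simps)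
    qed
    then show "AE \<omega> in M. (h \<omega> < l * g \<omega> \<longrightarrow> X \<omega> = K1 \<omega>) \<and> (l * g \<omega> < h \<omega> \<longrightarrow> X \<omega> = K2 \<omega>)"
      by eventually_elim auto
  qed
qed

text \<open>
  Duality on the one-point box \<open>[K1, K1]\<close> gives a density \<open>g\<close> attaining \<open>\<rho>1 K1\<close>; a test that exceeds
  \<open>K1\<close> where \<open>g > 0\<close> would violate the constraint.
\<close>

lemma (in prob_space) test_without_slater:
  assumes \<rho>1: "convex_expectation M \<rho>1" "continuous_from_below M \<rho>1"
    and \<rho>2: "convex_expectation M \<rho>2" "continuous_from_below M \<rho>2"
    and K: "K1 \<in> Linf M" "K2 \<in> Linf M"
    and range: "AE \<omega> in M. 0 \<le> K1 \<omega> \<and> K1 \<omega> \<le> K2 \<omega> \<and> K2 \<omega> \<le> K"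
    and \<alpha>: "\<rho>1 K1 = \<alpha>"
    and u: "K - \<rho>1 (\<lambda>_. 0) + 1 < u" and v: "K - \<rho>2 (\<lambda>_. 0) + 1 < v"
    and closed1: "closed_under_ae_convergence M (density_level_set M \<rho>1 u)"
    and closed2: "closed_under_ae_convergence M (density_level_set M \<rho>2 v)"
  obtains g h where "g \<in> density_level_set M \<rho>1 u" "h \<in> density_level_set M \<rho>2 v"
    "\<And>X. X \<in> tests M \<rho>1 K1 K2 \<alpha> \<Longrightarrow> AE \<omega> in M. 0 < g \<omega> \<longrightarrow> X \<omega> = K1 \<omega>"
proof -
  let ?D = "Lbox M K1 K1"
  define V where "V = 1 * \<rho>1 K1 + \<rho>2 (\<lambda>\<omega>. K2 \<omega> - K1 \<omega>)"
  have K1D: "K1 \<in> ?D" using K by (simp add: Lbox_def)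
  have V: "V \<le> 1 * \<rho>1 X + \<rho>2 (\<lambda>\<omega>. K2 \<omega> - X \<omega>)" if "X \<in> ?D" for X
  proof -
    have XL: "X \<in> Linf M" using that by (rule Lbox_Linf)
    have "AE \<omega> in M. K1 \<omega> \<le> X \<omega> \<and> X \<omega> \<le> K1 \<omega>" using that unfolding Lbox_def by blast
    then have eq: "AE \<omega> in M. X \<omega> = K1 \<omega>" by eventually_elim auto
    have "\<rho>1 K1 \<le> \<rho>1 X"
      using eq by (intro convex_expectation_mono[OF \<rho>1(1) K(1) XL]) (auto elim!: eventually_mono)
    moreover have "\<rho>2 (\<lambda>\<omega>. K2 \<omega> - K1 \<omega>) \<le> \<rho>2 (\<lambda>\<omega>. K2 \<omega> - X \<omega>)"
      using eq by (intro convex_expectation_mono[OF \<rho>2(1)] Linf_diff K XL) (auto elim!: eventually_mono)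
    ultimately show ?thesis by (simp add: V_def)
  qed
  have range': "AE \<omega> in M. 0 \<le> K1 \<omega> \<and> K1 \<omega> \<le> K1 \<omega> \<and> K1 \<omega> \<le> K2 \<omega> \<and> K2 \<omega> \<le> K"
    using range by eventually_elim auto
  obtain g h where g: "g \<in> density_level_set M \<rho>1 u" and h: "h \<in> density_level_set M \<rho>2 v"
    and dual: "\<And>X Y Z. X \<in> ?D \<Longrightarrow> Y \<in> Linf M \<Longrightarrow> Z \<in> Linf M \<Longrightarrow>
      V \<le> 1 * ((LINT \<omega>|M. g \<omega> * (X \<omega> - Y \<omega>)) + \<rho>1 Y) +
        ((LINT \<omega>|M. h \<omega> * (K2 \<omega> - X \<omega> - Z \<omega>)) + \<rho>2 Z)"
    using dual_densities[OF \<rho>1 \<rho>2 K(1) K(1) K(2) range' u v closed1 closed2 zero_le_one V] by blast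
  have gd: "integrable M g" "AE \<omega> in M. 0 \<le> g \<omega>"
    using g by (auto simp: density_level_set_iff prob_density_def)
  show thesis
  proof (rule that[OF g h])
    fix X assume X: "X \<in> tests M \<rho>1 K1 K2 \<alpha>"
    then have XL: "X \<in> Linf M" and X_AE: "AE \<omega> in M. K1 \<omega> \<le> X \<omega>" and "\<rho>1 X \<le> \<alpha>"
      by (auto simp: tests_def)
    have int: "integrable M (\<lambda>\<omega>. g \<omega> * (X \<omega> - K1 \<omega>))"
      using gd(1) XL K(1) by (intro integrable_mult_Linf Linf_diff)
    have nn: "AE \<omega> in M. 0 \<le> g \<omega> * (X \<omega> - K1 \<omega>)" using X_AE gd(2) by eventually_elim simp
    \<comment> \<open>The choice \<open>Z = K2 - K1\<close> cancels the \<open>\<rho>2\<close> part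
      and leaves \<open>\<rho>1 K1 \<le> E[g (K1 - X)] + \<rho>1 X\<close>. As
      \<open>\<rho>1 X \<le> \<alpha> = \<rho>1 K1\<close>, the integral of
      \<open>g (X - K1)\<close> is at most 0.\<close>
    have "V \<le> (LINT \<omega>|M. g \<omega> * (K1 \<omega> - X \<omega>)) + \<rho>1 X + \<rho>2 (\<lambda>\<omega>. K2 \<omega> - K1 \<omega>)"
      using dual[OF K1D XL Linf_diff[OF K(2) K(1)]] by simp
    moreover have "(LINT \<omega>|M. g \<omega> * (K1 \<omega> - X \<omega>)) = - (LINT \<omega>|M. g \<omega> * (X \<omega> - K1 \<omega>))"
      by (subst integral_minus[symmetric]) (simp add: algebra_simps)
    ultimately have "(LINT \<omega>|M. g \<omega> * (X \<omega> - K1 \<omega>)) = 0"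
      using \<open>\<rho>1 X \<le> \<alpha>\<close> \<alpha> integral_nonneg_AE[OF nn] by (simp add: V_def)
    then have "AE \<omega> in M. g \<omega> * (X \<omega> - K1 \<omega>) = 0"
      using integral_nonneg_eq_0_iff_AE[OF int nn] by simp
    then show "AE \<omega> in M. 0 < g \<omega> \<longrightarrow> X \<omega> = K1 \<omega>" by eventually_elim auto
  qed
qed

theorem theorem4p13:
  fixes \<mu> :: "'a measure"
    and \<rho>1 \<rho>2 :: "('a \<Rightarrow> real) \<Rightarrow> real"
    and K1 K2 :: "'a \<Rightarrow> real"
    and \<alpha> u v :: real
  assumes "prob_space \<mu>"
    and "convex_expectation \<mu> \<rho>1"
    and "convex_expectation \<mu> \<rho>2"
    and "K1 \<in> Linf \<mu>"
    and "K2 \<in> Linf \<mu>"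
    and "AE \<omega> in \<mu>. 0 \<le> K1 \<omega> \<and> K1 \<omega> < K2 \<omega>"
    and "\<rho>1 K1 \<le> \<alpha>"
    and "\<alpha> \<le> \<rho>1 K2"
    and "continuous_from_below \<mu> \<rho>1"
    and "continuous_from_below \<mu> \<rho>2"
    and "u > max 0 (Linf_norm \<mu> K2 - \<rho>1 (\<lambda>_. 0) + 1)"
    and "v > max 0 (Linf_norm \<mu> K2 - \<rho>2 (\<lambda>_. 0) + 1)"
    and "closed_under_ae_convergence \<mu> (density_level_set \<mu> \<rho>1 u)"
    and "closed_under_ae_convergence \<mu> (density_level_set \<mu> \<rho>2 v)"
  shows "\<exists>P\<in>finite_penalty_probs \<mu> \<rho>1. \<exists>Q\<in>finite_penalty_probs \<mu> \<rho>2.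
    \<forall>X. optimal_test \<mu> \<rho>1 \<rho>2 K1 K2 \<alpha> X \<longrightarrow>
      (\<exists>z::ennreal. \<exists>B\<in>borel_measurable \<mu>.
         (AE \<omega> in \<mu>. K1 \<omega> \<le> B \<omega> \<and> B \<omega> \<le> K2 \<omega>) \<and>
         (AE \<omega> in \<mu>. X \<omega> =
            K2 \<omega> * indicator (set_gt \<mu> z (dens \<mu> Q) (dens \<mu> P)) \<omega> +
            B \<omega> * indicator (set_eq \<mu> z (dens \<mu> Q) (dens \<mu> P)) \<omega> +
            K1 \<omega> * indicator (set_lt \<mu> z (dens \<mu> Q) (dens \<mu> P)) \<omega>))"
proof -
  interpret prob_space \<mu> by fact
  note \<rho>1 = assms(2) assms(9) and \<rho>2 = assms(3) assms(10) and K = assms(4,5)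
  define N where "N = Linf_norm \<mu> K2"
  have range: "AE \<omega> in \<mu>. 0 \<le> K1 \<omega> \<and> K1 \<omega> \<le> K2 \<omega> \<and> K2 \<omega> \<le> N"
    using assms(6) AE_le_Linf_norm[OF K(2)] unfolding N_def by eventually_elim auto
  have u: "N - \<rho>1 (\<lambda>_. 0) + 1 < u" and v: "N - \<rho>2 (\<lambda>_. 0) + 1 < v"
    using assms(11,12) by (auto simp: N_def)
  \<comment> \<open>Level sets contain all representatives, so a density found above agrees with
    \<open>dens\<close> of an actual measure only a.e.\<close>
  have level: "\<exists>P\<in>finite_penalty_probs \<mu> \<rho>. AE \<omega> in \<mu>. dens \<mu> P \<omega> = g \<omega>"
    if "g \<in> density_level_set \<mu> \<rho> c" for g \<rho> c
    using that by (auto simp: density_level_set_def elim!: eventually_mono bexI[rotated])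
  have test: "X \<in> borel_measurable \<mu>" "AE \<omega> in \<mu>. K1 \<omega> \<le> X \<omega> \<and> X \<omega> \<le> K2 \<omega>" "X \<in> tests \<mu> \<rho>1 K1 K2 \<alpha>"
    if "optimal_test \<mu> \<rho>1 \<rho>2 K1 K2 \<alpha> X" for X
    using that by (auto simp: optimal_test_def tests_def Linf_def)
  show ?thesis
  proof (cases "\<rho>1 K1 < \<alpha>")
    case True
    obtain g h l where g: "g \<in> density_level_set \<mu> \<rho>1 u" and h: "h \<in> density_level_set \<mu> \<rho>2 v"
      and l: "0 \<le> l" and opt: "\<And>X. optimal_test \<mu> \<rho>1 \<rho>2 K1 K2 \<alpha> X \<Longrightarrow>
        AE \<omega> in \<mu>. (h \<omega> < l * g \<omega> \<longrightarrow> X \<omega> = K1 \<omega>) \<and> (l * g \<omega> < h \<omega> \<longrightarrow> X \<omega> = K2 \<omega>)"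
      using optimal_test_slater[OF \<rho>1 \<rho>2 K range True u v assms(13,14)] by blast
    obtain P where P: "P \<in> finite_penalty_probs \<mu> \<rho>1" "AE \<omega> in \<mu>. dens \<mu> P \<omega> = g \<omega>"
      using level[OF g] by blast
    obtain Q where Q: "Q \<in> finite_penalty_probs \<mu> \<rho>2" "AE \<omega> in \<mu>. dens \<mu> Q \<omega> = h \<omega>"
      using level[OF h] by blast
    show ?thesis
    proof (intro bexI[OF _ P(1)] bexI[OF _ Q(1)] allI impI)
      fix X assume X: "optimal_test \<mu> \<rho>1 \<rho>2 K1 K2 \<alpha> X"
      show "\<exists>z::ennreal. \<exists>B\<in>borel_measurable \<mu>.
         (AE \<omega> in \<mu>. K1 \<omega> \<le> B \<omega> \<and> B \<omega> \<le> K2 \<omega>) \<and>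
         (AE \<omega> in \<mu>. X \<omega> =
            K2 \<omega> * indicator (set_gt \<mu> z (dens \<mu> Q) (dens \<mu> P)) \<omega> +
            B \<omega> * indicator (set_eq \<mu> z (dens \<mu> Q) (dens \<mu> P)) \<omega> +
            K1 \<omega> * indicator (set_lt \<mu> z (dens \<mu> Q) (dens \<mu> P)) \<omega>)"
      \<comment> \<open>The test itself serves as \<open>B\<close>, since on the set of equality
        only \<open>K1 \<le> B \<le> K2\<close> is demanded.\<close>
      proof (intro exI[of _ "ennreal l"] bexI[OF _ test(1)[OF X]] conjI test(2)[OF X])
        show "AE \<omega> in \<mu>. X \<omega> =
            K2 \<omega> * indicator (set_gt \<mu> (ennreal l) (dens \<mu> Q) (dens \<mu> P)) \<omega> +
            X \<omega> * indicator (set_eq \<mu> (ennreal l) (dens \<mu> Q) (dens \<mu> P)) \<omega> +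
            K1 \<omega> * indicator (set_lt \<mu> (ennreal l) (dens \<mu> Q) (dens \<mu> P)) \<omega>"
          using opt[OF X] P(2) Q(2) AE_space
          by eventually_elim
            (use l in \<open>auto simp: set_gt_def set_eq_def set_lt_def indicator_def not_less\<close>)
      qed
    qed
  next
    case False
    then have \<alpha>: "\<rho>1 K1 = \<alpha>" using assms(7) by simp
    obtain g h where g: "g \<in> density_level_set \<mu> \<rho>1 u" and h: "h \<in> density_level_set \<mu> \<rho>2 v"
      and opt: "\<And>X. X \<in> tests \<mu> \<rho>1 K1 K2 \<alpha> \<Longrightarrow> AE \<omega> in \<mu>. 0 < g \<omega> \<longrightarrow> X \<omega> = K1 \<omega>"
      using test_without_slater[OF \<rho>1 \<rho>2 K range \<alpha> u v assms(13,14)] by blast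
    obtain P where P: "P \<in> finite_penalty_probs \<mu> \<rho>1" "AE \<omega> in \<mu>. dens \<mu> P \<omega> = g \<omega>"
      using level[OF g] by blast
    obtain Q where Q: "Q \<in> finite_penalty_probs \<mu> \<rho>2"
      using level[OF h] by blast
    show ?thesis
    proof (intro bexI[OF _ P(1)] bexI[OF _ Q] allI impI)
      fix X assume X: "optimal_test \<mu> \<rho>1 \<rho>2 K1 K2 \<alpha> X"
      show "\<exists>z::ennreal. \<exists>B\<in>borel_measurable \<mu>.
         (AE \<omega> in \<mu>. K1 \<omega> \<le> B \<omega> \<and> B \<omega> \<le> K2 \<omega>) \<and>
         (AE \<omega> in \<mu>. X \<omega> =
            K2 \<omega> * indicator (set_gt \<mu> z (dens \<mu> Q) (dens \<mu> P)) \<omega> +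
            B \<omega> * indicator (set_eq \<mu> z (dens \<mu> Q) (dens \<mu> P)) \<omega> +
            K1 \<omega> * indicator (set_lt \<mu> z (dens \<mu> Q) (dens \<mu> P)) \<omega>)"
      \<comment> \<open>With \<open>z = \<infinity>\<close> the first set is empty and the other two
        are \<open>{G = 0}\<close> and \<open>{G > 0}\<close>, so the formula with
        \<open>B = X\<close> says exactly that \<open>X = K1\<close> where
        \<open>G > 0\<close>.\<close>
      proof (intro exI[of _ \<infinity>] bexI[OF _ test(1)[OF X]] conjI test(2)[OF X])
        show "AE \<omega> in \<mu>. X \<omega> =
            K2 \<omega> * indicator (set_gt \<mu> \<infinity> (dens \<mu> Q) (dens \<mu> P)) \<omega> +
            X \<omega> * indicator (set_eq \<mu> \<infinity> (dens \<mu> Q) (dens \<mu> P)) \<omega> +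
            K1 \<omega> * indicator (set_lt \<mu> \<infinity> (dens \<mu> Q) (dens \<mu> P)) \<omega>"
          using opt[OF test(3)[OF X]] P(2) AE_space
        proof eventually_elim
          case (elim \<omega>)
          \<comment> \<open>\<open>enn2real\<close> makes \<open>dens\<close> nonnegative
            everywhere, so \<open>{G = 0}\<close> and \<open>{G > 0}\<close> cover the
            space.\<close>
          have "0 \<le> dens \<mu> P \<omega>" by (simp add: dens_def)
          then show ?case using elim by (auto simp: set_gt_def set_eq_def set_lt_def indicator_def)
        qed
      qed
    qed
  qed
qed

end
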